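(* Let $X,Y$ be compact metric spaces, let $T:X\to X$ and $S:Y\to Y$ be Borel maps, and let $\pi:X\to Y$ be a continuous onto map with $\pi\circ T=S\circ\pi$. Assume that $T$ is $L$-Lipschitz with $L\ge1$, that $\pi$ is $\beta$-Hölder and admits a Lipschitz section $\sigma:Y\to X$ (i.e. $\pi\sigma=\mathrm{Id}_Y$), and let $\mathscr T\in\{\varnothing,\mathrm{LIL},\mathrm{CLT},\mathrm{ASIP}\}$ and $\rho\in(0,\infty]$. 1. Assume that the fibers are exponentially shrinking with ratio $\theta$, let $\alpha\in(0,1]$ and set $\gamma=\frac{\alpha\beta}{1-\log L/\log\theta}$. If $S$ satisfies $\mathrm{UE}(\omega_\gamma[\rho];\mathscr T,\omega_* )$ then $T$ satisfies $\mathrm{UE}(\omega_\alpha[C\rho];\mathscr T,\omega_* )$ for some $C>0$. 2. Assume that the fibers are polynomially shrinking with degree $d>1$, consider $\alpha,\gamma\in(1/d,1]$ and set $\alpha'=\alpha d-1$ and $\gamma'=\gamma d-1$. If $S$ satisfies $\mathrm{UE}(\omega_{\alpha'\log}[\rho];\mathscr T,\omega_{\gamma'\log})$, then $T$ satisfies $\mathrm{UE}(\omega_\alpha[C\rho];\mathscr T,\omega_\gamma)$ for some $C>0$. 3. Assume that the fibers are exponentially shrinking, consider $\alpha,\gamma>1$ and let $\alpha'=(\alpha-1)/2$ and $\gamma'=(\gamma-1)/2$. If $S$ satisfies $\mathrm{UE}(\omega_{\alpha'\log}[\rho];\mathscr T,\omega_{\gamma'\log})$ then $T$ satisfies $\mathrm{UE}(\omega_{\alpha\log}[C\rho];\mathscr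 T,\omega_{\gamma\log})$ for some $C>0$.
   Context: Moduli. A modulus of continuity is a continuous, increasing (not necessarily strictly), concave function $\omega:[0,\infty)\to[0,\infty)$ with $\omega(0)=0$. $f:X\to\mathbb R$ is $\omega$-continuous if $|f(x)-f(x')|\le C\omega(d(x,x'))$ for some $C$ and all $x,x'$; $\mathrm{Hol}_\omega(f)$ is the infimum of such $C$, $\mathrm{Hol}_\omega(X)$ is the space of such functions, with norm $\|f\|_\omega=\|f\|_\infty+\mathrm{Hol}_\omega(f)$. For $\alpha\in(0,1]$, $\omega_\alpha(r)=r^\alpha$. For $\alpha>0$, $\omega_{\alpha\log}(r)=\big(\log\frac{r_\alpha}{r}\big)^{-\alpha}$ on $(0,1]$ with $r_\alpha>1$ large enough to ensure monotonicity and concavity, $\omega_{\alpha\log}(0)=0$, constant for $r\ge1$. Shrinking. $T$ is uniformly continuous along fibers if $d(Tx,Tx')\le\bar\omega_T(d(x,x'))$ for some modulus $\bar\omega_T$ whenever $\pi(x)=\pi(x')$. The fibers are $(a_n)_n$-shrinking if moreover $(a_n)$ is a sequence of positive numbers with $a_n\to0$ and $d(T^nx,T^nx')\le a_n$ for all $n$ and all $x,x'$ with $\pi(x)=\pi(x')$. They are exponentially shrinking with ratio $\theta\in(0,1)$ if one can take $a_n=C\theta^n$, polynomially shrinking with degree $d>0$ if one can take $a_n=Cn^{-d}$. Property UE. Let $\omega_p,\omega_o$ be moduli of continuity. $T$ satisfies $\mathrm{UE}(\omega_p[\rho];\mathscr T,\omega_o)$ when (i) for every potential $\varphi\in\mathrm{Hol}_{\omega_p}(X)$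 with $\|\varphi\|_{\omega_p}<\rho$ there is a unique equilibrium state $\mu_\varphi$, i.e. a maximizer of $h_{\mathrm{KS}}(T,\mu)+\mu(\varphi)$ over all $T$-invariant probability measures $\mu$ ($h_{\mathrm{KS}}$ is Kolmogorov–Sinai entropy and $\mu(\varphi)=\int\varphi\,d\mu$), and (ii) $\mu_\varphi$ satisfies $\mathscr T$ for all $\omega_o$-continuous observables. If $\mathscr T=\varnothing$, only (i) is required. Writing $\omega_*$ in place of $\omega_o$ means that (ii) holds for all Hölder-continuous observables, whatever the Hölder exponent. Similarly for $S$ on $Y$. Limit theorems. A $T$-invariant probability $\mu$ satisfies $\mathscr T$ for all $\omega$-continuous observables if for each $f\in\mathrm{Hol}_\omega(X)$ there is $s_f\ge0$ such that, whenever $s_f>0$: - LIL: for $\mu$-a.e. $x$, $\limsup_n\frac{\sum_{k=1}^nf(T^kx)-n\mu(f)}{\sqrt{2n\log\log n}}=s_f$; - CLT: for all $r\in\mathbb R$, $\mu\{x:\frac1{\sqrt n}\big(\sum_{k=1}^nf(T^kx)-n\mu(f)\big)\le r\}\to G_{0,s_f^2}(r)$, where $G_{m,s^2}$ is the cumulative distribution function of the normal law of mean $m$ and variance $s^2$; - ASIP: for some $\lambda\in(0,\frac12]$ there are, on some probability space, a process $(A_k)_k$ with the law of $(f\circ T^k(Z))_k$, $Z$ of law $\mu$, and a sequence $(B_k)_k$ of independent Gaussian variables of mean $\mu(f)$ and variance $s_f^2$, such that almost surely $|\sum_{k=1}^nA_k-\sum_{k=1}^nB_k|=o(n^\lambda)$.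 Convention on parameters. The data $s_f$ (and $\lambda$ for the ASIP) is part of the limit theorem. A statement that a UE property of $S$ implies a UE property of $T$ also means that the equilibrium state $\mu_\varphi$ of a potential $\varphi$ and $\check\mu=\pi_*\mu_\varphi$ (an equilibrium state of $S$ for a potential $\check\varphi$) satisfy $\mathscr T$ with the same parameters under the correspondence $f\mapsto\check f$, i.e. $s_f=s_{\check f}$ and the same $\lambda$. This correspondence (for both potentials and observables) is: $h=\sum_{n\ge0}(f\circ T^n\circ\sigma\circ\pi-f\circ T^n)$, $\hat f=f+h-h\circ T$ (which is constant on fibers), $\check f=\hat f\circ\sigma$. *)

theory Defs
  imports "HOL-Probability.Probability" "HOL-Library.Landau_Symbols"
begin

text \<open>Moduli are functions on $[0,\infty)$; their values at negative reals are irrelevant.\<close>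

definition is_modulus :: "(real \<Rightarrow> real) \<Rightarrow> bool" where
  "is_modulus \<omega> \<longleftrightarrow> \<omega> \<in> {0..} \<rightarrow> {0..} \<and> continuous_on {0..} \<omega> \<and> mono_on {0..} \<omega> \<and>
     concave_on {0..} \<omega> \<and> \<omega> 0 = 0"

definition mod_continuous :: "(real \<Rightarrow> real) \<Rightarrow> ('a::metric_space \<Rightarrow> 'b::metric_space) \<Rightarrow> bool" where
  "mod_continuous \<omega> f \<longleftrightarrow> (\<exists>C. \<forall>x x'. dist (f x) (f x') \<le> C * \<omega> (dist x x'))"

definition Hol_space :: "(real \<Rightarrow> real) \<Rightarrow> ('a::metric_space \<Rightarrow> real) set" where
  "Hol_space \<omega> = {f. mod_continuous \<omega> f}"

text \<open>The constraint \<open>0 \<le> C\<close> matters only on a one-point space, where every real \<open>C\<close> would qualify.\<close>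

definition Hol_const :: "(real \<Rightarrow> real) \<Rightarrow> ('a::metric_space \<Rightarrow> real) \<Rightarrow> real" where
  "Hol_const \<omega> f = Inf {C. 0 \<le> C \<and> (\<forall>x x'. \<bar>f x - f x'\<bar> \<le> C * \<omega> (dist x x'))}"

definition Hol_norm :: "(real \<Rightarrow> real) \<Rightarrow> ('a::metric_space \<Rightarrow> real) \<Rightarrow> real" where
  "Hol_norm \<omega> f = (SUP x. \<bar>f x\<bar>) + Hol_const \<omega> f"

definition pow_modulus :: "real \<Rightarrow> real \<Rightarrow> real" where
  "pow_modulus \<alpha> t = t powr \<alpha>"

text \<open>The first argument of \<open>log_modulus\<close> is the constant called $r_\alpha$; it is admissible
  when the resulting function is a modulus, which is the case for instance if it is at least
  $e^{\alpha+1}$.\<close>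

definition log_modulus :: "real \<Rightarrow> real \<Rightarrow> real \<Rightarrow> real" where
  "log_modulus r \<alpha> t = (if t = 0 then 0 else ln (r / min t 1) powr (- \<alpha>))"

definition admissible_log_const :: "real \<Rightarrow> real \<Rightarrow> bool" where
  "admissible_log_const r \<alpha> \<longleftrightarrow> r > 1 \<and> is_modulus (log_modulus r \<alpha>)"

text \<open>The observables meant by the index $\omega_*$: Hoelder functions of arbitrary exponent.\<close>

definition Holder_functions :: "('a::metric_space \<Rightarrow> real) set" where
  "Holder_functions = (\<Union>\<alpha>\<in>{0<..1}. Hol_space (pow_modulus \<alpha>))"

definition uniformly_continuous_along_fibers ::
    "('x::metric_space \<Rightarrow> 'x) \<Rightarrow> ('x \<Rightarrow> 'y) \<Rightarrow> bool" where
  "uniformly_continuous_along_fibers T p \<longleftrightarrow>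
     (\<exists>\<omega>. is_modulus \<omega> \<and> (\<forall>x x'. p x = p x' \<longrightarrow> dist (T x) (T x') \<le> \<omega> (dist x x')))"

definition shrinking_fibers ::
    "('x::metric_space \<Rightarrow> 'x) \<Rightarrow> ('x \<Rightarrow> 'y) \<Rightarrow> (nat \<Rightarrow> real) \<Rightarrow> bool" where
  "shrinking_fibers T p a \<longleftrightarrow> uniformly_continuous_along_fibers T p \<and>
     (\<forall>n. a n > 0) \<and> a \<longlonglongrightarrow> 0 \<and>
     (\<forall>n x x'. p x = p x' \<longrightarrow> dist ((T ^^ n) x) ((T ^^ n) x') \<le> a n)"

definition exp_shrinking_fibers ::
    "('x::metric_space \<Rightarrow> 'x) \<Rightarrow> ('x \<Rightarrow> 'y) \<Rightarrow> real \<Rightarrow> bool" where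
  "exp_shrinking_fibers T p \<theta> \<longleftrightarrow> 0 < \<theta> \<and> \<theta> < 1 \<and>
     (\<exists>C. shrinking_fibers T p (\<lambda>n. C * \<theta> ^ n))"

text \<open>The value $a_0$ is left free, since $n^{-d}$ makes no sense for $n = 0$.\<close>

definition poly_shrinking_fibers ::
    "('x::metric_space \<Rightarrow> 'x) \<Rightarrow> ('x \<Rightarrow> 'y) \<Rightarrow> real \<Rightarrow> bool" where
  "poly_shrinking_fibers T p d \<longleftrightarrow> 0 < d \<and>
     (\<exists>a C. shrinking_fibers T p a \<and> (\<forall>n\<ge>1. a n = C * real n powr (- d)))"

definition invariant_prob :: "('x::topological_space \<Rightarrow> 'x) \<Rightarrow> 'x measure \<Rightarrow> bool" where
  "invariant_prob T \<mu> \<longleftrightarrow> sets \<mu> = sets borel \<and> prob_space \<mu> \<and> distr \<mu> borel T = \<mu>"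

definition finite_measurable_partitions :: "'x measure \<Rightarrow> 'x set set set" where
  "finite_measurable_partitions \<mu> = {P. finite P \<and> P \<subseteq> sets \<mu> \<and> partition_on (space \<mu>) P}"

text \<open>Natural logarithm, with $0 \log 0 = 0$.\<close>

definition partition_entropy :: "'x measure \<Rightarrow> 'x set set \<Rightarrow> real" where
  "partition_entropy \<mu> P = - (\<Sum>A\<in>P. measure \<mu> A * ln (measure \<mu> A))"

text \<open>$\bigvee_{k<n} T^{-k} P$.\<close>

definition iterated_partition ::
    "('x \<Rightarrow> 'x) \<Rightarrow> 'x measure \<Rightarrow> 'x set set \<Rightarrow> nat \<Rightarrow> 'x set set" where
  "iterated_partition T \<mu> P n =
     common_refinement ((\<lambda>k. (\<lambda>A. (T ^^ k) -` A \<inter> space \<mu>) ` P) ` {..<n})"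

definition entropy_rate :: "('x \<Rightarrow> 'x) \<Rightarrow> 'x measure \<Rightarrow> 'x set set \<Rightarrow> real" where
  "entropy_rate T \<mu> P = lim (\<lambda>n. partition_entropy \<mu> (iterated_partition T \<mu> P n) / real n)"

definition KS_entropy :: "('x \<Rightarrow> 'x) \<Rightarrow> 'x measure \<Rightarrow> ereal" where
  "KS_entropy T \<mu> = (SUP P\<in>finite_measurable_partitions \<mu>. ereal (entropy_rate T \<mu> P))"

definition equilibrium_state ::
    "('x::topological_space \<Rightarrow> 'x) \<Rightarrow> ('x \<Rightarrow> real) \<Rightarrow> 'x measure \<Rightarrow> bool" where
  "equilibrium_state T \<phi> \<mu> \<longleftrightarrow> invariant_prob T \<mu> \<and>
     (\<forall>\<nu>. invariant_prob T \<nu> \<longrightarrow>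
        KS_entropy T \<nu> + ereal (\<integral>x. \<phi> x \<partial>\<nu>) \<le> KS_entropy T \<mu> + ereal (\<integral>x. \<phi> x \<partial>\<mu>))"

datatype limit_theorem = No_Limit_Theorem | LIL | CLT | ASIP

definition LIL_holds :: "('x \<Rightarrow> 'x) \<Rightarrow> 'x measure \<Rightarrow> ('x \<Rightarrow> real) \<Rightarrow> real \<Rightarrow> bool" where
  "LIL_holds T \<mu> f s \<longleftrightarrow>
     (AE x in \<mu>. limsup (\<lambda>n. ereal (((\<Sum>k=1..n. f ((T ^^ k) x)) - real n * (\<integral>y. f y \<partial>\<mu>))
        / sqrt (2 * real n * ln (ln (real n))))) = ereal s)"

definition CLT_holds :: "('x \<Rightarrow> 'x) \<Rightarrow> 'x measure \<Rightarrow> ('x \<Rightarrow> real) \<Rightarrow> real \<Rightarrow> bool" where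
  "CLT_holds T \<mu> f s \<longleftrightarrow>
     (\<forall>r. (\<lambda>n. measure \<mu> {x \<in> space \<mu>.
         ((\<Sum>k=1..n. f ((T ^^ k) x)) - real n * (\<integral>y. f y \<partial>\<mu>)) / sqrt (real n) \<le> r})
       \<longlonglongrightarrow> cdf (density lborel (normal_density 0 s)) r)"

text \<open>Only the joint law of the two real sequences matters, so it is no restriction to look for
  the auxiliary probability space among those on pairs of real sequences.\<close>

definition ASIP_holds :: "('x \<Rightarrow> 'x) \<Rightarrow> 'x measure \<Rightarrow> ('x \<Rightarrow> real) \<Rightarrow> real \<Rightarrow> real \<Rightarrow> bool" where
  "ASIP_holds T \<mu> f s l \<longleftrightarrow> 0 < l \<and> l \<le> 1 / 2 \<and>
     (\<exists>(\<Omega> :: ((nat \<Rightarrow> real) \<times> (nat \<Rightarrow> real)) measure) A B.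
        prob_space \<Omega> \<and>
        (\<forall>k. A k \<in> borel_measurable \<Omega>) \<and>
        distr \<Omega> (\<Pi>\<^sub>M k\<in>UNIV. borel) (\<lambda>z k. A k z) =
          distr \<mu> (\<Pi>\<^sub>M k\<in>UNIV. borel) (\<lambda>x k. f ((T ^^ k) x)) \<and>
        prob_space.indep_vars \<Omega> (\<lambda>k. borel) B (UNIV :: nat set) \<and>
        (\<forall>k. distributed \<Omega> lborel (B k) (normal_density (\<integral>x. f x \<partial>\<mu>) s)) \<and>
        (AE z in \<Omega>. (\<lambda>n. \<bar>(\<Sum>k=1..n. A k z) - (\<Sum>k=1..n. B k z)\<bar>) \<in> o(\<lambda>n. real n powr l)))"

text \<open>The limit theorem for one observable, with its parameters: \<open>s\<close> is $s_f$, and \<open>l\<close> is the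
  exponent $\lambda$, used by the ASIP only.\<close>

definition limit_theorem_holds ::
    "limit_theorem \<Rightarrow> ('x \<Rightarrow> 'x) \<Rightarrow> 'x measure \<Rightarrow> ('x \<Rightarrow> real) \<Rightarrow> real \<Rightarrow> real \<Rightarrow> bool" where
  "limit_theorem_holds \<T> T \<mu> f s l \<longleftrightarrow>
     (case \<T> of
        No_Limit_Theorem \<Rightarrow> True
      | LIL \<Rightarrow> 0 \<le> s \<and> (0 < s \<longrightarrow> LIL_holds T \<mu> f s)
      | CLT \<Rightarrow> 0 \<le> s \<and> (0 < s \<longrightarrow> CLT_holds T \<mu> f s)
      | ASIP \<Rightarrow> 0 \<le> s \<and> (0 < s \<longrightarrow> ASIP_holds T \<mu> f s l))"

text \<open>The parameters of the limit theorem are explicit: \<open>s \<mu> f\<close> and \<open>l \<mu> f\<close> are those of the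
  observable \<open>f\<close> for the measure \<open>\<mu>\<close>. (If they were existentially quantified, \<open>s = 0\<close> would
  make every limit theorem void.)\<close>

definition UE ::
    "('x::metric_space \<Rightarrow> 'x) \<Rightarrow> (real \<Rightarrow> real) \<Rightarrow> ereal \<Rightarrow> limit_theorem \<Rightarrow> ('x \<Rightarrow> real) set \<Rightarrow>
     ('x measure \<Rightarrow> ('x \<Rightarrow> real) \<Rightarrow> real) \<Rightarrow> ('x measure \<Rightarrow> ('x \<Rightarrow> real) \<Rightarrow> real) \<Rightarrow> bool" where
  "UE T \<omega> \<rho> \<T> Obs s l \<longleftrightarrow>
     (\<forall>\<phi>\<in>Hol_space \<omega>. ereal (Hol_norm \<omega> \<phi>) < \<rho> \<longrightarrow>
        (\<exists>!\<mu>. equilibrium_state T \<phi> \<mu>) \<and>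
        (\<forall>\<mu>. equilibrium_state T \<phi> \<mu> \<longrightarrow>
           (\<forall>f\<in>Obs. limit_theorem_holds \<T> T \<mu> f (s \<mu> f) (l \<mu> f))))"

text \<open>\<open>transfer_fun\<close>, \<open>hat_fun\<close>, \<open>check_fun\<close> map \<open>f\<close> to $h$, $\hat f$, $\check f$; here \<open>p\<close> is
  the factor map and \<open>\<sigma>\<close> its section.\<close>

definition transfer_fun ::
    "('x \<Rightarrow> 'x) \<Rightarrow> ('x \<Rightarrow> 'y) \<Rightarrow> ('y \<Rightarrow> 'x) \<Rightarrow> ('x \<Rightarrow> real) \<Rightarrow> 'x \<Rightarrow> real" where
  "transfer_fun T p \<sigma> f x = (\<Sum>n. f ((T ^^ n) (\<sigma> (p x))) - f ((T ^^ n) x))"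

definition hat_fun ::
    "('x \<Rightarrow> 'x) \<Rightarrow> ('x \<Rightarrow> 'y) \<Rightarrow> ('y \<Rightarrow> 'x) \<Rightarrow> ('x \<Rightarrow> real) \<Rightarrow> 'x \<Rightarrow> real" where
  "hat_fun T p \<sigma> f x = f x + transfer_fun T p \<sigma> f x - transfer_fun T p \<sigma> f (T x)"

definition check_fun ::
    "('x \<Rightarrow> 'x) \<Rightarrow> ('x \<Rightarrow> 'y) \<Rightarrow> ('y \<Rightarrow> 'x) \<Rightarrow> ('x \<Rightarrow> real) \<Rightarrow> 'y \<Rightarrow> real" where
  "check_fun T p \<sigma> f = hat_fun T p \<sigma> f \<circ> \<sigma>"

text \<open>Parameters on the base, read on the extension: \<open>s\<close> becomes
  $(\mu, f) \mapsto s(p_*\mu, \check f)$.\<close>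

definition pull_param ::
    "('x \<Rightarrow> 'x) \<Rightarrow> ('x \<Rightarrow> 'y::topological_space) \<Rightarrow> ('y \<Rightarrow> 'x) \<Rightarrow>
     ('y measure \<Rightarrow> ('y \<Rightarrow> real) \<Rightarrow> real) \<Rightarrow> 'x measure \<Rightarrow> ('x \<Rightarrow> real) \<Rightarrow> real" where
  "pull_param T p \<sigma> s \<mu> f = s (distr \<mu> borel p) (check_fun T p \<sigma> f)"

text \<open>A UE property of \<open>S\<close> implies one of \<open>T\<close>, in the sense that includes the correspondence of
  equilibrium states and of parameters.\<close>

definition UE_implies ::
    "('y::metric_space \<Rightarrow> 'y) \<Rightarrow> ('x::metric_space \<Rightarrow> 'x) \<Rightarrow> ('x \<Rightarrow> 'y) \<Rightarrow> ('y \<Rightarrow> 'x) \<Rightarrow>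
     limit_theorem \<Rightarrow>
     (real \<Rightarrow> real) \<Rightarrow> ereal \<Rightarrow> ('y \<Rightarrow> real) set \<Rightarrow>
     (real \<Rightarrow> real) \<Rightarrow> ereal \<Rightarrow> ('x \<Rightarrow> real) set \<Rightarrow> bool" where
  "UE_implies S T p \<sigma> \<T> \<omega>Y \<rho>Y ObsY \<omega>X \<rho>X ObsX \<longleftrightarrow>
     (\<forall>s l. UE S \<omega>Y \<rho>Y \<T> ObsY s l \<longrightarrow>
        UE T \<omega>X \<rho>X \<T> ObsX (pull_param T p \<sigma> s) (pull_param T p \<sigma> l) \<and>
        (\<forall>\<phi>\<in>Hol_space \<omega>X. ereal (Hol_norm \<omega>X \<phi>) < \<rho>X \<longrightarrow>
           (\<forall>\<mu>. equilibrium_state T \<phi> \<mu> \<longrightarrow>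
              equilibrium_state S (check_fun T p \<sigma> \<phi>) (distr \<mu> borel p))))"

end

theory Submission
  imports Defs "HOL-Real_Asymp.Real_Asymp" "HOL-Complex_Analysis.Great_Picard"
begin

text \<open>
Let \<mu> be a T-invariant probability measure and \<nu> its image under p. Since the fibers shrink, T^n x is
at distance at most a n from T^n (\<sigma> (p x)), a point that depends on p x only. The whole proof
exploits this.

Measures: the integral of a continuous f against \<mu> is the limit of the integrals of f (T^n (\<sigma> y))
against \<nu>, so \<nu> determines \<mu> (\<open>invariant_lift_unique\<close>). Conversely, if ..., y 2, y 1, y 0 is a
backward orbit of S with stationary law \<nu>, then T^k (\<sigma> (y k)) converges and the law of the limit is
a T-invariant measure over \<nu> (\<open>invariant_lift_exists\<close>). Hence p induces a bijection between the
invariant probability measures of T and of S.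

Entropy: for large n the set T^{-n} A is, up to small measure, the preimage under p of a Borel
set. So the entropy rate of a partition for T is almost the entropy rate of a partition for S, and
p preserves the entropy of invariant measures (\<open>KS_entropy_project\<close>).

Equilibrium states and limit theorems: equilibrium states of T and S for potentials \<phi> and \<psi>
correspond to each other as soon as \<phi> and \<psi> have the same integrals against corresponding measures
(\<open>equilibrium_state_project_iff\<close>); by \<open>integral_check\<close> this is so for \<psi> = check \<phi>. An observable f
differs from (check f) o p by a bounded coboundary, so the Birkhoff sums of the two differ by a
bounded amount. For the LIL and the CLT this is enough. For the ASIP the Gaussian variables
are given jointly with the orbit of check f, and they have to be coupled with the orbit of f: this
is done by gluing two couplings along their common marginal (\<open>gluing\<close>).

Regularity: check f is a series of differences of f at points of a common fiber. Its first N terms are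
controlled by the Lipschitz growth of the powers of T, the others by the size of the fibers; for
points at distance t one chooses N depending on t. The numerical condition is isolated in
\<open>regularity_criterion\<close> and proved for the three pairs of moduli; \<open>check_regularity\<close> turns it into a
bound for the norm of check f.

There is one exception, the case L = 1 of the first claim. Then the first N terms are all of the same
order t^(\<alpha> \<beta>), their sum exceeds this by a factor log (1/t), and check \<phi> may fail to be
Hoelder of exponent \<alpha> \<beta>. But in this case the functions \<phi> o T^n o \<sigma> are Hoelder of exponent \<alpha>
uniformly in n. A subsequence of them converges to a Hoelder function which has the same integrals
as check \<phi>, and takes its place as potential on the base (\<open>nonexpansive_potential\<close>). For this
reason \<open>UE_implies_lift\<close> is stated for arbitrary \<psi> with the right integrals.
\<close>

section \<open>Coding points by real numbers\<close>

text \<open>A measurable retract of the unit interval. Sampling a random element of such a space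
reduces to sampling a real number.\<close>

definition real_coded :: "'a measure \<Rightarrow> bool" where
  "real_coded M \<longleftrightarrow> (\<exists>(c :: 'a \<Rightarrow> real) d. c \<in> borel_measurable M \<and> (\<forall>x\<in>space M. c x \<in> {0..1}) \<and>
     d \<in> measurable borel M \<and> (\<forall>x\<in>space M. d (c x) = x))"

text \<open>The point of the Cantor set with ternary digits 0 and 2. As digit 1 does not occur, the first
digit is decided by comparison with 1/2, and \<open>ternary_shift\<close> removes it; so reading
digits is a measurable operation, defined on all reals.\<close>

definition ternary_code :: "(nat \<Rightarrow> bool) \<Rightarrow> real" where
  "ternary_code b = (\<Sum>n. 2 * of_bool (b n) / 3 ^ Suc n)"

definition ternary_shift :: "real \<Rightarrow> real" where
  "ternary_shift x = 3 * x - 2 * of_bool (x \<ge> 1/2)"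

definition ternary_digit :: "nat \<Rightarrow> real \<Rightarrow> bool" where
  "ternary_digit n x \<longleftrightarrow> (ternary_shift ^^ n) x \<ge> 1/2"

lemma summable_ternary: "summable (\<lambda>n. 2 * of_bool (b n) / 3 ^ Suc n :: real)"
proof (rule summable_comparison_test')
  show "summable (\<lambda>n. 2/3 * (1/3) ^ n :: real)" by (intro summable_mult summable_geometric) simp
  show "norm (2 * of_bool (b n) / 3 ^ Suc n :: real) \<le> 2/3 * (1/3) ^ n" for n
    by (simp add: power_divide)
qed

lemma ternary_code_bounds: "0 \<le> ternary_code b" "ternary_code b \<le> 1"
proof -
  show "0 \<le> ternary_code b"
    unfolding ternary_code_def by (intro suminf_nonneg summable_ternary) simp
  have "ternary_code b \<le> (\<Sum>n. 2/3 * (1/3) ^ n)"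
    unfolding ternary_code_def
    by (intro suminf_le summable_ternary summable_mult summable_geometric)
       (simp_all add: power_divide)
  also have "\<dots> = 2/3 * (1 / (1 - 1/3))"
    by (subst suminf_mult) (simp_all add: suminf_geometric summable_geometric)
  finally show "ternary_code b \<le> 1" by simp
qed

lemma ternary_code_step:
  "ternary_code b = 2 * of_bool (b 0) / 3 + ternary_code (\<lambda>n. b (Suc n)) / 3"
proof -
  have "ternary_code b = (\<Sum>n. 2 * of_bool (b (Suc n)) / 3 ^ Suc (Suc n)) + 2 * of_bool (b 0) / 3"
    unfolding ternary_code_def by (subst suminf_split_head[OF summable_ternary]) simp
  also have "(\<Sum>n. 2 * of_bool (b (Suc n)) / 3 ^ Suc (Suc n)) =
      (\<Sum>n. (2 * of_bool (b (Suc n)) / 3 ^ Suc n) / 3 :: real)"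
    by simp
  also have "\<dots> = ternary_code (\<lambda>n. b (Suc n)) / 3"
    unfolding ternary_code_def by (rule suminf_divide[OF summable_ternary])
  finally show ?thesis by simp
qed

lemma ternary_digit_0: "ternary_code b \<ge> 1/2 \<longleftrightarrow> b 0"
  using ternary_code_step[of b] ternary_code_bounds[of "\<lambda>n. b (Suc n)"] by (cases "b 0") auto

lemma ternary_shift_code: "ternary_shift (ternary_code b) = ternary_code (\<lambda>n. b (Suc n))"
  using ternary_code_step[of b] unfolding ternary_shift_def ternary_digit_0 by (cases "b 0") auto

lemma ternary_digit_code: "ternary_digit n (ternary_code b) = b n"
proof -
  have "(ternary_shift ^^ n) (ternary_code b) = ternary_code (\<lambda>i. b (n + i))"
  proof (induction n)
    case (Suc n)
    then show ?case by (simp add: ternary_shift_code)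
  qed simp
  then show ?thesis using ternary_digit_0[of "\<lambda>i. b (n + i)"] by (simp add: ternary_digit_def)
qed

lemma ternary_digit_measurable: "Measurable.pred borel (ternary_digit n)"
proof -
  have 1[measurable]: "ternary_shift \<in> borel_measurable borel"
    unfolding ternary_shift_def by measurable
  have [measurable]: "(ternary_shift ^^ n) \<in> borel_measurable borel"
    by (induction n) auto
  show ?thesis unfolding ternary_digit_def by measurable
qed

text \<open>A real number is the supremum of the rationals below it. A sequence of reals is thus given by
countably many bits, which \<open>ternary_code\<close> packs into one number. Away from the codes the
decoding may produce infinite suprema; computing in the extended reals keeps it measurable.\<close>

lemma real_coded_sequences: "real_coded (PiM UNIV (\<lambda>_::nat. borel :: real measure))"
proof -
  let ?M = "PiM UNIV (\<lambda>_::nat. borel :: real measure)"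
  define q :: "nat \<Rightarrow> real" where "q = from_nat_into \<rat>"
  have q: "\<exists>j. x < q j \<and> q j < y" if xy: "x < y" for x y
  proof -
    obtain r where "r \<in> \<rat>" "x < r" "r < y" using Rats_dense_in_real[OF xy] by auto
    then obtain j where "q j = r"
      unfolding q_def using from_nat_into_surj[OF countable_rat, of r] by blast
    then show ?thesis using \<open>x < r\<close> \<open>r < y\<close> by auto
  qed
  define c where "c u = ternary_code (\<lambda>n. q (snd (prod_decode n)) < u (fst (prod_decode n)))" for u :: "nat \<Rightarrow> real"
  define d where "d x = (\<lambda>k. real_of_ereal (SUP j. if ternary_digit (prod_encode (k, j)) x then ereal (q j) else -\<infinity>))"
    for x
  show ?thesis
    unfolding real_coded_def
  proof (intro exI[of _ c] exI[of _ d] conjI ballI)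
    show "c \<in> borel_measurable ?M"
      unfolding c_def ternary_code_def by measurable
    show "c u \<in> {0..1}" for u unfolding c_def using ternary_code_bounds by auto
    note [measurable] = ternary_digit_measurable
    show "d \<in> measurable borel ?M"
      unfolding d_def
      by (rule measurable_PiM_single', intro borel_measurable_real_of_ereal borel_measurable_SUP) auto
    show "d (c u) = u" for u
    proof
      fix k
      have "(SUP j. if q j < u k then ereal (q j) else -\<infinity>) = ereal (u k)"
      proof (rule antisym)
        show "(SUP j. if q j < u k then ereal (q j) else -\<infinity>) \<le> ereal (u k)"
          by (rule SUP_least) auto
        show "ereal (u k) \<le> (SUP j. if q j < u k then ereal (q j) else -\<infinity>)"
        proof (rule dense_le)
          fix y :: ereal assume y: "y < ereal (u k)"
          show "y \<le> (SUP j. if q j < u k then ereal (q j) else -\<infinity>)"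
          proof (cases y)
            case (real r)
            then obtain j where "r < q j" "q j < u k" using q[of r "u k"] y by auto
            then show ?thesis using real by (intro SUP_upper2[of j]) auto
          qed (use y in auto)
        qed
      qed
      then show "d (c u) k = u k"
        unfolding d_def c_def ternary_digit_code by simp
    qed
  qed
qed

lemma real_coded_via:
  assumes N: "real_coded N" and e: "e \<in> measurable M N" and g: "g \<in> measurable N M"
    and ge: "\<And>x. x \<in> space M \<Longrightarrow> g (e x) = x"
  shows "real_coded M"
proof -
  obtain c :: "_ \<Rightarrow> real" and d where cd: "c \<in> borel_measurable N" "\<forall>x\<in>space N. c x \<in> {0..1}"
     "d \<in> measurable borel N" "\<forall>x\<in>space N. d (c x) = x"
    using N unfolding real_coded_def by auto
  show ?thesis unfolding real_coded_def
    using measurable_space[OF e] cd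
    by (intro exI[of _ "c \<circ> e"] exI[of _ "g \<circ> d"])
       (auto intro!: measurable_comp[OF e] measurable_comp[OF _ g] simp: ge)
qed

lemma compact_metric_countable_dense:
  assumes "compact (UNIV :: 'y::metric_space set)"
  obtains D :: "'y::metric_space set" where "countable D" "closure D = UNIV"
proof -
  have "\<forall>n. \<exists>K :: 'y set. finite K \<and> UNIV \<subseteq> (\<Union>x\<in>K. ball x (1 / Suc n))"
    using seq_compact_imp_totally_bounded[of "UNIV::'y set"] assms compact_eq_seq_compact_metric by (metis UNIV_I of_nat_0_less_iff subset_UNIV zero_less_Suc zero_less_divide_1_iff)
  then obtain K :: "nat \<Rightarrow> 'y set" where K: "\<And>n. finite (K n)" "\<And>n. UNIV \<subseteq> (\<Union>x\<in>K n. ball x (1 / Suc n))"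
    by metis
  have "x \<in> closure (\<Union>n. K n)" for x
    unfolding closure_approachable
  proof safe
    fix e :: real assume "e > 0"
    then obtain n where n: "1 / Suc n < e" using nat_approx_posE by blast
    obtain k where "k \<in> K n" "dist k x < 1 / Suc n" using K(2)[of n] by (auto simp: subset_eq)
    then show "\<exists>y\<in>\<Union>n. K n. dist y x < e" using n by force
  qed
  then show ?thesis using K by (intro that[of "\<Union>n. K n"]) (auto intro: countable_finite)
qed

lemma borel_measurable_dist_const:
  "(\<lambda>y :: 'y::metric_space. dist y a) \<in> borel_measurable borel"
  by (intro borel_measurable_continuous_onI continuous_intros)

text \<open>With a dense sequence q, a point y is coded by the indices of the first points of q within (1/2)^m of
y, and recovered as the limit of these points. For an arbitrary sequence of indices the limit need
not exist; then a default point is taken, and the Cauchy condition is expressed by countably many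
comparisons of distances between members of q.\<close>

lemma real_coded_compact_metric:
  assumes "compact (UNIV :: 'y::metric_space set)"
  shows "real_coded (borel :: 'y measure)"
proof -
  let ?N = "PiM UNIV (\<lambda>_::nat. borel :: real measure)"
  obtain D :: "'y set" where D: "countable D" "closure D = UNIV"
    by (rule compact_metric_countable_dense[OF assms])
  define q where "q = from_nat_into D"
  have q: "\<exists>i. dist x (q i) < e" if e: "e > 0" for x e
  proof -
    have "x \<in> closure D" using D(2) by simp
    then obtain y where "y \<in> D" "dist y x < e"
      using e unfolding closure_approachable by auto
    then show ?thesis unfolding q_def using from_nat_into_surj[OF D(1), of y] by (auto simp: dist_commute)
  qed
  define code where "code y m = real (LEAST i. dist y (q i) < (1/2) ^ m)" for y m
  define pt where "pt w m = q (nat \<lfloor>w m\<rfloor>)" for w :: "nat \<Rightarrow> real" and m :: nat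
  define dec where "dec w = (if Cauchy (pt w) then lim (pt w) else q 0)" for w
  have near: "dist y (pt (code y) m) < (1/2) ^ m" for y m
    unfolding pt_def code_def using LeastI_ex[OF q[of "(1/2)^m" y]] by simp
  have conv: "pt (code y) \<longlonglongrightarrow> y" for y
  proof (rule tendsto_dist_iff[THEN iffD2], rule tendsto_sandwich[of "\<lambda>_. 0" _ _ "\<lambda>m. (1/2)^m"])
    show "\<forall>\<^sub>F m in sequentially. dist (pt (code y) m) y \<le> (1/2)^m"
      using near[of y] by (auto simp: dist_commute less_imp_le)
  qed (auto intro: LIMSEQ_realpow_zero)
  have pm[measurable]: "(\<lambda>w. pt w m) \<in> measurable ?N borel" for m
    unfolding pt_def by (rule measurable_compose_countable'[where I=UNIV and g="\<lambda>w. nat \<lfloor>w m\<rfloor>"]) auto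
  have "(\<lambda>w. dist (pt w m) (pt w n)) \<in> borel_measurable ?N" for m n
    unfolding pt_def
    by (rule measurable_compose_countable'[where I=UNIV and g="\<lambda>w. nat \<lfloor>w m\<rfloor>"],
        simp, rule measurable_compose_countable'[where I=UNIV and g="\<lambda>w. nat \<lfloor>w n\<rfloor>"]) auto
  note [measurable] = this
  have "Measurable.pred ?N (\<lambda>w. \<forall>k. \<exists>M. \<forall>m\<ge>M. \<forall>n\<ge>M. dist (pt w m) (pt w n) < 1 / Suc k)"
    by measurable
  moreover have "Cauchy (pt w) \<longleftrightarrow> (\<forall>k. \<exists>M. \<forall>m\<ge>M. \<forall>n\<ge>M. dist (pt w m) (pt w n) < 1 / Suc k)" for w
  proof
    assume R: "\<forall>k. \<exists>M. \<forall>m\<ge>M. \<forall>n\<ge>M. dist (pt w m) (pt w n) < 1 / Suc k"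
    show "Cauchy (pt w)"
    proof (rule metric_CauchyI)
      fix e :: real assume "e > 0"
      then obtain k where "1 / Suc k < e" using nat_approx_posE by blast
      then show "\<exists>M. \<forall>m\<ge>M. \<forall>n\<ge>M. dist (pt w m) (pt w n) < e"
        using R[rule_format, of k] by (meson less_trans)
    qed
  qed (auto simp: Cauchy_def)
  ultimately have Cm[measurable]: "Measurable.pred ?N (\<lambda>w. Cauchy (pt w))" by simp
  have dm: "dec \<in> measurable ?N borel"
  proof (rule borel_measurable_LIMSEQ_metric[where f="\<lambda>m w. if Cauchy (pt w) then pt w m else q 0"])
    fix w
    show "(\<lambda>m. if Cauchy (pt w) then pt w m else q 0) \<longlonglongrightarrow> dec w"
    proof (cases "Cauchy (pt w)")
      case True
      obtain l where "pt w \<longlonglongrightarrow> l"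
        using True compact_imp_complete[OF assms] by (metis completeE UNIV_I)
      then show ?thesis using True by (simp add: dec_def limI)
    qed (simp add: dec_def)
  qed measurable
  have cm: "code \<in> measurable borel ?N"
  proof (rule measurable_PiM_single')
    fix m
    note [measurable] = borel_measurable_dist_const
    have "Measurable.pred borel (\<lambda>y. dist y (q i) < (1/2) ^ m)" for i
      by (rule borel_measurable_pred_less) auto
    note [measurable] = this
    have "(\<lambda>y. LEAST i. dist y (q i) < (1/2) ^ m) \<in> measurable borel (count_space UNIV)"
      by measurable
    then show "(\<lambda>y. code y m) \<in> borel_measurable borel" unfolding code_def by measurable
  qed auto
  have "dec (code y) = y" for y
    using conv[of y] by (auto simp: dec_def limI LIMSEQ_imp_Cauchy)
  then show ?thesis by (intro real_coded_via[OF real_coded_sequences cm dm])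
qed

section \<open>Sampling from conditional laws, and gluing of couplings\<close>

definition unit_seed :: "real measure" where
  "unit_seed = uniform_measure lborel {0..1}"

lemma sets_unit_seed[simp, measurable_cong]: "sets unit_seed = sets borel"
  by (simp add: unit_seed_def)

lemma space_unit_seed[simp]: "space unit_seed = UNIV"
  by (simp add: unit_seed_def)

lemma prob_space_unit_seed: "prob_space unit_seed"
  unfolding unit_seed_def by (rule prob_space_uniform_measure) auto

lemma unit_seed_le: 
  assumes "x \<le> 1" shows "emeasure unit_seed {s. ennreal s \<le> x} = x"
proof -
  obtain r where r: "x = ennreal r" "0 \<le> r" "r \<le> 1"
    using assms by (cases x) (auto simp: ennreal_le_1 top_unique)
  have "{0..1} \<inter> {s. ennreal s \<le> x} = {0..r}" using r by (auto simp: ennreal_le_iff)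
  then show ?thesis
    unfolding unit_seed_def using r
    by (subst emeasure_uniform_measure) (auto simp: divide_ennreal simp flip: ennreal_1)
qed

text \<open>Conditional distribution functions. The Radon--Nikodym density of the measure sending B to
Q ({..q} \<times> B) is monotone in q only almost everywhere; as D is countable, a running
supremum makes it monotone everywhere without changing it except on a null set.\<close>

lemma conditional_cdf:
  fixes Q :: "(real \<times> 'v) measure"
  assumes Q: "prob_space Q" "sets Q = sets (borel \<Otimes>\<^sub>M V)" and D: "countable D"
  obtains g where "\<And>q. g q \<in> borel_measurable V" "\<And>v q q'. q \<in> D \<Longrightarrow> q' \<in> D \<Longrightarrow> q \<le> q' \<Longrightarrow> g q v \<le> g q' v"
    "\<And>v q. g q v \<le> (1::ennreal)"
    "\<And>q B. q \<in> D \<Longrightarrow> B \<in> sets V \<Longrightarrow> (\<integral>\<^sup>+v. g q v * indicator B v \<partial>distr Q V snd) = emeasure Q ({..q} \<times> B)"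
proof -
  interpret Q: prob_space Q by fact
  define W where "W = distr Q V snd"
  have snd_m[measurable]: "snd \<in> measurable Q V"
    using Q(2) by (simp cong: measurable_cong_sets)
  have fst_m[measurable]: "fst \<in> measurable Q borel"
    using Q(2) by (simp cong: measurable_cong_sets)
  interpret W: prob_space W unfolding W_def by (rule Q.prob_space_distr) fact
  have sW[simp, measurable_cong]: "sets W = sets V" by (simp add: W_def)
  have sp: "space Q = UNIV \<times> space V" using sets_eq_imp_space_eq[OF Q(2)] by (simp add: space_pair_measure)
  define N where "N q = distr (density Q (indicator {z. fst z \<le> q})) V snd" for q :: real
  have sN[simp, measurable_cong]: "sets (N q) = sets V" for q by (simp add: N_def)
  have setQ: "{..q} \<times> B \<in> sets Q" if "B \<in> sets V" for q B
    using that Q(2) by auto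
  have Nval: "emeasure (N q) B = emeasure Q ({..q} \<times> B)" if B: "B \<in> sets V" for q B
  proof -
    have "emeasure (N q) B = emeasure (density Q (indicator {z. fst z \<le> q})) (snd -` B \<inter> space Q)"
      unfolding N_def using B by (subst emeasure_distr) auto
    also have "\<dots> = (\<integral>\<^sup>+z. indicator {z. fst z \<le> q} z * indicator (snd -` B \<inter> space Q) z \<partial>Q)"
      using B by (subst emeasure_density) auto
    also have "\<dots> = (\<integral>\<^sup>+z. indicator ({..q} \<times> B) z \<partial>Q)"
      by (rule nn_integral_cong) (auto split: split_indicator)
    finally show ?thesis using setQ[OF B] by simp
  qed
  have Wval: "emeasure W B = emeasure Q (UNIV \<times> B)" if B: "B \<in> sets V" for B
    unfolding W_def using B sets.sets_into_space[OF B]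
    by (subst emeasure_distr) (auto intro!: arg_cong[where f="emeasure Q"] simp: sp)
  have ac: "absolutely_continuous W (N q)" for q
    unfolding absolutely_continuous_def
  proof
    fix B assume "B \<in> null_sets W"
    then have B: "B \<in> sets V" "emeasure Q (UNIV \<times> B) = 0"
      using Wval[of B] by (auto simp: null_sets_def)
    then have "emeasure (N q) B \<le> 0"
      unfolding Nval[OF B(1)] B(2)[symmetric] using Q(2) by (intro emeasure_mono) auto
    then show "B \<in> null_sets (N q)" using B by auto
  qed
  define f where "f q = RN_deriv W (N q)" for q
  have fm[measurable]: "f q \<in> borel_measurable V" for q unfolding f_def by measurable
  have fval: "(\<integral>\<^sup>+v. f q v * indicator B v \<partial>W) = emeasure Q ({..q} \<times> B)" if B: "B \<in> sets V" for q B
  proof -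
    have "density W (f q) = N q" unfolding f_def by (rule W.density_RN_deriv[OF ac]) simp
    then show ?thesis using Nval[OF B] B by (metis emeasure_density fm sW measurable_cong_sets)
  qed
  have le1: "AE v in W. h v \<le> k v" 
    if h[measurable]: "h \<in> borel_measurable V" and k[measurable]: "k \<in> borel_measurable V"
     and le: "\<And>B. B \<in> sets V \<Longrightarrow> (\<integral>\<^sup>+v. h v * indicator B v \<partial>W) \<le> (\<integral>\<^sup>+v. k v * indicator B v \<partial>W)"
     and fin: "(\<integral>\<^sup>+v. k v \<partial>W) < \<infinity>" for h k :: "'v \<Rightarrow> ennreal"
  proof -
    define B where "B = {v\<in>space V. k v < h v}"
    have B[measurable]: "B \<in> sets V" unfolding B_def by measurable
    have spW: "space W = space V" using sets_eq_imp_space_eq[OF sW] .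
    have kf: "(\<integral>\<^sup>+v. k v * indicator B v \<partial>W) < \<infinity>"
      by (rule le_less_trans[OF nn_integral_mono fin]) (auto split: split_indicator)
    have "(\<integral>\<^sup>+v. h v * indicator B v - k v * indicator B v \<partial>W)
        = (\<integral>\<^sup>+v. h v * indicator B v \<partial>W) - (\<integral>\<^sup>+v. k v * indicator B v \<partial>W)"
      using kf by (intro nn_integral_diff) (auto simp: B_def split: split_indicator intro!: AE_I2)
    also have "\<dots> = 0" using le[OF B] le_less_trans[OF le[OF B] kf] by (simp add: diff_eq_0_iff_ennreal less_top)
    finally have "AE v in W. h v * indicator B v - k v * indicator B v = 0"
      by (subst (asm) nn_integral_0_iff_AE) auto
    then show ?thesis
      using AE_space
    proof eventually_elim
      case (elim v)
      then show ?case
        by (cases "v \<in> B") (auto simp: B_def diff_eq_0_iff_ennreal spW)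
    qed
  qed
  have fin: "(\<integral>\<^sup>+v. f q v \<partial>W) < \<infinity>" for q
  proof -
    have "(\<integral>\<^sup>+v. f q v \<partial>W) = (\<integral>\<^sup>+v. f q v * indicator (space V) v \<partial>W)"
      using sets_eq_imp_space_eq[OF sW] by (intro nn_integral_cong) (auto split: split_indicator)
    also have "\<dots> < \<infinity>" by (subst fval) (auto simp: less_top[symmetric])
    finally show ?thesis .
  qed
  have "AE v in W. \<forall>q\<in>D. \<forall>q'\<in>D. q \<le> q' \<longrightarrow> f q v \<le> f q' v"
  proof (intro AE_ball_countable[THEN iffD2] D ballI)
    fix q q' assume "q \<in> D" "q' \<in> D"
    show "AE v in W. q \<le> q' \<longrightarrow> f q v \<le> f q' v"
    proof (cases "q \<le> q'")
      case True
      have "AE v in W. f q v \<le> f q' v"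
        by (rule le1) (use True setQ fin[of q'] in \<open>auto simp: fval intro!: emeasure_mono\<close>)
      then show ?thesis by simp
    qed simp
  qed
  moreover have "AE v in W. \<forall>q\<in>D. f q v \<le> 1"
  proof (intro AE_ball_countable[THEN iffD2] D ballI)
    fix q assume "q \<in> D"
    have "emeasure Q ({..q} \<times> B) \<le> emeasure W B" if "B \<in> sets V" for B
      unfolding Wval[OF that] using that Q(2) by (intro emeasure_mono) auto
    then show "AE v in W. f q v \<le> 1"
      by (intro le1) (auto simp: fval W.emeasure_space_1)
  qed
  ultimately have AEg: "AE v in W. \<forall>q\<in>D. min 1 (SUP q'\<in>D \<inter> {..q}. f q' v) = f q v"
  proof eventually_elim
    case (elim v)
    show ?case
    proof
      fix q assume q: "q \<in> D"
      have "(SUP q'\<in>D \<inter> {..q}. f q' v) = f q v"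
        using q elim by (intro antisym SUP_least SUP_upper) auto
      then show "min 1 (SUP q'\<in>D \<inter> {..q}. f q' v) = f q v"
        using elim q by (auto simp: min_absorb2)
    qed
  qed
  show thesis
  proof (rule that[of "\<lambda>q v. min 1 (SUP q'\<in>D \<inter> {..q}. f q' v)"])
    show "(\<lambda>v. min 1 (SUP q'\<in>D \<inter> {..q}. f q' v)) \<in> borel_measurable V" for q
      using D by (intro borel_measurable_min borel_measurable_SUP countable_Int1) auto
    show "min 1 (SUP q'\<in>D \<inter> {..q}. f q' v) \<le> min 1 (SUP r\<in>D \<inter> {..q'}. f r v)" 
      if "q \<in> D" "q' \<in> D" "q \<le> q'" for v q q'
      using that by (intro min.mono order_refl SUP_subset_mono) auto
    show "(\<integral>\<^sup>+v. min 1 (SUP q'\<in>D \<inter> {..q}. f q' v) * indicator B v \<partial>distr Q V snd) = emeasure Q ({..q} \<times> B)"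
      if "q \<in> D" "B \<in> sets V" for q B
      unfolding fval[OF that(2), symmetric] W_def[symmetric]
    proof (rule nn_integral_cong_AE)
      show "AE v in W. min 1 (SUP q'\<in>D \<inter> {..q}. f q' v) * indicator B v = f q v * indicator B v"
        using AEg by eventually_elim (use that in simp)
    qed
  qed auto
qed

text \<open>The conditional quantile function: \<Phi> (v, s) is the infimum of the q at which the conditional
distribution function at v has reached s. The event \<Phi> < c is the increasing union over q < c of the
events s \<le> g q v, whose probabilities are known; this determines the joint law without any
right continuity of g.\<close>

lemma conditional_sampling_real:
  fixes Q :: "(real \<times> 'v) measure"
  assumes Q: "prob_space Q" "sets Q = sets (borel \<Otimes>\<^sub>M V)"
    and unit: "AE z in Q. fst z \<in> {0..1}"
  obtains \<Phi> where "\<Phi> \<in> borel_measurable (V \<Otimes>\<^sub>M unit_seed)"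
    "distr (distr Q V snd \<Otimes>\<^sub>M unit_seed) (borel \<Otimes>\<^sub>M V) (\<lambda>z. (\<Phi> z, fst z)) = Q"
proof -
  interpret Q: prob_space Q by fact
  define D where "D = \<rat> \<inter> {0..1::real}"
  have D: "countable D" unfolding D_def by (intro countable_Int1 countable_rat)
  have D01: "0 \<in> D" "1 \<in> D" unfolding D_def by auto
  define W where "W = distr Q V snd"
  have snd_m[measurable]: "snd \<in> measurable Q V"
    using Q(2) by (simp cong: measurable_cong_sets)
  interpret W: prob_space W unfolding W_def by (rule Q.prob_space_distr) fact
  interpret U: prob_space unit_seed by (rule prob_space_unit_seed)
  have sW[simp, measurable_cong]: "sets W = sets V" by (simp add: W_def)
  have spW: "space W = space V" using sets_eq_imp_space_eq[OF sW] .
  obtain g where g[measurable]: "\<And>q. g q \<in> borel_measurable V"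
    and gmono: "\<And>v q q'. q \<in> D \<Longrightarrow> q' \<in> D \<Longrightarrow> q \<le> q' \<Longrightarrow> g q v \<le> g q' v"
    and gle: "\<And>v q. g q v \<le> (1::ennreal)"
    and gval: "\<And>q B. q \<in> D \<Longrightarrow> B \<in> sets V \<Longrightarrow> (\<integral>\<^sup>+v. g q v * indicator B v \<partial>W) = emeasure Q ({..q} \<times> B)"
    by (rule conditional_cdf[OF Q D, folded W_def]) (rule that)
  \<comment> \<open>The value 1 is always admitted, so that the infimum is taken over a nonempty set.\<close>
  define E where "E q = {z. q = 1 \<or> ennreal (snd z) \<le> g q (fst z)}" for q
  define \<Phi> where "\<Phi> z = Inf {q \<in> D. z \<in> E q}" for z
  have less: "\<Phi> z < c \<longleftrightarrow> (\<exists>q\<in>D. q < c \<and> z \<in> E q)" for z c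
    unfolding \<Phi>_def using D01 by (subst cInf_less_iff) (auto simp: E_def D_def intro!: bdd_belowI[of _ 0])
  have Em[measurable]: "Measurable.pred (V \<Otimes>\<^sub>M unit_seed) (\<lambda>z. z \<in> E q)" for q
    unfolding E_def by measurable
  have \<Phi>m[measurable]: "\<Phi> \<in> borel_measurable (V \<Otimes>\<^sub>M unit_seed)"
  proof (rule borel_measurableI_less)
    fix c
    show "{z \<in> space (V \<Otimes>\<^sub>M unit_seed). \<Phi> z < c} \<in> sets (V \<Otimes>\<^sub>M unit_seed)"
      unfolding less using D by measurable
  qed
  interpret P: pair_sigma_finite W unit_seed ..
  interpret WU: pair_prob_space W unit_seed ..
  have spQ: "space Q = UNIV \<times> space V" using sets_eq_imp_space_eq[OF Q(2)] by (simp add: space_pair_measure)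
  have Wval: "emeasure W B = emeasure Q (UNIV \<times> B)" if B: "B \<in> sets V" for B
    unfolding W_def using B sets.sets_into_space[OF B]
    by (subst emeasure_distr) (auto intro!: arg_cong[where f="emeasure Q"] simp: spQ)
  have Esets: "{z \<in> B \<times> UNIV. z \<in> E q} \<in> sets (W \<Otimes>\<^sub>M unit_seed)" if B: "B \<in> sets V" for B q
  proof -
    have "{z \<in> B \<times> UNIV. z \<in> E q} = {z\<in>space (V \<Otimes>\<^sub>M unit_seed). z \<in> E q} \<inter> (B \<times> space unit_seed)"
      using sets.sets_into_space[OF B] by (auto simp: space_pair_measure)
    also have "\<dots> \<in> sets (V \<Otimes>\<^sub>M unit_seed)"
      by (intro sets.Int pair_measureI predE Em B) auto
    also have "\<dots> = sets (W \<Otimes>\<^sub>M unit_seed)" by (intro sets_pair_measure_cong) auto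
    finally show ?thesis .
  qed
  have Eval: "emeasure (W \<Otimes>\<^sub>M unit_seed) {z \<in> B \<times> UNIV. z \<in> E q} = emeasure Q ({..q} \<times> B)"
    if q: "q \<in> D" "q < 1" and B: "B \<in> sets V" for q B
  proof -
    have "{z \<in> B \<times> UNIV. z \<in> E q} \<in> sets (W \<Otimes>\<^sub>M unit_seed)"
      by (rule Esets[OF B])
    then have "emeasure (W \<Otimes>\<^sub>M unit_seed) {z \<in> B \<times> UNIV. z \<in> E q} =
        (\<integral>\<^sup>+v. emeasure unit_seed (Pair v -` {z \<in> B \<times> UNIV. z \<in> E q}) \<partial>W)"
      by (rule U.emeasure_pair_measure_alt)
    also have "\<dots> = (\<integral>\<^sup>+v. g q v * indicator B v \<partial>W)"
    proof (rule nn_integral_cong)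
      fix v
      have "Pair v -` {z \<in> B \<times> UNIV. z \<in> E q} = (if v \<in> B then {s. ennreal s \<le> g q v} else {})"
        using q by (auto simp: E_def)
      then show "emeasure unit_seed (Pair v -` {z \<in> B \<times> UNIV. z \<in> E q}) = g q v * indicator B v"
        using unit_seed_le[OF gle[of q v]] by simp
    qed
    also have "\<dots> = emeasure Q ({..q} \<times> B)" by (rule gval[OF q(1) B])
    finally show ?thesis .
  qed
  have val: "emeasure (W \<Otimes>\<^sub>M unit_seed) {z \<in> B \<times> UNIV. \<Phi> z < c} = emeasure Q ({..<c} \<times> B)"
    if B: "B \<in> sets V" for B c
  proof -
    have Bs: "B \<subseteq> space V" using B by (rule sets.sets_into_space)
    have Bm: "S \<times> B \<in> sets Q" if "S \<in> sets borel" for S :: "real set" using that B Q(2) by auto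
    consider "c \<le> 0" | "c > 1" | "0 < c" "c \<le> 1" by linarith
    then show ?thesis
    proof cases
      case 1
      then have "{z \<in> B \<times> UNIV. \<Phi> z < c} = {}" unfolding less by (auto simp: D_def)
      moreover have "emeasure Q ({..<c} \<times> B) = 0"
      proof (rule AE_iff_measurable[THEN iffD1, of _ _ "\<lambda>z. z \<notin> {..<c} \<times> B"])
        show "AE z in Q. z \<notin> {..<c} \<times> B" using unit by eventually_elim (use 1 in auto)
      qed (use Bm Bs in \<open>auto simp: spQ\<close>)
      ultimately show ?thesis by (simp only: emeasure_empty)
    next
      case 2
      then have "{z \<in> B \<times> UNIV. \<Phi> z < c} = B \<times> space unit_seed"
        unfolding less using D01 by (auto simp: E_def)
      then have "emeasure (W \<Otimes>\<^sub>M unit_seed) {z \<in> B \<times> UNIV. \<Phi> z < c} =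
          emeasure (W \<Otimes>\<^sub>M unit_seed) (B \<times> space unit_seed)" by (simp only:)
      also have "\<dots> = emeasure W B * emeasure unit_seed (space unit_seed)"
        by (rule U.emeasure_pair_measure_Times) (use B in auto)
      also have "\<dots> = emeasure W B" by (simp only: U.emeasure_space_1 mult_1_right)
      also have "\<dots> = emeasure Q ({..<c} \<times> B)"
        unfolding Wval[OF B]
      proof (rule emeasure_eq_AE)
        show "AE z in Q. z \<in> UNIV \<times> B \<longleftrightarrow> z \<in> {..<c} \<times> B"
          using unit by eventually_elim (use 2 in auto)
      qed (use Bm in auto)
      finally show ?thesis .
    next
      case 3
      define Dc where "Dc = D \<inter> {..<c}"
      have Dc: "countable Dc" "Dc \<noteq> {}" unfolding Dc_def using D D01 3 by auto
      \<comment> \<open>An increasing sequence that is cofinal in the part of D below c.\<close>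
      define m where "m n = Max (from_nat_into Dc ` {..n})" for n
      have mD: "m n \<in> Dc" for n
      proof -
        have "m n \<in> from_nat_into Dc ` {..n}" unfolding m_def by (rule Max_in) auto
        then show ?thesis using from_nat_into[OF Dc(2)] by auto
      qed
      have minc: "m i \<le> m j" if "i \<le> j" for i j
        unfolding m_def by (rule Max_mono) (use that in auto)
      have mcof: "\<exists>n. q \<le> m n" if qDc: "q \<in> Dc" for q
      proof -
        obtain n where "from_nat_into Dc n = q" using from_nat_into_surj[OF Dc(1) qDc] by auto
        then show ?thesis unfolding m_def by (intro exI[of _ n] Max_ge) auto
      qed
      have Einc: "z \<in> E q'" if "z \<in> E q" "q \<in> Dc" "q' \<in> Dc" "q \<le> q'" for z q q'
        using that gmono[of q q' "fst z"] 3 by (auto simp: E_def Dc_def)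
      define A1 where "A1 n = {z \<in> B \<times> UNIV. z \<in> E (m n)}" for n
      have A1: "A1 n \<in> sets (W \<Otimes>\<^sub>M unit_seed)" for n
        unfolding A1_def by (rule Esets[OF B])
      have sub: "\<Phi> z < c" if "z \<in> A1 n" for z n
        unfolding less using mD[of n] that by (auto simp: A1_def Dc_def)
      have "{z \<in> B \<times> UNIV. \<Phi> z < c} = (\<Union>n. A1 n)"
      proof (safe, goal_cases)
        case (1 v s)
        then obtain q where q: "q \<in> Dc" "(v, s) \<in> E q" unfolding less Dc_def by auto
        then obtain n where "q \<le> m n" using mcof by auto
        then have "(v, s) \<in> A1 n" using q 1 Einc[OF q(2,1) mD] by (auto simp: A1_def)
        then show ?case by auto
      qed (use sub in \<open>auto simp: A1_def\<close>)
      moreover have "incseq A1"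
        unfolding incseq_def A1_def using Einc[OF _ mD mD minc] by auto
      ultimately have "emeasure (W \<Otimes>\<^sub>M unit_seed) {z \<in> B \<times> UNIV. \<Phi> z < c} = (SUP n. emeasure (W \<Otimes>\<^sub>M unit_seed) (A1 n))"
        using A1 by (simp add: SUP_emeasure_incseq image_subset_iff)
      also have "\<dots> = (SUP n. emeasure Q ({..m n} \<times> B))"
      proof (intro SUP_cong refl)
        fix n
        have "m n \<in> D" "m n < 1" using mD[of n] 3 by (auto simp: Dc_def)
        then show "emeasure (W \<Otimes>\<^sub>M unit_seed) (A1 n) = emeasure Q ({..m n} \<times> B)"
          unfolding A1_def by (rule Eval[OF _ _ B])
      qed
      also have "\<dots> = emeasure Q (\<Union>n. {..m n} \<times> B)"
        by (rule SUP_emeasure_incseq) (use Bm minc in \<open>auto simp: incseq_def intro: order_trans\<close>)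
      also have "emeasure Q (\<Union>n. {..m n} \<times> B) = emeasure Q ({..<c} \<times> B)"
      proof (rule emeasure_eq_AE)
        show "AE z in Q. z \<in> (\<Union>n. {..m n} \<times> B) \<longleftrightarrow> z \<in> {..<c} \<times> B"
          using unit
        proof eventually_elim
          case (elim z)
          have cof: "\<exists>n. u \<le> m n" if u: "0 \<le> u" "u < c" for u
          proof -
            obtain q where "q \<in> \<rat>" "u < q" "q < c" using Rats_dense_in_real[OF u(2)] by auto
            then have "q \<in> Dc" using u 3 by (auto simp: Dc_def D_def)
            then show ?thesis using mcof[of q] \<open>u < q\<close> by (meson less_imp_le order_trans)
          qed
          have "u < c" if "u \<le> m n" for u n using that mD[of n] by (auto simp: Dc_def)
          then show ?case using elim cof by (cases z) auto
        qed
      qed (use Bm in auto)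
      finally show ?thesis .
    qed
  qed
  show thesis
  proof (rule that[OF \<Phi>m])
    let ?f = "\<lambda>z. (\<Phi> z, fst z)"
    let ?G = "{A \<times> B |A B. A \<in> range (\<lambda>c::real. {..<c}) \<and> B \<in> sets V}"
    have fm[measurable]: "?f \<in> measurable (W \<Otimes>\<^sub>M unit_seed) (borel \<Otimes>\<^sub>M V)" by measurable
    have gen: "sets (borel \<Otimes>\<^sub>M V) = sigma_sets (UNIV \<times> space V) ?G"
    proof -
      have cover: "\<Union>(range (\<lambda>n::nat. {..<real n})) = UNIV" using reals_Archimedean2 by auto
      have "sets (borel \<Otimes>\<^sub>M V) = sets (sigma (space borel \<times> space V) ?G)"
        by (rule sets_pair_eq[where Ca="range (\<lambda>n::nat. {..<real n})" and Cb="{space V}"])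
           (auto simp: cover sets.sigma_sets_eq sets.space_closed borel_Iio[where 'a=real]
              simp del: sets_borel)
      then show ?thesis
        using sets.sets_into_space by (subst (asm) sets_measure_of) fastforce+
    qed
    show "distr (distr Q V snd \<Otimes>\<^sub>M unit_seed) (borel \<Otimes>\<^sub>M V) ?f = Q"
      unfolding W_def[symmetric]
    proof (rule measure_eqI_generator_eq[where E="?G" and \<Omega>="UNIV \<times> space V" and A="\<lambda>n. {..<real n} \<times> space V"])
      show "Int_stable ?G"
      proof (rule Int_stableI)
        fix a b assume "a \<in> ?G" "b \<in> ?G"
        then obtain c B c' B' where "a = {..<c} \<times> B" "B \<in> sets V" "b = {..<c'} \<times> B'" "B' \<in> sets V"
          by auto
        then have "a \<inter> b = {..<min c c'} \<times> (B \<inter> B')" "B \<inter> B' \<in> sets V" by auto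
        then show "a \<inter> b \<in> ?G" by blast
      qed
      show "?G \<subseteq> Pow (UNIV \<times> space V)" using sets.sets_into_space by fastforce
      show "sets (distr (W \<Otimes>\<^sub>M unit_seed) (borel \<Otimes>\<^sub>M V) ?f) = sigma_sets (UNIV \<times> space V) ?G"
        using gen by simp
      show "sets Q = sigma_sets (UNIV \<times> space V) ?G" using gen Q(2) by simp
      show "range (\<lambda>n. {..<real n} \<times> space V) \<subseteq> ?G" by auto
      show "(\<Union>n. {..<real n} \<times> space V) = UNIV \<times> space V" using reals_Archimedean2 by auto
      show "emeasure (distr (W \<Otimes>\<^sub>M unit_seed) (borel \<Otimes>\<^sub>M V) ?f) ({..<real n} \<times> space V) \<noteq> \<infinity>" for n
        by (subst emeasure_distr) (auto simp: WU.emeasure_finite[unfolded infinity_ennreal_def])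
      fix X assume "X \<in> ?G"
      then obtain c B where X: "X = {..<c} \<times> B" "B \<in> sets V" by auto
      have "emeasure (distr (W \<Otimes>\<^sub>M unit_seed) (borel \<Otimes>\<^sub>M V) ?f) X
          = emeasure (W \<Otimes>\<^sub>M unit_seed) {z \<in> B \<times> UNIV. \<Phi> z < c}"
        using X sets.sets_into_space[OF X(2)]
        by (subst emeasure_distr) (auto simp: space_pair_measure spW intro!: arg_cong[where f="emeasure (W \<Otimes>\<^sub>M unit_seed)"])
      then show "emeasure (distr (W \<Otimes>\<^sub>M unit_seed) (borel \<Otimes>\<^sub>M V) ?f) X = emeasure Q X"
        using val[OF X(2)] X by simp
    qed
  qed
qed

text \<open>A random element u jointly distributed with v can be simulated from v and an independent uniform
seed. This is the form in which conditional laws are used below.\<close>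

lemma conditional_sampling:
  fixes Q :: "('u \<times> 'v) measure"
  assumes U: "real_coded U" and Q: "prob_space Q" "sets Q = sets (U \<Otimes>\<^sub>M V)"
  obtains \<Phi> where "\<Phi> \<in> measurable (V \<Otimes>\<^sub>M unit_seed) U"
    "distr (distr Q V snd \<Otimes>\<^sub>M unit_seed) (U \<Otimes>\<^sub>M V) (\<lambda>z. (\<Phi> z, fst z)) = Q"
proof -
  interpret Q: prob_space Q by fact
  obtain c :: "_ \<Rightarrow> real" and d where c[measurable]: "c \<in> borel_measurable U" and c01: "\<forall>x\<in>space U. c x \<in> {0..1}"
     and d[measurable]: "d \<in> measurable borel U" and dc: "\<forall>x\<in>space U. d (c x) = x"
    using U unfolding real_coded_def by auto
  note [measurable_cong] = Q(2)
  have spQ: "space Q = space U \<times> space V" using sets_eq_imp_space_eq[OF Q(2)] by (simp add: space_pair_measure)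
  define R where "R = distr Q (borel \<Otimes>\<^sub>M V) (\<lambda>z. (c (fst z), snd z))"
  have R: "prob_space R" unfolding R_def by (rule Q.prob_space_distr) measurable
  have sR: "sets R = sets (borel \<Otimes>\<^sub>M V)" unfolding R_def by simp
  have "AE z in R. fst z \<in> {0..1}"
    unfolding R_def by (subst AE_distr_iff) (use c01 in \<open>auto simp: spQ intro!: AE_I2\<close>)
  from conditional_sampling_real[OF R sR this] obtain \<Phi> where
    \<Phi>[measurable]: "\<Phi> \<in> borel_measurable (V \<Otimes>\<^sub>M unit_seed)" and
    law: "distr (distr R V snd \<Otimes>\<^sub>M unit_seed) (borel \<Otimes>\<^sub>M V) (\<lambda>z. (\<Phi> z, fst z)) = R" by blast
  have RV: "distr R V snd = distr Q V snd"
    unfolding R_def by (subst distr_distr) (auto simp: comp_def)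
  have sW[measurable_cong]: "sets (distr Q V snd) = sets V" by simp
  show thesis
  proof (rule that[of "\<lambda>z. d (\<Phi> z)"])
    show "(\<lambda>z. d (\<Phi> z)) \<in> measurable (V \<Otimes>\<^sub>M unit_seed) U" by measurable
    have "distr (distr Q V snd \<Otimes>\<^sub>M unit_seed) (U \<Otimes>\<^sub>M V) (\<lambda>z. (d (\<Phi> z), fst z))
        = distr (distr (distr R V snd \<Otimes>\<^sub>M unit_seed) (borel \<Otimes>\<^sub>M V) (\<lambda>z. (\<Phi> z, fst z))) (U \<Otimes>\<^sub>M V) (\<lambda>z. (d (fst z), snd z))"
      unfolding RV by (subst distr_distr) (auto simp: comp_def)
    also have "\<dots> = distr Q (U \<Otimes>\<^sub>M V) (\<lambda>z. (d (c (fst z)), snd z))"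
      unfolding law unfolding R_def by (subst distr_distr) (auto simp: comp_def)
    also have "\<dots> = distr Q Q (\<lambda>z. z)"
      by (rule distr_cong) (use Q(2) dc in \<open>auto simp: spQ\<close>)
    finally show "distr (distr Q V snd \<Otimes>\<^sub>M unit_seed) (U \<Otimes>\<^sub>M V) (\<lambda>z. (d (\<Phi> z), fst z)) = Q"
      by simp
  qed
qed

text \<open>Given v and w, one samples u from its conditional law given v, with a seed independent of (v, w).\<close>

lemma gluing:
  fixes P1 :: "('u \<times> 'v) measure" and P2 :: "('v \<times> 'w) measure"
  assumes U: "real_coded U" and P1: "prob_space P1" "sets P1 = sets (U \<Otimes>\<^sub>M V)"
    and P2: "prob_space P2" "sets P2 = sets (V \<Otimes>\<^sub>M W)"
    and marg: "distr P1 V snd = distr P2 V fst"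
  obtains P where "prob_space P" "sets P = sets (U \<Otimes>\<^sub>M V \<Otimes>\<^sub>M W)"
    "distr P (U \<Otimes>\<^sub>M V) (\<lambda>(u, v, w). (u, v)) = P1" "distr P (V \<Otimes>\<^sub>M W) snd = P2"
proof -
  obtain \<Phi> where \<Phi>[measurable]: "\<Phi> \<in> measurable (V \<Otimes>\<^sub>M unit_seed) U"
    and law: "distr (distr P1 V snd \<Otimes>\<^sub>M unit_seed) (U \<Otimes>\<^sub>M V) (\<lambda>z. (\<Phi> z, fst z)) = P1"
    using conditional_sampling[OF U P1] by blast
  note [measurable_cong] = P2(2)
  interpret P2: prob_space P2 by fact
  interpret S: prob_space unit_seed by (rule prob_space_unit_seed)
  interpret PS: pair_prob_space P2 unit_seed ..
  let ?f = "\<lambda>z. (\<Phi> (fst (fst z), snd z), fst z)"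
  have f[measurable]: "?f \<in> measurable (P2 \<Otimes>\<^sub>M unit_seed) (U \<Otimes>\<^sub>M V \<Otimes>\<^sub>M W)" by measurable
  show thesis
  proof (rule that[of "distr (P2 \<Otimes>\<^sub>M unit_seed) (U \<Otimes>\<^sub>M V \<Otimes>\<^sub>M W) ?f"])
    show "prob_space (distr (P2 \<Otimes>\<^sub>M unit_seed) (U \<Otimes>\<^sub>M V \<Otimes>\<^sub>M W) ?f)"
      by (rule PS.prob_space_distr) measurable
    have "distr (distr (P2 \<Otimes>\<^sub>M unit_seed) (U \<Otimes>\<^sub>M V \<Otimes>\<^sub>M W) ?f) (V \<Otimes>\<^sub>M W) snd = distr (P2 \<Otimes>\<^sub>M unit_seed) P2 fst"
      by (subst distr_distr) (auto simp: comp_def P2(2) intro!: distr_cong)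
    then show "distr (distr (P2 \<Otimes>\<^sub>M unit_seed) (U \<Otimes>\<^sub>M V \<Otimes>\<^sub>M W) ?f) (V \<Otimes>\<^sub>M W) snd = P2"
      by (simp add: S.distr_pair_fst S.emeasure_space_1[simplified])
    have "distr (distr (P2 \<Otimes>\<^sub>M unit_seed) (U \<Otimes>\<^sub>M V \<Otimes>\<^sub>M W) ?f) (U \<Otimes>\<^sub>M V) (\<lambda>(u, v, w). (u, v))
        = distr (P2 \<Otimes>\<^sub>M unit_seed) (U \<Otimes>\<^sub>M V) (\<lambda>z. (\<Phi> (fst (fst z), snd z), fst (fst z)))"
      by (subst distr_distr) (auto simp: comp_def split_beta')
    also have "\<dots> = distr (distr (P2 \<Otimes>\<^sub>M unit_seed) (V \<Otimes>\<^sub>M unit_seed) (\<lambda>(p, s). (fst p, s))) (U \<Otimes>\<^sub>M V) (\<lambda>z. (\<Phi> z, fst z))"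
      by (subst distr_distr) (auto simp: comp_def split_beta')
    also have "distr (P2 \<Otimes>\<^sub>M unit_seed) (V \<Otimes>\<^sub>M unit_seed) (\<lambda>(p, s). (fst p, s)) = distr P2 V fst \<Otimes>\<^sub>M distr unit_seed unit_seed (\<lambda>s. s)"
      by (rule pair_measure_distr[symmetric]) (auto simp: S.sigma_finite_measure_axioms)
    also have "\<dots> = distr P1 V snd \<Otimes>\<^sub>M unit_seed" by (simp add: marg)
    also note law
    finally show "distr (distr (P2 \<Otimes>\<^sub>M unit_seed) (U \<Otimes>\<^sub>M V \<Otimes>\<^sub>M W) ?f) (U \<Otimes>\<^sub>M V) (\<lambda>(u, v, w). (u, v)) = P1" .
  qed simp
qed

section \<open>Entropy of finitely valued functions\<close>

text \<open>Functions are more convenient than partitions, since the join of two partitions becomes a pair of functions.\<close>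

definition shannon :: "'a measure \<Rightarrow> ('a \<Rightarrow> 'b) \<Rightarrow> real" where
  "shannon M X = - (\<Sum>v\<in>X ` space M. measure M (X -` {v} \<inter> space M) * ln (measure M (X -` {v} \<inter> space M)))"

lemma (in prob_space) shannon_eq_entropy:
  assumes "simple_function M X"
  shows "shannon M X = entropy (exp 1) (count_space (X ` space M)) X"
proof -
  interpret information_space M "exp 1" by unfold_locales simp
  show ?thesis
    unfolding shannon_def
    by (subst entropy_simple_distributed[OF simple_distributedI[OF assms measure_nonneg refl]])
       (simp add: log_def)
qed

lemma (in prob_space) shannon_comp_le:
  assumes "simple_function M X"
  shows "shannon M (\<lambda>x. f (X x)) \<le> shannon M X"
proof -
  interpret information_space M "exp 1" by unfold_locales simp
  have "simple_function M (f \<circ> X)" by (rule simple_function_compose[OF assms])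
  then show ?thesis
    using entropy_data_processing[OF assms, of f] assms by (simp add: shannon_eq_entropy comp_def)
qed

lemma (in prob_space) shannon_comp_inj:
  assumes "simple_function M X" "inj_on f (X ` space M)"
  shows "shannon M (\<lambda>x. f (X x)) = shannon M X"
proof -
  interpret information_space M "exp 1" by unfold_locales simp
  have "simple_function M (f \<circ> X)" by (rule simple_function_compose[OF assms(1)])
  then show ?thesis
    using entropy_of_inj[OF assms] assms by (simp add: shannon_eq_entropy comp_def)
qed

lemma (in prob_space) shannon_pair_le:
  assumes "simple_function M X" "simple_function M Y"
  shows "shannon M (\<lambda>x. (X x, Y x)) \<le> shannon M X + shannon M Y"
proof -
  interpret information_space M "exp 1" by unfold_locales simp
  show ?thesis
    using entropy_chain_rule[OF assms] conditional_entropy_less_eq_entropy[OF assms(2,1)] assms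
    by (simp add: shannon_eq_entropy simple_function_Pair)
qed

text \<open>This writes the entropies of several images of W as sums over the same index set, so that they can
be compared term by term.\<close>

lemma (in prob_space) shannon_image:
  assumes W: "simple_function M W"
  shows "shannon M (\<lambda>x. f (W x)) =
    - (\<Sum>w\<in>W ` space M. prob (W -` {w} \<inter> space M) * ln (prob ((\<lambda>x. f (W x)) -` {f w} \<inter> space M)))"
proof -
  have fin: "finite (W ` space M)" using W by (rule simple_functionD)
  have ms: "W -` {w} \<inter> space M \<in> events" for w using W by (rule simple_functionD)
  let ?P = "\<lambda>w. prob (W -` {w} \<inter> space M)"
  let ?Q = "\<lambda>v. prob ((\<lambda>x. f (W x)) -` {v} \<inter> space M)"
  have Q: "?Q v = (\<Sum>w\<in>{w \<in> W ` space M. f w = v}. ?P w)" for v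
  proof -
    have "(\<lambda>x. f (W x)) -` {v} \<inter> space M = (\<Union>w\<in>{w \<in> W ` space M. f w = v}. W -` {w} \<inter> space M)"
      by auto
    also have "prob \<dots> = (\<Sum>w\<in>{w \<in> W ` space M. f w = v}. ?P w)"
      by (rule finite_measure_finite_Union) (use fin ms in \<open>auto simp: disjoint_family_on_def\<close>)
    finally show ?thesis .
  qed
  have "(\<Sum>w\<in>W ` space M. ?P w * ln (?Q (f w))) =
      (\<Sum>v\<in>f ` W ` space M. \<Sum>w\<in>{w \<in> W ` space M. f w = v}. ?P w * ln (?Q (f w)))"
    by (rule sum.image_gen[OF fin])
  also have "\<dots> = (\<Sum>v\<in>f ` W ` space M. \<Sum>w\<in>{w \<in> W ` space M. f w = v}. ?P w * ln (?Q v))"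
    by (intro sum.cong) auto
  also have "\<dots> = (\<Sum>v\<in>f ` W ` space M. ?Q v * ln (?Q v))"
    by (simp add: Q sum_distrib_right)
  finally show ?thesis by (simp add: shannon_def image_image)
qed

text \<open>The difference of the two sides is the conditional mutual information of X and Y given Z. Read
as a statement on conditional entropies: to condition on more decreases entropy.\<close>

lemma (in prob_space) shannon_strong_subadditive:
  assumes X: "simple_function M X" and Y: "simple_function M Y" and Z: "simple_function M Z"
  shows "shannon M (\<lambda>x. (X x, Y x, Z x)) + shannon M Z
    \<le> shannon M (\<lambda>x. (X x, Z x)) + shannon M (\<lambda>x. (Y x, Z x))"
proof -
  interpret information_space M "exp 1" by unfold_locales simp
  define W where "W = (\<lambda>x. (X x, Y x, Z x))"
  note XZ = simple_function_Pair[OF X Z]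
  note YZ = simple_function_Pair[OF Y Z]
  have W: "simple_function M W" unfolding W_def by (rule simple_function_Pair[OF X YZ])
  have ms: "V -` {w} \<inter> space M \<in> events" if "simple_function M V" for V :: "_ \<Rightarrow> 'z" and w
    using that by (rule simple_functionD)
  define P where "P V v = prob (V -` {v} \<inter> space M)" for V :: "'a \<Rightarrow> 'z" and v
  define Pz where "Pz z = (if z \<in> Z ` space M then prob (Z -` {z} \<inter> space M) else 0)" for z
  define Pxz where "Pxz v = (if v \<in> (\<lambda>x. (X x, Z x)) ` space M then prob ((\<lambda>x. (X x, Z x)) -` {v} \<inter> space M) else 0)" for v
  define Pyz where "Pyz v = (if v \<in> (\<lambda>x. (Y x, Z x)) ` space M then prob ((\<lambda>x. (Y x, Z x)) -` {v} \<inter> space M) else 0)" for v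
  define Pw where "Pw v = (if v \<in> W ` space M then prob (W -` {v} \<inter> space M) else 0)" for v
  have d: "simple_distributed M Z Pz" "simple_distributed M (\<lambda>x. (Y x, Z x)) Pyz"
     "simple_distributed M (\<lambda>x. (X x, Z x)) Pxz" "simple_distributed M (\<lambda>x. (X x, Y x, Z x)) Pw"
    using Z YZ XZ W unfolding W_def[symmetric]
    by (auto intro!: simple_distributedI simp: Pz_def Pyz_def Pxz_def Pw_def measure_nonneg)
  let ?I = "conditional_mutual_information (exp 1) (count_space (X ` space M)) (count_space (Y ` space M))
    (count_space (Z ` space M)) X Y Z"
  have "0 \<le> ?I" by (rule conditional_mutual_information_nonneg[OF X Y Z])
  also have "?I = (\<Sum>(x, y, z)\<in>W ` space M. Pw (x, y, z) *
      log (exp 1) (Pw (x, y, z) / (Pxz (x, z) * (Pyz (y, z) / Pz z))))"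
    unfolding W_def by (rule conditional_mutual_information_eq[OF d])
  also have "\<dots> = (\<Sum>w\<in>W ` space M. Pw w * ln (Pw w) + Pw w * ln (Pz (snd (snd w)))
      - Pw w * ln (Pxz (fst w, snd (snd w))) - Pw w * ln (Pyz (snd w)))"
  proof (rule sum.cong[OF refl])
    fix w assume "w \<in> W ` space M"
    then obtain x y z where w: "w = (x, y, z)" "(x, y, z) \<in> W ` space M" by (metis prod_cases3)
    then have im: "z \<in> Z ` space M" "(x, z) \<in> (\<lambda>x. (X x, Z x)) ` space M" "(y, z) \<in> (\<lambda>x. (Y x, Z x)) ` space M"
      by (auto simp: W_def)
    have le: "Pw w \<le> Pz z" "Pw w \<le> Pxz (x, z)" "Pw w \<le> Pyz (y, z)"
      using im w simple_functionD(2)[OF Z] simple_functionD(2)[OF XZ] simple_functionD(2)[OF YZ]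
      unfolding Pw_def Pz_def Pxz_def Pyz_def by (auto simp: W_def intro!: finite_measure_mono)
    show "(case w of (x, y, z) \<Rightarrow> Pw (x, y, z) * log (exp 1) (Pw (x, y, z) / (Pxz (x, z) * (Pyz (y, z) / Pz z)))) =
        Pw w * ln (Pw w) + Pw w * ln (Pz (snd (snd w)))
        - Pw w * ln (Pxz (fst w, snd (snd w))) - Pw w * ln (Pyz (snd w))"
    proof (cases "Pw w = 0")
      case False
      then have pos: "Pw w > 0" unfolding Pw_def using measure_nonneg[of M] by (auto simp: less_le)
      then have "Pz z > 0" "Pxz (x, z) > 0" "Pyz (y, z) > 0" using le by auto
      then show ?thesis
        using pos w by (simp add: log_def ln_div ln_mult algebra_simps)
    qed (use w in simp)
  qed
  also have "\<dots> = (\<Sum>w\<in>W ` space M. Pw w * ln (Pw w)) + (\<Sum>w\<in>W ` space M. Pw w * ln (Pz (snd (snd w))))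
      - (\<Sum>w\<in>W ` space M. Pw w * ln (Pxz (fst w, snd (snd w)))) - (\<Sum>w\<in>W ` space M. Pw w * ln (Pyz (snd w)))"
    by (simp add: sum.distrib sum_subtractf)
  also have "(\<Sum>w\<in>W ` space M. Pw w * ln (Pw w)) = - shannon M W"
    unfolding shannon_def by (simp add: Pw_def)
  also have "(\<Sum>w\<in>W ` space M. Pw w * ln (Pz (snd (snd w)))) = - shannon M (\<lambda>x. snd (snd (W x)))"
    unfolding shannon_image[OF W, where f="\<lambda>w. snd (snd w)"]
    by (auto intro!: sum.cong simp: Pw_def Pz_def W_def)
  also have "(\<Sum>w\<in>W ` space M. Pw w * ln (Pxz (fst w, snd (snd w)))) = - shannon M (\<lambda>x. (fst (W x), snd (snd (W x))))"
    unfolding shannon_image[OF W, where f="\<lambda>w. (fst w, snd (snd w))"]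
    by (auto intro!: sum.cong simp: Pw_def Pxz_def W_def)
  also have "(\<Sum>w\<in>W ` space M. Pw w * ln (Pyz (snd w))) = - shannon M (\<lambda>x. snd (W x))"
    unfolding shannon_image[OF W, where f="snd"]
    by (auto intro!: sum.cong simp: Pw_def Pyz_def W_def)
  finally show ?thesis by (simp add: W_def)
qed

section \<open>Entropy rates of measure preserving maps\<close>

text \<open>Fekete's lemma. Division of n by k with remainder shows that u n / n is eventually at most u k / k
up to an arbitrarily small error, for every k \<ge> 1.\<close>

lemma subadditive_convergent:
  fixes u :: "nat \<Rightarrow> real"
  assumes sub: "\<And>m n. u (m + n) \<le> u m + u n" and nn: "\<And>n. 0 \<le> u n"
  shows "convergent (\<lambda>n. u n / real n)"
proof -
  define L where "L = (INF n\<in>{1..}. u n / real n)"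
  have bdd: "bdd_below ((\<lambda>n. u n / real n) ` {1..})" using nn by (intro bdd_belowI2[of _ 0]) auto
  have lower: "L \<le> u n / real n" if "n \<ge> 1" for n
    unfolding L_def by (rule cINF_lower[OF bdd]) (use that in auto)
  have mult: "u (q * k) \<le> real q * u k" if "q \<ge> 1" for q k
    using that
  proof (induction q rule: dec_induct)
    case (step q)
    then show ?case using sub[of k "q * k"] by (simp add: algebra_simps)
  qed simp
  have "(\<lambda>n. u n / real n) \<longlonglongrightarrow> L"
  proof (rule LIMSEQ_I)
    fix e :: real assume e: "e > 0"
    have "\<exists>k\<in>{1..}. u k / real k < L + e / 2"
      using e unfolding L_def by (subst cINF_less_iff[OF _ bdd, symmetric]) auto
    then obtain k where k: "k \<ge> 1" "u k / real k < L + e / 2" by auto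
    define M where "M = (\<Sum>r<k. u r)"
    have M: "u r \<le> M" if "r < k" for r unfolding M_def by (rule member_le_sum) (use that nn in auto)
    obtain N where N: "real N > 2 * M / e" using reals_Archimedean2 by blast
    show "\<exists>n0. \<forall>n\<ge>n0. norm (u n / real n - L) < e"
    proof (intro exI allI impI)
      fix n assume n: "n \<ge> max (max N k) 1"
      have q: "n div k \<ge> 1" using n k by (simp add: div_greater_zero_iff Suc_le_eq)
      have "u n \<le> u (n div k * k) + u (n mod k)" using sub[of "n div k * k" "n mod k"] by simp
      also have "\<dots> \<le> real (n div k) * u k + M"
        using mult[OF q, of k] M[of "n mod k"] k by auto
      also have "real (n div k) * u k = real (n div k * k) * (u k / real k)" using k by simp
      also have "\<dots> \<le> real n * (u k / real k)"
        by (intro mult_right_mono) (use nn[of k] in \<open>auto simp del: of_nat_mult\<close>)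
      finally have "u n / real n \<le> u k / real k + M / real n"
        using n by (simp add: field_simps)
      moreover have "M / real n < e / 2"
      proof -
        have "2 * M / e < real n" using N n by simp
        then show ?thesis using e n by (simp add: field_simps)
      qed
      ultimately have "u n / real n < L + e" using k(2) by linarith
      then show "norm (u n / real n - L) < e" using lower[of n] n by simp
    qed
  qed
  then show ?thesis by (rule convergentI)
qed

text \<open>The values of X that are not attained on the image of f have probability 0, hence contribute 0
ln 0 = 0.\<close>

lemma (in prob_space) shannon_distr:
  assumes f: "f \<in> measurable M N" and X: "simple_function (distr M N f) X"
  shows "shannon (distr M N f) X = shannon M (\<lambda>x. X (f x))"
proof -
  let ?D = "distr M N f"
  have fin: "finite (X ` space N)" using simple_functionD(1)[OF X] by simp
  have ms: "X -` {v} \<inter> space N \<in> sets N" for v using simple_functionD(2)[OF X, of "{v}"] by simp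
  have val: "measure ?D (X -` {v} \<inter> space ?D) = prob ((\<lambda>x. X (f x)) -` {v} \<inter> space M)" for v
    using f ms[of v] measurable_space[OF f]
    by (subst measure_distr) (auto intro!: arg_cong[where f=prob])
  have sub: "(\<lambda>x. X (f x)) ` space M \<subseteq> X ` space ?D" using measurable_space[OF f] by auto
  show ?thesis
    unfolding shannon_def val
  proof (rule arg_cong[where f=uminus], rule sum.mono_neutral_right[OF _ sub])
    show "\<forall>i\<in>X ` space ?D - (\<lambda>x. X (f x)) ` space M.
       prob ((\<lambda>x. X (f x)) -` {i} \<inter> space M) * ln (prob ((\<lambda>x. X (f x)) -` {i} \<inter> space M)) = 0"
    proof
      fix v assume "v \<in> X ` space ?D - (\<lambda>x. X (f x)) ` space M"
      then have "(\<lambda>x. X (f x)) -` {v} \<inter> space M = {}" by force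
      then show "prob ((\<lambda>x. X (f x)) -` {v} \<inter> space M) * ln (prob ((\<lambda>x. X (f x)) -` {v} \<inter> space M)) = 0"
        by (simp only: measure_empty mult_zero_left)
    qed
  qed (use fin in simp)
qed

definition itinerary :: "('x \<Rightarrow> 'x) \<Rightarrow> ('x \<Rightarrow> 'b) \<Rightarrow> nat \<Rightarrow> 'x \<Rightarrow> 'b list" where
  "itinerary T X n x = map (\<lambda>k. X ((T ^^ k) x)) [0..<n]"

text \<open>For the function that sends a point to its cell, this is the entropy rate of the partition
(\<open>entropy_rate_cell\<close>).\<close>

definition function_entropy_rate :: "('x \<Rightarrow> 'x) \<Rightarrow> 'x measure \<Rightarrow> ('x \<Rightarrow> 'b) \<Rightarrow> real" where
  "function_entropy_rate T M X = lim (\<lambda>n. shannon M (itinerary T X n) / real n)"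

lemma itinerary_Suc: "itinerary T X (Suc n) x = itinerary T X n x @ [X ((T ^^ n) x)]"
  by (simp add: itinerary_def)

lemma itinerary_add: "itinerary T X (m + n) x = itinerary T X m x @ itinerary T X n ((T ^^ m) x)"
proof (induction n)
  case 0
  then show ?case by (simp add: itinerary_def)
next
  case (Suc n)
  have "(T ^^ (m + n)) x = (T ^^ n) ((T ^^ m) x)" by (simp add: add.commute[of m n] funpow_add)
  then show ?case using Suc by (simp add: itinerary_Suc)
qed

locale measure_preserving = prob_space M for M :: "'x measure" +
  fixes T :: "'x \<Rightarrow> 'x"
  assumes T: "T \<in> measurable M M" and inv: "distr M M T = M"
begin

lemma T_pow: "T ^^ n \<in> measurable M M"
proof (induction n)
  case (Suc n)
  then show ?case using measurable_comp[OF Suc T] by (simp add: comp_def)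
qed (simp add: id_def)

lemma inv_pow: "distr M M (T ^^ n) = M"
proof (induction n)
  case 0
  then show ?case by (simp add: id_def distr_id)
next
  case (Suc n)
  have "distr M M (T ^^ Suc n) = distr (distr M M (T ^^ n)) M T"
    by (subst distr_distr[OF T T_pow]) (simp add: comp_def)
  then show ?case using Suc inv by (simp add: comp_def)
qed

lemma simple_comp: "simple_function M X \<Longrightarrow> simple_function M (\<lambda>x. X ((T ^^ n) x))"
  using simple_function_comp[OF T_pow, of X n] by (simp add: comp_def)

lemma shannon_comp_pow:
  assumes "simple_function M X"
  shows "shannon M (\<lambda>x. X ((T ^^ n) x)) = shannon M X"
  using shannon_distr[OF T_pow, of n X] assms by (simp add: inv_pow)

lemma simple_itinerary:
  assumes X: "simple_function M X"
  shows "simple_function M (itinerary T X n)"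
proof (induction n)
  case 0
  then show ?case by (simp add: itinerary_def[abs_def])
next
  case (Suc n)
  have "simple_function M ((\<lambda>(l, a). l @ [a]) \<circ> (\<lambda>x. (itinerary T X n x, X ((T ^^ n) x))))"
    by (intro simple_function_compose simple_function_Pair Suc simple_comp X)
  then show ?case by (simp add: itinerary_Suc[abs_def] comp_def)
qed

lemma shannon_nonneg:
  assumes X: "simple_function M X"
  shows "0 \<le> shannon M X"
proof -
  have "measure M (X -` {v} \<inter> space M) * ln (measure M (X -` {v} \<inter> space M)) \<le> 0" for v
    using measure_nonneg[of M "X -` {v} \<inter> space M"] prob_le_1[of "X -` {v} \<inter> space M"]
    by (cases "measure M (X -` {v} \<inter> space M) = 0")
       (auto intro!: mult_nonneg_nonpos simp: zero_less_measure_iff)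
  then show ?thesis unfolding shannon_def by (simp add: sum_nonpos)
qed

lemma shannon_itinerary_add:
  assumes X: "simple_function M X"
  shows "shannon M (itinerary T X (m + n)) \<le> shannon M (itinerary T X m) + shannon M (itinerary T X n)"
proof -
  note S = simple_itinerary[OF X]
  have "shannon M (itinerary T X (m + n)) =
      shannon M (\<lambda>x. (\<lambda>(a, b). a @ b) (itinerary T X m x, itinerary T X n ((T ^^ m) x)))"
    by (simp add: itinerary_add[abs_def])
  also have "\<dots> \<le> shannon M (\<lambda>x. (itinerary T X m x, itinerary T X n ((T ^^ m) x)))"
    by (intro shannon_comp_le simple_function_Pair S simple_comp)
  also have "\<dots> \<le> shannon M (itinerary T X m) + shannon M (\<lambda>x. itinerary T X n ((T ^^ m) x))"
    by (intro shannon_pair_le S simple_comp)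
  finally show ?thesis using shannon_comp_pow[OF S] by simp
qed

lemma function_entropy_rate_tendsto:
  assumes X: "simple_function M X"
  shows "(\<lambda>n. shannon M (itinerary T X n) / real n) \<longlonglongrightarrow> function_entropy_rate T M X"
  unfolding function_entropy_rate_def convergent_LIMSEQ_iff[symmetric]
  by (intro subadditive_convergent shannon_itinerary_add shannon_nonneg simple_itinerary X)

lemma function_entropy_rate_pow:
  assumes X: "simple_function M X"
  shows "function_entropy_rate T M (\<lambda>x. X ((T ^^ m) x)) = function_entropy_rate T M X"
proof -
  have "itinerary T (\<lambda>x. X ((T ^^ m) x)) n = (\<lambda>x. itinerary T X n ((T ^^ m) x))" for n
    by (rule ext) (simp add: itinerary_def funpow_add[symmetric, THEN fun_cong, unfolded comp_def] add.commute)
  then show ?thesis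
    unfolding function_entropy_rate_def by (simp add: shannon_comp_pow[OF simple_itinerary[OF X]])
qed

text \<open>The conditional entropy of the itinerary of X given that of Y increases at each step by at most the
conditional entropy of X given Y: conditioning the new letter of X on the past and on the whole
itinerary of Y instead of the new letter of Y only decreases its entropy.\<close>

lemma itinerary_conditional:
  fixes X :: "'x \<Rightarrow> 'b" and Y :: "'x \<Rightarrow> 'c"
  assumes X: "simple_function M X" and Y: "simple_function M Y"
  shows "shannon M (\<lambda>x. (itinerary T X n x, itinerary T Y n x)) - shannon M (itinerary T Y n)
    \<le> real n * (shannon M (\<lambda>x. (X x, Y x)) - shannon M Y)"
proof (induction n)
  case 0
  have "shannon M (\<lambda>x. (itinerary T X 0 x, itinerary T Y 0 x)) = shannon M (\<lambda>x. (\<lambda>l. ([] :: 'b list, l)) (itinerary T Y 0 x))"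
    by (simp add: itinerary_def)
  also have "\<dots> = shannon M (itinerary T Y 0)"
    by (rule shannon_comp_inj) (auto intro: simple_itinerary Y inj_onI)
  finally show ?case by simp
next
  case (Suc n)
  let ?A = "itinerary T X n" and ?B = "itinerary T Y n"
  let ?X = "\<lambda>x. X ((T ^^ n) x)" and ?Y = "\<lambda>x. Y ((T ^^ n) x)"
  note S = simple_itinerary[OF X] simple_itinerary[OF Y] simple_comp[OF X] simple_comp[OF Y]
  note SP = simple_function_Pair
  have 1: "shannon M (\<lambda>x. (itinerary T X (Suc n) x, itinerary T Y (Suc n) x))
      = shannon M (\<lambda>x. (\<lambda>((a, b), c, d). (a @ [c], b @ [d])) ((?A x, ?B x), ?X x, ?Y x))"
    by (simp add: itinerary_Suc)
  also have "\<dots> \<le> shannon M (\<lambda>x. ((?A x, ?B x), ?X x, ?Y x))"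
    by (intro shannon_comp_le SP S)
  also have "\<dots> + shannon M ?Y \<le> shannon M (\<lambda>x. ((?A x, ?B x), ?Y x)) + shannon M (\<lambda>x. (?X x, ?Y x))"
    by (intro shannon_strong_subadditive SP S)
  finally have a: "shannon M (\<lambda>x. (itinerary T X (Suc n) x, itinerary T Y (Suc n) x)) + shannon M ?Y
     \<le> shannon M (\<lambda>x. ((?A x, ?B x), ?Y x)) + shannon M (\<lambda>x. (?X x, ?Y x))" by simp
  have "shannon M (\<lambda>x. ((?A x, ?B x), ?Y x)) = shannon M (\<lambda>x. (\<lambda>(a, d, b). ((a, b), d)) (?A x, ?Y x, ?B x))"
    by simp
  also have "\<dots> \<le> shannon M (\<lambda>x. (?A x, ?Y x, ?B x))"
    by (intro shannon_comp_le SP S)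
  also have "\<dots> + shannon M ?B \<le> shannon M (\<lambda>x. (?A x, ?B x)) + shannon M (\<lambda>x. (?Y x, ?B x))"
    by (intro shannon_strong_subadditive S)
  finally have b: "shannon M (\<lambda>x. ((?A x, ?B x), ?Y x)) + shannon M ?B
    \<le> shannon M (\<lambda>x. (?A x, ?B x)) + shannon M (\<lambda>x. (?Y x, ?B x))" by simp
  have c: "shannon M (\<lambda>x. (?Y x, ?B x)) = shannon M (itinerary T Y (Suc n))"
  proof -
    have "shannon M (\<lambda>x. (\<lambda>(d, b). b @ [d]) (?Y x, ?B x)) = shannon M (\<lambda>x. (?Y x, ?B x))"
      by (intro shannon_comp_inj SP S) (auto intro!: inj_onI)
    then show ?thesis by (simp add: itinerary_Suc[abs_def])
  qed
  have d: "shannon M (\<lambda>x. (?X x, ?Y x)) = shannon M (\<lambda>x. (X x, Y x))"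
    using shannon_comp_pow[OF SP[OF X Y]] by simp
  have e: "shannon M ?Y = shannon M Y" by (rule shannon_comp_pow[OF Y])
  show ?case using a b c d e Suc by (simp add: algebra_simps)
qed

lemma function_entropy_rate_le:
  assumes X: "simple_function M X" and Y: "simple_function M Y"
  shows "function_entropy_rate T M X \<le>
    function_entropy_rate T M Y + (shannon M (\<lambda>x. (X x, Y x)) - shannon M Y)"
proof (rule LIMSEQ_le)
  let ?c = "shannon M (\<lambda>x. (X x, Y x)) - shannon M Y"
  show "(\<lambda>n. shannon M (itinerary T X n) / real n) \<longlonglongrightarrow> function_entropy_rate T M X"
    by (rule function_entropy_rate_tendsto[OF X])
  show "(\<lambda>n. shannon M (itinerary T Y n) / real n + ?c) \<longlonglongrightarrow> function_entropy_rate T M Y + ?c"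
    by (intro tendsto_add function_entropy_rate_tendsto[OF Y] tendsto_const)
  show "\<exists>N. \<forall>n\<ge>N. shannon M (itinerary T X n) / real n \<le> shannon M (itinerary T Y n) / real n + ?c"
  proof (intro exI allI impI)
    fix n :: nat assume n: "n \<ge> 1"
    have "shannon M (\<lambda>x. fst (itinerary T X n x, itinerary T Y n x)) \<le> shannon M (\<lambda>x. (itinerary T X n x, itinerary T Y n x))"
      by (intro shannon_comp_le simple_function_Pair simple_itinerary X Y)
    then have "shannon M (itinerary T X n) \<le> shannon M (itinerary T Y n) + real n * ?c"
      using itinerary_conditional[OF X Y, of n] by simp
    then show "shannon M (itinerary T X n) / real n \<le> shannon M (itinerary T Y n) / real n + ?c"
      using n by (simp add: field_simps)
  qed
qed

end

section \<open>Partitions and Kolmogorov--Sinai entropy\<close>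

lemma shannon_cong:
  assumes "\<And>x. x \<in> space M \<Longrightarrow> X x = Y x"
  shows "shannon M X = shannon M Y"
proof -
  have "X ` space M = Y ` space M" using assms by (intro image_cong) auto
  moreover have "X -` {v} \<inter> space M = Y -` {v} \<inter> space M" for v using assms by auto
  ultimately show ?thesis unfolding shannon_def by simp
qed

definition cell :: "'x set set \<Rightarrow> 'x \<Rightarrow> 'x set" where
  "cell P x = (THE A. A \<in> P \<and> x \<in> A)"

lemma cell_eq:
  assumes "partition_on S P" "A \<in> P" "x \<in> A"
  shows "cell P x = A"
  unfolding cell_def
proof (rule the_equality)
  fix B assume "B \<in> P \<and> x \<in> B"
  then show "B = A" using assms unfolding partition_on_def disjoint_def by blast
qed (use assms in auto)

lemma cell_in:
  assumes "partition_on S P" "x \<in> S"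
  shows "cell P x \<in> P" "x \<in> cell P x"
proof -
  obtain A where "A \<in> P" "x \<in> A" using assms unfolding partition_on_def by auto
  then show "cell P x \<in> P" "x \<in> cell P x" using cell_eq[OF assms(1)] by auto
qed

lemma cell_vimage:
  assumes "partition_on S P" "A \<in> P"
  shows "cell P -` {A} \<inter> S = A"
proof -
  have "A \<subseteq> S" using assms unfolding partition_on_def by auto
  then show ?thesis using cell_eq[OF assms] cell_in(2)[OF assms(1)] by auto
qed

lemma simple_function_cell:
  assumes "P \<in> finite_measurable_partitions M"
  shows "simple_function M (cell P)"
proof -
  have P: "finite P" "P \<subseteq> sets M" "partition_on (space M) P"
    using assms by (auto simp: finite_measurable_partitions_def)
  have sub: "cell P ` space M \<subseteq> P" using cell_in[OF P(3)] by auto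
  show ?thesis
    unfolding simple_function_def
  proof (intro conjI ballI)
    show "finite (cell P ` space M)" using sub P(1) by (rule finite_subset)
    fix A assume "A \<in> cell P ` space M"
    then have "A \<in> P" using sub by auto
    then show "cell P -` {A} \<inter> space M \<in> sets M" using cell_vimage[OF P(3)] P(2) by auto
  qed
qed

definition fibers_of :: "'x measure \<Rightarrow> ('x \<Rightarrow> 'b) \<Rightarrow> 'x set set" where
  "fibers_of M F = (\<lambda>v. F -` {v} \<inter> space M) ` (F ` space M)"

lemma partition_entropy_fibers_of: "partition_entropy M (fibers_of M F) = shannon M F"
proof -
  have inj: "inj_on (\<lambda>v. F -` {v} \<inter> space M) (F ` space M)"
    by (rule inj_onI) blast
  show ?thesis unfolding partition_entropy_def fibers_of_def shannon_def
    by (subst sum.reindex[OF inj]) simp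
qed

lemma partition_on_fibers_of: "partition_on (space M) (fibers_of M F)"
  unfolding partition_on_def fibers_of_def disjoint_def by auto

lemma fibers_of_finite_partition:
  assumes "simple_function M F"
  shows "fibers_of M F \<in> finite_measurable_partitions M"
  using partition_on_fibers_of simple_functionD[OF assms]
  by (auto simp: finite_measurable_partitions_def fibers_of_def)

lemma cell_fibers_of:
  assumes "x \<in> space M"
  shows "cell (fibers_of M F) x = F -` {F x} \<inter> space M"
  by (rule cell_eq[OF partition_on_fibers_of]) (use assms in \<open>auto simp: fibers_of_def\<close>)

context measure_preserving
begin

lemma pow_space: "x \<in> space M \<Longrightarrow> (T ^^ k) x \<in> space M"
  using measurable_space[OF T_pow] .

text \<open>The atoms of the iterated partition are the nonempty sets on which the itinerary is constant.
For n = 0 the common refinement of the empty family is the whole type instead of the space.\<close>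

lemma iterated_partition_eq:
  assumes P: "partition_on (space M) P" and n: "n > 0"
  shows "iterated_partition T M P n = fibers_of M (itinerary T (cell P) n)"
proof -
  define Q where "Q k = (\<lambda>A. (T ^^ k) -` A \<inter> space M) ` P" for k
  let ?F = "itinerary T (cell P) n"
  have it: "?F x = ?F y \<longleftrightarrow> (\<forall>k<n. cell P ((T ^^ k) x) = cell P ((T ^^ k) y))" for x y
    by (auto simp: itinerary_def)
  have block: "(\<Inter>R\<in>Q ` {..<n}. f R) = ?F -` {?F x} \<inter> space M"
    if f: "\<And>k. k < n \<Longrightarrow> f (Q k) \<in> Q k \<and> x \<in> f (Q k)" and x: "x \<in> space M" for f x
  proof -
    have fk: "f (Q k) = (T ^^ k) -` cell P ((T ^^ k) x) \<inter> space M" if kn: "k < n" for k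
    proof -
      obtain A where A: "A \<in> P" "f (Q k) = (T ^^ k) -` A \<inter> space M"
        using f[OF kn] by (auto simp: Q_def)
      moreover have "(T ^^ k) x \<in> A" using f[OF kn] A by auto
      ultimately show ?thesis using cell_eq[OF P, of A] by auto
    qed
    have mem: "z \<in> f (Q k) \<longleftrightarrow> cell P ((T ^^ k) z) = cell P ((T ^^ k) x)"
      if k: "k < n" and z: "z \<in> space M" for k z
    proof -
      have "(T ^^ k) z \<in> cell P ((T ^^ k) x) \<longleftrightarrow> cell P ((T ^^ k) z) = cell P ((T ^^ k) x)"
        using cell_eq[OF P cell_in(1)[OF P pow_space[OF x]], of "(T ^^ k) z" k] cell_in(2)[OF P pow_space[OF z], of k]
        by auto
      then show ?thesis unfolding fk[OF k] using z by auto
    qed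
    have "z \<in> space M" if "z \<in> (\<Inter>R\<in>Q ` {..<n}. f R)" for z
    proof -
      have "z \<in> f (Q 0)" using that n by blast
      then show ?thesis unfolding fk[OF n] by simp
    qed
    moreover have "z \<in> (\<Inter>R\<in>Q ` {..<n}. f R) \<longleftrightarrow> z \<in> ?F -` {?F x} \<inter> space M" if z: "z \<in> space M" for z
    proof -
      have "z \<in> (\<Inter>R\<in>Q ` {..<n}. f R) \<longleftrightarrow> (\<forall>k<n. z \<in> f (Q k))" by blast
      also have "\<dots> \<longleftrightarrow> (\<forall>k<n. cell P ((T ^^ k) z) = cell P ((T ^^ k) x))" using mem z by simp
      also have "\<dots> \<longleftrightarrow> z \<in> ?F -` {?F x} \<inter> space M" using z by (simp add: it)
      finally show ?thesis .
    qed
    ultimately show ?thesis by blast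
  qed
  have "common_refinement (Q ` {..<n}) = fibers_of M ?F"
  proof (intro set_eqI iffI)
    fix B assume "B \<in> common_refinement (Q ` {..<n})"
    then obtain f where f: "f \<in> (\<Pi> R\<in>Q ` {..<n}. R)" "B = \<Inter> (f ` Q ` {..<n})" "B \<noteq> {}"
      by (auto simp: common_refinement)
    then obtain x where x: "x \<in> B" by auto
    have fx: "f (Q k) \<in> Q k \<and> x \<in> f (Q k)" if "k < n" for k using f x that by auto
    have "x \<in> space M" using fx[OF n] by (auto simp: Q_def)
    then show "B \<in> fibers_of M ?F" using block[OF fx] f(2) by (auto simp: fibers_of_def)
  next
    fix B assume "B \<in> fibers_of M ?F"
    then obtain x where x: "x \<in> space M" "B = ?F -` {?F x} \<inter> space M" by (auto simp: fibers_of_def)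
    define f where "f R = (SOME A. A \<in> R \<and> x \<in> A)" for R
    have f: "f (Q k) \<in> Q k \<and> x \<in> f (Q k)" for k
    proof -
      have "(T ^^ k) -` cell P ((T ^^ k) x) \<inter> space M \<in> Q k \<and> x \<in> (T ^^ k) -` cell P ((T ^^ k) x) \<inter> space M"
        using cell_in[OF P pow_space[OF x(1), of k]] x(1) by (auto simp: Q_def)
      then show ?thesis unfolding f_def by (rule someI)
    qed
    have "B = \<Inter> (f ` Q ` {..<n})" using block[of f, OF f x(1)] x(2) by simp
    moreover have "B \<noteq> {}" using x by auto
    moreover have "f \<in> (\<Pi> R\<in>Q ` {..<n}. R)" using f by auto
    ultimately show "B \<in> common_refinement (Q ` {..<n})"
      unfolding common_refinement by blast
  qed
  then show ?thesis by (simp add: iterated_partition_def Q_def)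
qed

lemma entropy_rate_cell:
  assumes "P \<in> finite_measurable_partitions M"
  shows "entropy_rate T M P = function_entropy_rate T M (cell P)"
proof -
  have P: "partition_on (space M) P" using assms by (auto simp: finite_measurable_partitions_def)
  have "(\<lambda>n. partition_entropy M (iterated_partition T M P n) / real n) \<longlonglongrightarrow> l \<longleftrightarrow>
      (\<lambda>n. shannon M (itinerary T (cell P) n) / real n) \<longlonglongrightarrow> l" for l
  proof (rule filterlim_cong[OF refl refl])
    show "\<forall>\<^sub>F n in sequentially. partition_entropy M (iterated_partition T M P n) / real n
      = shannon M (itinerary T (cell P) n) / real n"
      using eventually_gt_at_top[of 0]
      by eventually_elim (simp add: iterated_partition_eq[OF P] partition_entropy_fibers_of)
  qed
  then show ?thesis unfolding entropy_rate_def function_entropy_rate_def lim_def by simp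
qed

lemma entropy_rate_fibers_of:
  assumes F: "simple_function M F"
  shows "entropy_rate T M (fibers_of M F) = function_entropy_rate T M F"
proof -
  define g where "g v = F -` {v} \<inter> space M" for v
  have "shannon M (itinerary T (cell (fibers_of M F)) n) = shannon M (itinerary T F n)" for n
  proof -
    have "shannon M (itinerary T (cell (fibers_of M F)) n) = shannon M (\<lambda>x. map g (itinerary T F n x))"
      by (rule shannon_cong) (auto simp: itinerary_def cell_fibers_of pow_space g_def)
    also have "\<dots> = shannon M (itinerary T F n)"
    proof (rule shannon_comp_inj[OF simple_itinerary[OF F]])
      have "inj_on g (F ` space M)" unfolding g_def by (rule inj_onI) blast
      then have "inj_on (map g) (lists (F ` space M))" by (rule inj_on_map_lists)
      then show "inj_on (map g) (itinerary T F n ` space M)"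
        by (rule inj_on_subset) (auto simp: itinerary_def pow_space)
    qed
    finally show ?thesis .
  qed
  then show ?thesis
    unfolding entropy_rate_cell[OF fibers_of_finite_partition[OF F]] function_entropy_rate_def by simp
qed

lemma KS_entropy_upper:
  assumes F: "simple_function M F"
  shows "ereal (function_entropy_rate T M F) \<le> KS_entropy T M"
  unfolding KS_entropy_def entropy_rate_fibers_of[OF F, symmetric]
  by (rule SUP_upper[OF fibers_of_finite_partition[OF F]])

lemma KS_entropy_least:
  assumes "\<And>P. P \<in> finite_measurable_partitions M \<Longrightarrow> ereal (function_entropy_rate T M (cell P)) \<le> c"
  shows "KS_entropy T M \<le> c"
  unfolding KS_entropy_def using assms by (intro SUP_least) (simp add: entropy_rate_cell)

end

lemma uniformly_continuous_xlnx: "uniformly_continuous_on {0..1} (\<lambda>t :: real. t * ln t)"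
proof (rule compact_uniformly_continuous)
  show "continuous_on {0..1} (\<lambda>t :: real. t * ln t)"
    unfolding continuous_on_eq_continuous_within
  proof
    fix t :: real assume t: "t \<in> {0..1}"
    show "continuous (at t within {0..1}) (\<lambda>t. t * ln t)"
    proof (cases "t = 0")
      case True
      have "((\<lambda>t :: real. t * ln t) \<longlongrightarrow> 0) (at_right 0)" by real_asymp
      then have "((\<lambda>t :: real. t * ln t) \<longlongrightarrow> 0) (at 0 within {0..1})"
        by (simp add: at_within_Icc_at_right)
      then show ?thesis using True by (simp add: continuous_within)
    next
      case False
      then show ?thesis using t by (intro continuous_intros) auto
    qed
  qed
qed simp

text \<open>The conditional entropy of X given Y is small when X = Y with high probability: the difference of
entropies compares the values of t ln t at the joint probabilities with the values they would
have for X = Y, and all arguments move by less than d. Since d depends on V and e only, it can be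
fixed before the measure and the functions are known.\<close>

lemma conditional_shannon_small:
  fixes V :: "'b set"
  assumes V: "finite V" and e: "e > 0"
  obtains d where "d > 0" "\<And>(M :: 'a measure) X Y. \<lbrakk>prob_space M; simple_function M X; simple_function M Y;
     X ` space M \<subseteq> V; Y ` space M \<subseteq> V; measure M {x \<in> space M. X x \<noteq> Y x} < d\<rbrakk> \<Longrightarrow>
     shannon M (\<lambda>x. (X x, Y x)) - shannon M Y \<le> e"
proof -
  define \<eta> where "\<eta> t = t * ln t" for t :: real
  define N where "N = real (card (V \<times> V))"
  define c where "c = e / (N + 1)"
  have N: "N \<ge> 0" by (simp add: N_def)
  have c: "c > 0" unfolding c_def using e N by simp
  obtain d where d: "d > 0" "\<And>s t. s \<in> {0..1} \<Longrightarrow> t \<in> {0..1} \<Longrightarrow> \<bar>s - t\<bar> < d \<Longrightarrow> \<bar>\<eta> s - \<eta> t\<bar> < c"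
    using uniformly_continuous_xlnx c unfolding uniformly_continuous_on_def dist_real_def \<eta>_def by metis
  show thesis
  proof (rule that[OF d(1)])
    fix M :: "'a measure" and X Y :: "'a \<Rightarrow> 'b"
    assume M: "prob_space M" and X: "simple_function M X" and Y: "simple_function M Y"
      and sub: "X ` space M \<subseteq> V" "Y ` space M \<subseteq> V" and small: "measure M {x \<in> space M. X x \<noteq> Y x} < d"
    interpret prob_space M by fact
    define q where "q w = prob (Y -` {w} \<inter> space M)" for w
    define p where "p z = prob ((\<lambda>x. (X x, Y x)) -` {z} \<inter> space M)" for z
    note XY = simple_function_Pair[OF X Y]
    have sY: "Y -` {w} \<inter> space M \<in> events" for w using simple_functionD(2)[OF Y] .
    have sXY: "(\<lambda>x. (X x, Y x)) -` {z} \<inter> space M \<in> events" for z using simple_functionD(2)[OF XY] .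
    have sne: "{x \<in> space M. X x \<noteq> Y x} \<in> events"
    proof -
      have "(\<lambda>x. (X x, Y x)) -` {z. fst z \<noteq> snd z} \<inter> space M \<in> events" using simple_functionD(2)[OF XY] .
      also have "(\<lambda>x. (X x, Y x)) -` {z. fst z \<noteq> snd z} \<inter> space M = {x \<in> space M. X x \<noteq> Y x}" by auto
      finally show ?thesis .
    qed
    have "shannon M (\<lambda>x. (X x, Y x)) = - (\<Sum>z\<in>V \<times> V. \<eta> (p z))"
      unfolding shannon_def \<eta>_def p_def
    proof (rule arg_cong[where f=uminus], rule sum.mono_neutral_left)
      show "\<forall>z\<in>V \<times> V - (\<lambda>x. (X x, Y x)) ` space M. prob ((\<lambda>x. (X x, Y x)) -` {z} \<inter> space M) *
            ln (prob ((\<lambda>x. (X x, Y x)) -` {z} \<inter> space M)) = 0"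
      proof
        fix z assume "z \<in> V \<times> V - (\<lambda>x. (X x, Y x)) ` space M"
        then have "(\<lambda>x. (X x, Y x)) -` {z} \<inter> space M = {}" by force
        then show "prob ((\<lambda>x. (X x, Y x)) -` {z} \<inter> space M) * ln (prob ((\<lambda>x. (X x, Y x)) -` {z} \<inter> space M)) = 0"
          by (simp only: measure_empty mult_zero_left)
      qed
    qed (use V sub in auto)
    moreover have "shannon M Y = - (\<Sum>w\<in>V. \<eta> (q w))"
      unfolding shannon_def \<eta>_def q_def
    proof (rule arg_cong[where f=uminus], rule sum.mono_neutral_left)
      show "\<forall>z\<in>V - Y ` space M. prob (Y -` {z} \<inter> space M) * ln (prob (Y -` {z} \<inter> space M)) = 0"
      proof
        fix z assume "z \<in> V - Y ` space M"
        then have "Y -` {z} \<inter> space M = {}" by force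
        then show "prob (Y -` {z} \<inter> space M) * ln (prob (Y -` {z} \<inter> space M)) = 0"
          by (simp only: measure_empty mult_zero_left)
      qed
    qed (use V sub in auto)
    moreover have "(\<Sum>w\<in>V. \<eta> (q w)) = (\<Sum>z\<in>V \<times> V. if fst z = snd z then \<eta> (q (snd z)) else 0)"
    proof -
      have "(\<Sum>z\<in>V \<times> V. if fst z = snd z then \<eta> (q (snd z)) else 0) =
          (\<Sum>v\<in>V. \<Sum>w\<in>V. if v = w then \<eta> (q w) else 0)"
        by (simp add: sum.cartesian_product split_beta')
      also have "\<dots> = (\<Sum>w\<in>V. \<eta> (q w))" using V by simp
      finally show ?thesis by simp
    qed
    ultimately have "shannon M (\<lambda>x. (X x, Y x)) - shannon M Y =
        (\<Sum>z\<in>V \<times> V. (if fst z = snd z then \<eta> (q (snd z)) else 0) - \<eta> (p z))"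
      by (simp add: sum_subtractf)
    also have "\<dots> \<le> (\<Sum>z\<in>V \<times> V. c)"
    proof (rule sum_mono)
      fix z assume "z \<in> V \<times> V"
      obtain v w where z: "z = (v, w)" by (cases z)
      have p01: "p z \<in> {0..1}" unfolding p_def by auto
      have q01: "q w \<in> {0..1}" unfolding q_def by auto
      show "(if fst z = snd z then \<eta> (q (snd z)) else 0) - \<eta> (p z) \<le> c"
      proof (cases "v = w")
        case True
        have "q w \<le> p z + measure M {x \<in> space M. X x \<noteq> Y x}"
        proof -
          have "q w \<le> prob (((\<lambda>x. (X x, Y x)) -` {z} \<inter> space M) \<union> {x \<in> space M. X x \<noteq> Y x})"
            unfolding q_def using sXY sne True z by (intro finite_measure_mono) auto
          also have "\<dots> \<le> p z + prob {x \<in> space M. X x \<noteq> Y x}"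
            unfolding p_def by (rule measure_Un_le[OF sXY sne])
          finally show ?thesis .
        qed
        moreover have "p z \<le> q w"
          unfolding p_def q_def using sY z by (intro finite_measure_mono) auto
        ultimately have "\<bar>q w - p z\<bar> < d" using small by linarith
        then show ?thesis using d(2)[OF q01 p01] True z by auto
      next
        case False
        have "p z \<le> measure M {x \<in> space M. X x \<noteq> Y x}"
          unfolding p_def using sne False z by (intro finite_measure_mono) auto
        then have "\<bar>0 - p z\<bar> < d" using small p01 by auto
        then have "\<bar>\<eta> 0 - \<eta> (p z)\<bar> < c" using p01 by (intro d(2)) auto
        then show ?thesis using False z by (simp add: \<eta>_def)
      qed
    qed
    also have "\<dots> = N * c" by (simp add: N_def)
    also have "\<dots> \<le> (N + 1) * c" using c by (simp add: algebra_simps)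
    also have "\<dots> = e" unfolding c_def using N by simp
    finally show "shannon M (\<lambda>x. (X x, Y x)) - shannon M Y \<le> e" .
  qed
qed

section \<open>Entropy of extensions with shrinking fibers\<close>

text \<open>The indicator function of a closed set is a decreasing limit of continuous functions, and closed
sets form a generator of the Borel sets that is stable under intersections.\<close>

lemma borel_measure_eqI_continuous:
  fixes M N :: "'a::metric_space measure"
  assumes M: "prob_space M" "sets M = sets borel" and N: "prob_space N" "sets N = sets borel"
    and eq: "\<And>f :: 'a \<Rightarrow> real. continuous_on UNIV f \<Longrightarrow> (\<And>x. f x \<in> {0..1}) \<Longrightarrow> (\<integral>x. f x \<partial>M) = (\<integral>x. f x \<partial>N)"
  shows "M = N"
proof -
  have lim: "(\<lambda>n. \<integral>x. max 0 (1 - real n * infdist x C) \<partial>K) \<longlonglongrightarrow> measure K C"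
    if K: "prob_space K" "sets K = sets borel" and C: "closed C" "C \<noteq> {}" for C and K :: "'a measure"
  proof -
    interpret prob_space K by fact
    note [measurable_cong] = K(2)
    have [measurable]: "(\<lambda>x. infdist x C) \<in> borel_measurable borel"
      by (intro borel_measurable_continuous_onI continuous_on_infdist continuous_on_id)
    have Cm: "C \<in> sets K" using C K by auto
    have "(\<lambda>n. \<integral>x. max 0 (1 - real n * infdist x C) \<partial>K) \<longlonglongrightarrow> (\<integral>x. indicator C x \<partial>K)"
    proof (rule integral_dominated_convergence[where w="\<lambda>_. 1"])
      show "AE x in K. (\<lambda>n. max 0 (1 - real n * infdist x C)) \<longlonglongrightarrow> indicator C x"
      proof (rule AE_I2)
        fix x
        show "(\<lambda>n. max 0 (1 - real n * infdist x C)) \<longlonglongrightarrow> indicator C x"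
        proof (cases "x \<in> C")
          case False
          then have "infdist x C \<noteq> 0" using C in_closed_iff_infdist_zero by blast
          then have pos: "infdist x C > 0" using infdist_nonneg[of x C] by linarith
          obtain n0 where n0: "real n0 > 1 / infdist x C" using reals_Archimedean2 by blast
          have "eventually (\<lambda>n. max 0 (1 - real n * infdist x C) = indicator C x) sequentially"
            using eventually_ge_at_top[of n0]
          proof eventually_elim
            case (elim n)
            have "1 / infdist x C < real n" using n0 elim by linarith
            then have "1 < real n * infdist x C" using pos by (simp add: field_simps)
            then show ?case using False by simp
          qed
          then show ?thesis by (rule tendsto_eventually)
        qed simp
      qed
      show "AE x in K. norm (max 0 (1 - real n * infdist x C)) \<le> 1" for n
        using infdist_nonneg[of _ C] by (intro AE_I2) auto
    qed (use Cm in auto)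
    then show ?thesis using Cm sets.sets_into_space[OF Cm] by (simp add: Int_absorb2)
  qed
  interpret M: prob_space M by fact
  interpret N: prob_space N by fact
  have closed: "measure M C = measure N C" if C: "closed C" for C
  proof (cases "C = {}")
    case False
    have "(\<integral>x. max 0 (1 - real n * infdist x C) \<partial>M) = (\<integral>x. max 0 (1 - real n * infdist x C) \<partial>N)" for n
      by (rule eq) (auto intro!: continuous_intros simp: infdist_nonneg)
    then show ?thesis using lim[OF M C False] lim[OF N C False] LIMSEQ_unique by auto
  qed simp
  show ?thesis
  proof (rule measure_eqI_generator_eq[where E="{C. closed C}" and \<Omega>=UNIV and A="\<lambda>_. UNIV"])
    show "Int_stable {C :: 'a set. closed C}" by (auto simp: Int_stable_def)
    show "sets M = sigma_sets UNIV {C. closed C}" "sets N = sigma_sets UNIV {C. closed C}"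
      unfolding M(2) N(2) by (subst borel_eq_closed, simp)+
    show "emeasure M X = emeasure N X" if "X \<in> {C. closed C}" for X
      using closed[of X] that by (simp add: M.emeasure_eq_measure N.emeasure_eq_measure)
  qed auto
qed

lemma invariant_prob_measure_preserving:
  fixes T :: "'a::topological_space \<Rightarrow> 'a"
  assumes "invariant_prob T \<mu>" and T: "T \<in> borel_measurable borel"
  shows "measure_preserving \<mu> T" "sets \<mu> = sets borel" "space \<mu> = UNIV"
proof -
  have s: "sets \<mu> = sets borel" and pr: "prob_space \<mu>" and i: "distr \<mu> borel T = \<mu>"
    using assms by (auto simp: invariant_prob_def)
  interpret prob_space \<mu> by (rule pr)
  show "sets \<mu> = sets borel" "space \<mu> = UNIV" using s sets_eq_imp_space_eq[OF s] by auto
  show "measure_preserving \<mu> T"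
  proof
    show "T \<in> measurable \<mu> \<mu>" using T by (simp add: measurable_cong_sets[OF s s])
    have "distr \<mu> \<mu> T = distr \<mu> borel T" by (rule distr_cong) (use s in auto)
    then show "distr \<mu> \<mu> T = \<mu>" using i by simp
  qed
qed

locale shrinking_extension =
  fixes T :: "'x::metric_space \<Rightarrow> 'x" and S :: "'y::metric_space \<Rightarrow> 'y"
    and p :: "'x \<Rightarrow> 'y" and \<sigma> :: "'y \<Rightarrow> 'x" and a :: "nat \<Rightarrow> real"
  assumes compact_X: "compact (UNIV :: 'x set)" and compact_Y: "compact (UNIV :: 'y set)"
    and T_cont: "continuous_on UNIV T" and S_meas: "S \<in> borel_measurable borel"
    and p_cont: "continuous_on UNIV p" and \<sigma>_cont: "continuous_on UNIV \<sigma>"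
    and equivariant: "p (T x) = S (p x)" and sect: "p (\<sigma> y) = y"
    and shrink: "p x = p x' \<Longrightarrow> dist ((T ^^ n) x) ((T ^^ n) x') \<le> a n"
    and shrink_0: "a \<longlonglongrightarrow> 0"
begin

lemma T_meas[measurable]: "T \<in> borel_measurable borel"
  by (rule borel_measurable_continuous_onI[OF T_cont])

lemma p_meas[measurable]: "p \<in> borel_measurable borel"
  by (rule borel_measurable_continuous_onI[OF p_cont])

lemma \<sigma>_meas[measurable]: "\<sigma> \<in> borel_measurable borel"
  by (rule borel_measurable_continuous_onI[OF \<sigma>_cont])

declare S_meas[measurable]

lemma T_pow_cont: "continuous_on UNIV (T ^^ n)"
proof (induction n)
  case (Suc n)
  then show ?case using continuous_on_compose[OF Suc] continuous_on_subset[OF T_cont] by (auto simp: comp_def)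
qed (simp add: id_def continuous_on_id)

lemma T_pow_meas[measurable]: "T ^^ n \<in> borel_measurable borel"
  by (rule borel_measurable_continuous_onI[OF T_pow_cont])

lemma S_pow_meas[measurable]: "S ^^ n \<in> borel_measurable borel"
  by (induction n) auto

lemma p_pow: "p ((T ^^ n) x) = (S ^^ n) (p x)"
  by (induction n) (simp_all add: equivariant)

lemma near_section: "dist ((T ^^ n) (\<sigma> (p x))) ((T ^^ n) x) \<le> a n"
  by (rule shrink) (simp add: sect)

lemma shrink_nonneg: "0 \<le> a n"
  using shrink[of undefined undefined n] by simp

lemmas invariant_measure_preserving = invariant_prob_measure_preserving[OF _ T_meas]
lemmas invariant_measure_preserving_S = invariant_prob_measure_preserving[OF _ S_meas]

lemma project_invariant:
  assumes "invariant_prob T \<mu>"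
  shows "invariant_prob S (distr \<mu> borel p)"
proof -
  have s[measurable_cong]: "sets \<mu> = sets borel" and pr: "prob_space \<mu>" and i: "distr \<mu> borel T = \<mu>"
    using assms by (auto simp: invariant_prob_def)
  interpret prob_space \<mu> by (rule pr)
  have "distr (distr \<mu> borel p) borel S = distr \<mu> borel (\<lambda>x. S (p x))"
    by (subst distr_distr) (auto simp: comp_def)
  also have "\<dots> = distr (distr \<mu> borel T) borel p"
    by (subst distr_distr) (auto simp: comp_def equivariant)
  finally show ?thesis
    unfolding invariant_prob_def i by (auto intro!: prob_space_distr)
qed

text \<open>For closed C the preimage of C under T^n is sandwiched: it is contained in the set of x for which
T^n (\<sigma> (p x)) is within a n of C, which in turn is contained in the preimage of the closed
2 a n-neighbourhood of C. By invariance the outer sets differ in measure by as much as C and its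
neighbourhood do, which tends to 0. The sets with the claimed property form a Dynkin system;
requiring it for all large n makes it stable under unions.\<close>

lemma pullback_approximation:
  assumes \<mu>: "invariant_prob T \<mu>" and A: "A \<in> sets borel" and e: "e > 0"
  shows "\<exists>n0. \<forall>n\<ge>n0. \<exists>B\<in>sets borel. measure \<mu> (sym_diff ((T ^^ n) -` A) (p -` B)) < e"
proof -
  interpret measure_preserving \<mu> T using invariant_measure_preserving[OF \<mu>] by simp
  note s[measurable_cong] = invariant_measure_preserving(2)[OF \<mu>]
  note sp = invariant_measure_preserving(3)[OF \<mu>]
  have vT: "(T ^^ n) -` A \<in> sets \<mu>" if "A \<in> sets borel" for A n
    using measurable_sets[OF T_pow, of A n] that s sp by simp
  have vp: "p -` B \<in> sets \<mu>" if "B \<in> sets borel" for B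
    using measurable_sets[OF p_meas, of B] that s by simp
  have mT: "measure \<mu> ((T ^^ n) -` A) = measure \<mu> A" if "A \<in> sets borel" for A n
  proof -
    have "measure (distr \<mu> \<mu> (T ^^ n)) A = measure \<mu> ((T ^^ n) -` A \<inter> space \<mu>)"
      by (rule measure_distr[OF T_pow]) (use that s in simp)
    then show ?thesis by (simp add: inv_pow sp)
  qed
  let ?P = "\<lambda>A. \<forall>e>0. \<exists>n0. \<forall>n\<ge>n0. \<exists>B\<in>sets borel. measure \<mu> (sym_diff ((T ^^ n) -` A) (p -` B)) < e"
  have basic: "?P C" if C: "closed C" for C
  proof (cases "C = {}")
    case True
    then show ?thesis by (auto intro!: bexI[of _ "{}"])
  next
    case False
    have [measurable]: "(\<lambda>x. infdist x C) \<in> borel_measurable borel"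
      by (intro borel_measurable_continuous_onI continuous_on_infdist continuous_on_id)
    define D where "D k = {x. infdist x C \<le> 1 / real (Suc k)}" for k
    have D: "D k \<in> sets borel" for k unfolding D_def by measurable
    have Cb: "C \<in> sets borel" using C by simp
    have "(\<lambda>k. measure \<mu> (D k)) \<longlonglongrightarrow> measure \<mu> (\<Inter>k. D k)"
    proof (rule finite_Lim_measure_decseq)
      show "range D \<subseteq> sets \<mu>" using D s by auto
      show "decseq D" unfolding decseq_def D_def
        by (auto intro: order_trans[OF _ divide_left_mono])
    qed
    moreover have "(\<Inter>k. D k) = C"
    proof (intro set_eqI iffI)
      fix x assume x: "x \<in> (\<Inter>k. D k)"
      have "infdist x C \<le> 0"
      proof (rule ccontr)
        assume "\<not> infdist x C \<le> 0"
        then obtain k where "1 / Suc k < infdist x C" using nat_approx_posE[of "infdist x C"] by auto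
        then show False using x by (auto simp: D_def not_le dest!: spec[of _ k])
      qed
      then show "x \<in> C" using in_closed_iff_infdist_zero[OF C False] infdist_nonneg[of x C] by auto
    qed (auto simp: D_def)
    ultimately have lim: "(\<lambda>k. measure \<mu> (D k)) \<longlonglongrightarrow> measure \<mu> C" by simp
    show ?thesis
    proof (intro allI impI)
      fix e :: real assume e: "e > 0"
      obtain k where "\<bar>measure \<mu> (D k) - measure \<mu> C\<bar> < e"
        using LIMSEQ_D[OF lim e] by auto
      then have k: "measure \<mu> (D k) < measure \<mu> C + e" by auto
      have "(\<lambda>n. 2 * a n) \<longlonglongrightarrow> 2 * 0" by (intro tendsto_intros shrink_0)
      then have "eventually (\<lambda>n. 2 * a n < 1 / real (Suc k)) sequentially"
        by (rule order_tendstoD) simp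
      then obtain n0 where n0: "\<And>n. n \<ge> n0 \<Longrightarrow> 2 * a n < 1 / real (Suc k)"
        by (auto simp: eventually_sequentially)
      show "\<exists>n0. \<forall>n\<ge>n0. \<exists>B\<in>sets borel. measure \<mu> (sym_diff ((T ^^ n) -` C) (p -` B)) < e"
      proof (intro exI[of _ n0] allI impI)
        fix n assume n: "n \<ge> n0"
        define B where "B = {y. infdist ((T ^^ n) (\<sigma> y)) C \<le> a n}"
        have "B \<in> sets borel" unfolding B_def by measurable
        have "sym_diff ((T ^^ n) -` C) (p -` B) \<subseteq> (T ^^ n) -` D k - (T ^^ n) -` C"
        proof -
          have "p x \<in> B" if "(T ^^ n) x \<in> C" for x
            unfolding B_def mem_Collect_eq by (rule infdist_le2[OF that near_section])
          moreover have "(T ^^ n) x \<in> D k" if "p x \<in> B" for x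
          proof -
            have "infdist ((T ^^ n) x) C \<le> infdist ((T ^^ n) (\<sigma> (p x))) C + dist ((T ^^ n) x) ((T ^^ n) (\<sigma> (p x)))"
              by (rule infdist_triangle)
            also have "\<dots> \<le> a n + a n"
              using that near_section[of n x] by (intro add_mono) (auto simp: B_def dist_commute)
            finally show ?thesis using n0[OF n] by (simp add: D_def)
          qed
          ultimately show ?thesis by auto
        qed
        then have "measure \<mu> (sym_diff ((T ^^ n) -` C) (p -` B)) \<le> measure \<mu> ((T ^^ n) -` D k - (T ^^ n) -` C)"
          using vT[OF D] vT[OF Cb] by (intro finite_measure_mono) auto
        also have "\<dots> = measure \<mu> ((T ^^ n) -` D k) - measure \<mu> ((T ^^ n) -` C)"
          using vT[OF D] vT[OF Cb] by (intro finite_measure_Diff) (auto simp: D_def)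
        also have "\<dots> < e" using k by (simp add: mT D Cb)
        finally show "\<exists>B\<in>sets borel. measure \<mu> (sym_diff ((T ^^ n) -` C) (p -` B)) < e"
          using \<open>B \<in> sets borel\<close> by blast
      qed
    qed
  qed
  have gen: "sigma_sets UNIV (Collect closed) = sets (borel :: 'x measure)" by (simp add: borel_eq_closed)
  have closed_Pow: "Collect closed \<subseteq> Pow (UNIV :: 'x set)" by simp
  have stable: "Int_stable (Collect closed :: 'x set set)" by (auto simp: Int_stable_def)
  have "A \<in> sigma_sets UNIV (Collect closed)" using A by (simp add: gen)
  with stable closed_Pow have "?P A"
  proof (induction rule: sigma_sets_induct_disjoint)
    case (basic A)
    then show ?case using \<open>\<And>C. closed C \<Longrightarrow> ?P C\<close> by auto
  next
    case empty
    then show ?case by (auto intro!: bexI[of _ "{}"])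
  next
    case (compl A)
    show ?case
    proof (intro allI impI)
      fix e :: real assume "e > 0"
      then obtain n0 where n0: "\<forall>n\<ge>n0. \<exists>B\<in>sets borel. measure \<mu> (sym_diff ((T ^^ n) -` A) (p -` B)) < e"
        using compl by blast
      show "\<exists>n0. \<forall>n\<ge>n0. \<exists>B\<in>sets borel. measure \<mu> (sym_diff ((T ^^ n) -` (UNIV - A)) (p -` B)) < e"
      proof (intro exI[of _ n0] allI impI)
        fix n assume "n \<ge> n0"
        then obtain B where B: "B \<in> sets borel" "measure \<mu> (sym_diff ((T ^^ n) -` A) (p -` B)) < e"
          using n0 by blast
        have "sym_diff ((T ^^ n) -` (UNIV - A)) (p -` (UNIV - B)) = sym_diff ((T ^^ n) -` A) (p -` B)" by auto
        then show "\<exists>B\<in>sets borel. measure \<mu> (sym_diff ((T ^^ n) -` (UNIV - A)) (p -` B)) < e"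
          using B by (intro bexI[of _ "UNIV - B"]) auto
      qed
    qed
  next
    case (union A)
    have Ab: "A i \<in> sets borel" for i using union(2) gen by auto
    show ?case
    proof (intro allI impI)
      fix e :: real assume e: "e > 0"
      have "(\<lambda>N. measure \<mu> (\<Union>i<N. A i)) \<longlonglongrightarrow> measure \<mu> (\<Union>N. \<Union>i<N. A i)"
        
      proof (rule finite_Lim_measure_incseq)
        show "range (\<lambda>N. \<Union>i<N. A i) \<subseteq> sets \<mu>" using Ab s by auto
        show "incseq (\<lambda>N. \<Union>i<N. A i)" unfolding incseq_def by fastforce
      qed
      moreover have "(\<Union>N. \<Union>i<N. A i) = (\<Union>i. A i)" by blast
      ultimately have "(\<lambda>N. measure \<mu> (\<Union>i<N. A i)) \<longlonglongrightarrow> measure \<mu> (\<Union>i. A i)" by simp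
      from LIMSEQ_D[OF this, of "e/2"] e obtain N where "\<bar>measure \<mu> (\<Union>i<N. A i) - measure \<mu> (\<Union>i. A i)\<bar> < e / 2"
        by auto
      then have N: "measure \<mu> (\<Union>i. A i) - measure \<mu> (\<Union>i<N. A i) < e / 2" by linarith
      define d where "d = e / (2 * (real N + 1))"
      have d: "d > 0" unfolding d_def using e by simp
      have Nd: "real N * d \<le> e / 2" unfolding d_def using e by (simp add: field_simps)
      have "\<forall>i. \<exists>n0. \<forall>n\<ge>n0. \<exists>B\<in>sets borel. measure \<mu> (sym_diff ((T ^^ n) -` A i) (p -` B)) < d"
        using union(3) d by blast
      then obtain n0 where n0: "\<And>i n. n \<ge> n0 i \<Longrightarrow> \<exists>B\<in>sets borel. measure \<mu> (sym_diff ((T ^^ n) -` A i) (p -` B)) < d"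
        by metis
      show "\<exists>n0. \<forall>n\<ge>n0. \<exists>B\<in>sets borel. measure \<mu> (sym_diff ((T ^^ n) -` (\<Union>i. A i)) (p -` B)) < e"
      proof (intro exI[of _ "\<Sum>i<N. n0 i"] allI impI)
        fix n assume n: "n \<ge> (\<Sum>i<N. n0 i)"
        have "\<forall>i\<in>{..<N}. \<exists>B. B \<in> sets borel \<and> measure \<mu> (sym_diff ((T ^^ n) -` A i) (p -` B)) < d"
        proof
          fix i assume "i \<in> {..<N}"
          then have "n0 i \<le> (\<Sum>i<N. n0 i)" by (intro member_le_sum) auto
          then show "\<exists>B. B \<in> sets borel \<and> measure \<mu> (sym_diff ((T ^^ n) -` A i) (p -` B)) < d"
            using n0[of i n] n by auto
        qed
        then obtain B where B: "\<And>i. i < N \<Longrightarrow> B i \<in> sets borel"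
          "\<And>i. i < N \<Longrightarrow> measure \<mu> (sym_diff ((T ^^ n) -` A i) (p -` B i)) < d"
          by (metis lessThan_iff)
        let ?R = "(T ^^ n) -` (\<Union>i. A i) - (T ^^ n) -` (\<Union>i<N. A i)"
        let ?Q = "\<Union>i<N. sym_diff ((T ^^ n) -` A i) (p -` B i)"
        have U: "(\<Union>i. A i) \<in> sets borel" "(\<Union>i<N. A i) \<in> sets borel" using Ab by auto
        have Rs: "?R \<in> sets \<mu>" using vT[OF U(1)] vT[OF U(2)] by auto
        have Qi: "sym_diff ((T ^^ n) -` A i) (p -` B i) \<in> sets \<mu>" if "i < N" for i
          using vT[OF Ab] vp[OF B(1)[OF that]] by auto
        then have Qs: "?Q \<in> sets \<mu>" by auto
        have "sym_diff ((T ^^ n) -` (\<Union>i. A i)) (p -` (\<Union>i<N. B i)) \<subseteq> ?R \<union> ?Q" by blast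
        then have "measure \<mu> (sym_diff ((T ^^ n) -` (\<Union>i. A i)) (p -` (\<Union>i<N. B i))) \<le> measure \<mu> (?R \<union> ?Q)"
          using Rs Qs by (intro finite_measure_mono) auto
        also have "\<dots> \<le> measure \<mu> ?R + measure \<mu> ?Q" by (rule measure_Un_le[OF Rs Qs])
        also have "measure \<mu> ?R = measure \<mu> ((T ^^ n) -` (\<Union>i. A i)) - measure \<mu> ((T ^^ n) -` (\<Union>i<N. A i))"
          using vT[OF U(1)] vT[OF U(2)] by (intro finite_measure_Diff) auto
        also have "\<dots> = measure \<mu> (\<Union>i. A i) - measure \<mu> (\<Union>i<N. A i)"
          unfolding mT[OF U(1)] mT[OF U(2)] ..
        also have "measure \<mu> ?Q \<le> (\<Sum>i<N. measure \<mu> (sym_diff ((T ^^ n) -` A i) (p -` B i)))"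
          using Qi by (intro measure_UNION_le) auto
        also have "\<dots> \<le> (\<Sum>i<N. d)" using B(2) by (intro sum_mono less_imp_le) auto
        also have "\<dots> \<le> e / 2" using Nd by simp
        finally have "measure \<mu> (sym_diff ((T ^^ n) -` (\<Union>i. A i)) (p -` (\<Union>i<N. B i))) < e"
          using N by linarith
        moreover have "(\<Union>i<N. B i) \<in> sets borel" using B(1) by auto
        ultimately show "\<exists>B\<in>sets borel. measure \<mu> (sym_diff ((T ^^ n) -` (\<Union>i. A i)) (p -` B)) < e"
          by blast
      qed
    qed
  qed
  then show ?thesis using e by blast
qed

lemma function_entropy_rate_project:
  assumes \<mu>: "invariant_prob T \<mu>" and F: "simple_function (distr \<mu> borel p) F"
  shows "function_entropy_rate S (distr \<mu> borel p) F = function_entropy_rate T \<mu> (\<lambda>x. F (p x))"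
proof -
  interpret measure_preserving \<mu> T using invariant_measure_preserving[OF \<mu>] by simp
  interpret S: measure_preserving "distr \<mu> borel p" S
    using invariant_measure_preserving_S[OF project_invariant[OF \<mu>]] by simp
  have p': "p \<in> measurable \<mu> borel"
    using p_meas measurable_cong_sets[OF invariant_measure_preserving(2)[OF \<mu>] refl] by blast
  have "shannon (distr \<mu> borel p) (itinerary S F n) = shannon \<mu> (itinerary T (\<lambda>x. F (p x)) n)" for n
    by (subst shannon_distr[OF p' S.simple_itinerary[OF F]]) (simp add: itinerary_def[abs_def] p_pow)
  then show ?thesis by (simp add: function_entropy_rate_def)
qed

text \<open>Partitions of the base pull back to partitions of the extension with the same entropy rate, which
gives one inequality. For the other one, the cell of T^n x is, for large n, equal with high
probability to a function b of p x. By invariance T^n does not change the entropy rate, and replacing the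
cell of T^n x by b (p x) costs at most a small conditional entropy.\<close>

theorem KS_entropy_project:
  assumes \<mu>: "invariant_prob T \<mu>"
  shows "KS_entropy T \<mu> = KS_entropy S (distr \<mu> borel p)"
proof -
  let ?\<nu> = "distr \<mu> borel p"
  interpret measure_preserving \<mu> T using invariant_measure_preserving[OF \<mu>] by simp
  interpret S: measure_preserving ?\<nu> S
    using invariant_measure_preserving_S[OF project_invariant[OF \<mu>]] by simp
  note s = invariant_measure_preserving(2)[OF \<mu>]
  note sp = invariant_measure_preserving(3)[OF \<mu>]
  have p': "p \<in> measurable \<mu> borel"
    using p_meas measurable_cong_sets[OF s refl] by blast
  have pull: "simple_function \<mu> (\<lambda>x. F (p x))" if "simple_function ?\<nu> F" for F :: "'y \<Rightarrow> 'z"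
    using simple_function_comp[of p \<mu> ?\<nu> F] p' that by (simp add: comp_def)
  show ?thesis
  proof (rule antisym)
    show "KS_entropy S ?\<nu> \<le> KS_entropy T \<mu>"
    proof (rule S.KS_entropy_least)
      fix P assume "P \<in> finite_measurable_partitions ?\<nu>"
      then have "simple_function ?\<nu> (cell P)" by (rule simple_function_cell)
      then show "ereal (function_entropy_rate S ?\<nu> (cell P)) \<le> KS_entropy T \<mu>"
        using KS_entropy_upper[OF pull] by (simp add: function_entropy_rate_project[OF \<mu>])
    qed
    show "KS_entropy T \<mu> \<le> KS_entropy S ?\<nu>"
    proof (rule KS_entropy_least)
      fix P assume P: "P \<in> finite_measurable_partitions \<mu>"
      then have P': "finite P" "P \<subseteq> sets \<mu>" "partition_on UNIV P"
        using sp by (auto simp: finite_measurable_partitions_def)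
      have X: "simple_function \<mu> (cell P)" by (rule simple_function_cell[OF P])
      have main: "ereal (function_entropy_rate T \<mu> (cell P)) \<le> KS_entropy S ?\<nu> + ereal e" if e: "e > 0" for e
      proof -
        obtain d where d: "d > 0" "\<And>(M :: 'x measure) X Y. \<lbrakk>prob_space M; simple_function M X; simple_function M Y;
          X ` space M \<subseteq> P; Y ` space M \<subseteq> P; measure M {x \<in> space M. X x \<noteq> Y x} < d\<rbrakk> \<Longrightarrow>
           shannon M (\<lambda>x. (X x, Y x)) - shannon M Y \<le> e"
          by (rule conditional_shannon_small[OF P'(1) e, where 'a='x]) (rule that, assumption+)
        define d' where "d' = d / (real (card P) + 1)"
        have d': "d' > 0" unfolding d'_def using d by simp
        have "\<forall>A\<in>P. \<exists>n0. \<forall>n\<ge>n0. \<exists>B\<in>sets borel. measure \<mu> (sym_diff ((T ^^ n) -` A) (p -` B)) < d'"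
          using pullback_approximation[OF \<mu> _ d'] P'(2) s by auto
        then obtain n0 where n0: "\<And>A n. A \<in> P \<Longrightarrow> n \<ge> n0 A \<Longrightarrow> \<exists>B\<in>sets borel. measure \<mu> (sym_diff ((T ^^ n) -` A) (p -` B)) < d'"
          by metis
        define n where "n = (\<Sum>A\<in>P. n0 A)"
        have "\<forall>A\<in>P. \<exists>B. B \<in> sets borel \<and> measure \<mu> (sym_diff ((T ^^ n) -` A) (p -` B)) < d'"
        proof
          fix A assume A: "A \<in> P"
          then have "n0 A \<le> n" unfolding n_def by (intro member_le_sum) (use P' in auto)
          then show "\<exists>B. B \<in> sets borel \<and> measure \<mu> (sym_diff ((T ^^ n) -` A) (p -` B)) < d'"
            using n0[OF A] by auto
        qed
        then obtain B where B: "\<And>A. A \<in> P \<Longrightarrow> B A \<in> sets borel"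
          "\<And>A. A \<in> P \<Longrightarrow> measure \<mu> (sym_diff ((T ^^ n) -` A) (p -` B A)) < d'"
          by metis
        obtain l where l: "set l = P" using finite_list[OF P'(1)] by auto
        define A0 where "A0 = cell P undefined"
        have A0: "A0 \<in> P" unfolding A0_def by (rule cell_in[OF P'(3)]) simp
        \<comment> \<open>The first cell in the list l whose approximating set contains y, and A0 if there is none.\<close>
        define b where "b l y = foldr (\<lambda>A r. if y \<in> B A then A else r) l A0" for l y
        have bP: "b l y \<in> P" if "set l \<subseteq> P" for l y
          using that A0 by (induction l) (auto simp: b_def)
        have bs: "simple_function ?\<nu> (b l)" if "set l \<subseteq> P" for l
          using that
        proof (induction l)
          case Nil
          then show ?case by (simp add: b_def[abs_def])
        next
          case (Cons A l)
          have "b (A # l) = (\<lambda>y. if y \<in> B A then A else b l y)" by (rule ext) (simp add: b_def)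
          then show ?case using Cons B(1) by (auto intro!: simple_function_If_set)
        qed
        have bval: "b l y = A" if "A \<in> set l" "y \<in> B A" "\<And>A'. A' \<in> set l \<Longrightarrow> y \<in> B A' \<Longrightarrow> A' = A" for l y A
          using that
        proof (induction l)
          case (Cons A' l)
          show ?case
          proof (cases "y \<in> B A'")
            case True
            then have "A' = A" by (intro Cons.prems(3)) auto
            then show ?thesis using True by (simp add: b_def)
          next
            case False
            have "A \<noteq> A'" using False Cons.prems(2) by blast
            then have "A \<in> set l" using Cons.prems(1) by simp
            then have "b l y = A"
            proof (rule Cons.IH)
              show "y \<in> B A" by (rule Cons.prems(2))
              show "A'' = A" if "A'' \<in> set l" "y \<in> B A''" for A''
                by (rule Cons.prems(3)) (simp_all add: that)
            qed
            then show ?thesis using False by (simp add: b_def)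
          qed
        qed simp
        define Y where "Y x = b l (p x)" for x
        have Ys: "simple_function \<mu> Y" unfolding Y_def using pull[OF bs] l by simp
        have Xn: "simple_function \<mu> (\<lambda>x. cell P ((T ^^ n) x))" by (rule simple_comp[OF X])
        have vT: "(T ^^ n) -` A \<in> sets \<mu>" if "A \<in> P" for A
        proof -
          have "A \<in> sets \<mu>" using that P'(2) by blast
          from measurable_sets[OF T_pow this] show ?thesis by (simp add: sp)
        qed
        have vp: "p -` B A \<in> sets \<mu>" if "A \<in> P" for A
          using measurable_sets[OF p' B(1)[OF that]] by (simp add: sp)
        have Ds: "sym_diff ((T ^^ n) -` A) (p -` B A) \<in> sets \<mu>" if "A \<in> P" for A
          using vT[OF that] vp[OF that] by auto
        have "{x \<in> space \<mu>. cell P ((T ^^ n) x) \<noteq> Y x} \<subseteq> (\<Union>A\<in>P. sym_diff ((T ^^ n) -` A) (p -` B A))"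
        proof
          fix x assume x: "x \<in> {x \<in> space \<mu>. cell P ((T ^^ n) x) \<noteq> Y x}"
          show "x \<in> (\<Union>A\<in>P. sym_diff ((T ^^ n) -` A) (p -` B A))"
          proof (rule ccontr)
            assume "x \<notin> (\<Union>A\<in>P. sym_diff ((T ^^ n) -` A) (p -` B A))"
            then have *: "(T ^^ n) x \<in> A \<longleftrightarrow> p x \<in> B A" if "A \<in> P" for A using that by auto
            have "Y x = cell P ((T ^^ n) x)"
              unfolding Y_def
            proof (rule bval)
              show "cell P ((T ^^ n) x) \<in> set l" unfolding l by (rule cell_in[OF P'(3)]) simp
              then show "p x \<in> B (cell P ((T ^^ n) x))"
                using cell_in(2)[OF P'(3), of "(T ^^ n) x"] * l by simp
              show "A' = cell P ((T ^^ n) x)" if "A' \<in> set l" "p x \<in> B A'" for A'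
                using that l * cell_eq[OF P'(3), of A' "(T ^^ n) x"] by simp
            qed
            then show False using x by simp
          qed
        qed
        then have "measure \<mu> {x \<in> space \<mu>. cell P ((T ^^ n) x) \<noteq> Y x} \<le> measure \<mu> (\<Union>A\<in>P. sym_diff ((T ^^ n) -` A) (p -` B A))"
          using Ds P' by (intro finite_measure_mono) auto
        also have "\<dots> \<le> (\<Sum>A\<in>P. measure \<mu> (sym_diff ((T ^^ n) -` A) (p -` B A)))"
          using Ds P' by (intro measure_UNION_le) auto
        also have "\<dots> \<le> (\<Sum>A\<in>P. d')" using B(2) by (intro sum_mono less_imp_le) auto
        also have "\<dots> = real (card P) * d'" by simp
        also have "\<dots> < (real (card P) + 1) * d'" using d' by (simp add: algebra_simps)
        also have "\<dots> = d" unfolding d'_def by (simp add: add_nonneg_eq_0_iff)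
        finally have "shannon \<mu> (\<lambda>x. (cell P ((T ^^ n) x), Y x)) - shannon \<mu> Y \<le> e"
          using cell_in(1)[OF P'(3)] bP[of l] l
          by (intro d(2) prob_space_axioms Xn Ys) (auto simp: Y_def)
        then have "function_entropy_rate T \<mu> (\<lambda>x. cell P ((T ^^ n) x)) \<le> function_entropy_rate T \<mu> Y + e"
          using function_entropy_rate_le[OF Xn Ys] by linarith
        then have "function_entropy_rate T \<mu> (cell P) \<le> function_entropy_rate S ?\<nu> (b l) + e"
          unfolding function_entropy_rate_pow[OF X] Y_def
          using function_entropy_rate_project[OF \<mu> bs[of l]] l by simp
        then have "ereal (function_entropy_rate T \<mu> (cell P)) \<le> ereal (function_entropy_rate S ?\<nu> (b l)) + ereal e"
          by simp
        also have "\<dots> \<le> KS_entropy S ?\<nu> + ereal e"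
          by (intro add_right_mono S.KS_entropy_upper bs) (simp add: l)
        finally show ?thesis .
      qed
      show "ereal (function_entropy_rate T \<mu> (cell P)) \<le> KS_entropy S ?\<nu>"
        by (rule ereal_le_epsilon2) (intro allI impI main)
    qed
  qed
qed

end

section \<open>Lifting invariant measures\<close>

context shrinking_extension
begin

text \<open>By uniform continuity, f oscillates little on the image of a fiber under T^n.\<close>

lemma continuous_orbit_section:
  fixes f :: "'x \<Rightarrow> real"
  assumes f: "continuous_on UNIV f"
  shows "(\<lambda>n. f ((T ^^ n) (\<sigma> (p x))) - f ((T ^^ n) x)) \<longlonglongrightarrow> 0"
proof (rule LIMSEQ_I)
  fix e :: real assume e: "e > 0"
  have "uniformly_continuous_on UNIV f" by (rule compact_uniformly_continuous[OF f compact_X])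
  then obtain d where d: "d > 0" "\<And>x x'. dist x' x < d \<Longrightarrow> dist (f x') (f x) < e"
    using e unfolding uniformly_continuous_on_def by (metis UNIV_I)
  have "eventually (\<lambda>n. a n < d) sequentially" by (rule order_tendstoD(2)[OF shrink_0 d(1)])
  then obtain n0 where n0: "\<And>n. n \<ge> n0 \<Longrightarrow> a n < d" by (auto simp: eventually_sequentially)
  show "\<exists>n0. \<forall>n\<ge>n0. norm (f ((T ^^ n) (\<sigma> (p x))) - f ((T ^^ n) x) - 0) < e"
  proof (intro exI allI impI)
    fix n assume "n \<ge> n0"
    then have "dist (f ((T ^^ n) (\<sigma> (p x)))) (f ((T ^^ n) x)) < e"
      by (intro d(2) le_less_trans[OF near_section n0])
    then show "norm (f ((T ^^ n) (\<sigma> (p x))) - f ((T ^^ n) x) - 0) < e" by (simp add: dist_real_def)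
  qed
qed

lemma continuous_bounded:
  fixes f :: "'x \<Rightarrow> real"
  assumes "continuous_on UNIV f"
  obtains C where "\<And>x. \<bar>f x\<bar> \<le> C" "C \<ge> 0"
proof -
  have "bounded (range f)" using compact_continuous_image[OF assms compact_X] compact_imp_bounded by auto
  then obtain C where "\<And>x. \<bar>f x\<bar> \<le> C" unfolding bounded_iff by auto
  moreover from this[of undefined] have "C \<ge> 0" by linarith
  ultimately show thesis by (rule that)
qed

text \<open>The left-hand side involves the projected measure only. This yields the uniqueness of lifts, and
it identifies integrals for potentials that are obtained as limits of f o T^n o \<sigma>.\<close>

lemma integral_via_section:
  fixes f :: "'x \<Rightarrow> real"
  assumes \<mu>: "invariant_prob T \<mu>" and f: "continuous_on UNIV f"
  shows "(\<lambda>n. \<integral>y. f ((T ^^ n) (\<sigma> y)) \<partial>distr \<mu> borel p) \<longlonglongrightarrow> (\<integral>x. f x \<partial>\<mu>)"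
proof -
  interpret measure_preserving \<mu> T using invariant_measure_preserving[OF \<mu>] by simp
  note s[measurable_cong] = invariant_measure_preserving(2)[OF \<mu>]
  have fm[measurable]: "f \<in> borel_measurable borel" by (rule borel_measurable_continuous_onI[OF f])
  obtain C where C: "\<And>x. \<bar>f x\<bar> \<le> C" "C \<ge> 0" using continuous_bounded[OF f] by blast
  have int: "integrable \<mu> (\<lambda>x. f (g x))" if "g \<in> measurable borel borel" for g
  proof (rule integrable_const_bound[where B=C])
    show "(\<lambda>x. f (g x)) \<in> borel_measurable \<mu>" using that by measurable
  qed (simp add: C)
  have "(\<lambda>n. \<integral>x. f ((T ^^ n) (\<sigma> (p x))) - f ((T ^^ n) x) \<partial>\<mu>) \<longlonglongrightarrow> (\<integral>x. 0 \<partial>\<mu>)"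
  proof (rule integral_dominated_convergence[where w="\<lambda>_. C + C"])
    show "AE x in \<mu>. (\<lambda>n. f ((T ^^ n) (\<sigma> (p x))) - f ((T ^^ n) x)) \<longlonglongrightarrow> 0"
      by (intro AE_I2 continuous_orbit_section f)
    show "AE x in \<mu>. norm (f ((T ^^ n) (\<sigma> (p x))) - f ((T ^^ n) x)) \<le> C + C" for n
    proof (rule AE_I2)
      fix x
      show "norm (f ((T ^^ n) (\<sigma> (p x))) - f ((T ^^ n) x)) \<le> C + C"
        using C(1)[of "(T ^^ n) (\<sigma> (p x))"] C(1)[of "(T ^^ n) x"] unfolding real_norm_def by linarith
    qed
  qed auto
  moreover have "(\<integral>x. f ((T ^^ n) (\<sigma> (p x))) - f ((T ^^ n) x) \<partial>\<mu>) =
      (\<integral>y. f ((T ^^ n) (\<sigma> y)) \<partial>distr \<mu> borel p) - (\<integral>x. f x \<partial>\<mu>)" for n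
  proof -
    have "(\<integral>x. f ((T ^^ n) (\<sigma> (p x))) - f ((T ^^ n) x) \<partial>\<mu>) =
        (\<integral>x. f ((T ^^ n) (\<sigma> (p x))) \<partial>\<mu>) - (\<integral>x. f ((T ^^ n) x) \<partial>\<mu>)"
      by (rule Bochner_Integration.integral_diff) (intro int; measurable)+
    moreover have "(\<integral>x. f ((T ^^ n) x) \<partial>\<mu>) = (\<integral>x. f x \<partial>\<mu>)"
    proof -
      have "(\<integral>x. f x \<partial>distr \<mu> \<mu> (T ^^ n)) = (\<integral>x. f ((T ^^ n) x) \<partial>\<mu>)"
        by (rule integral_distr[OF T_pow]) measurable
      then show ?thesis by (simp add: inv_pow)
    qed
    moreover have "(\<integral>y. f ((T ^^ n) (\<sigma> y)) \<partial>distr \<mu> borel p) = (\<integral>x. f ((T ^^ n) (\<sigma> (p x))) \<partial>\<mu>)"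
      by (rule integral_distr) measurable
    ultimately show ?thesis by simp
  qed
  ultimately show ?thesis by (simp add: LIM_zero_iff)
qed

lemma invariant_lift_unique:
  assumes \<mu>: "invariant_prob T \<mu>" and \<mu>': "invariant_prob T \<mu>'" and eq: "distr \<mu> borel p = distr \<mu>' borel p"
  shows "\<mu> = \<mu>'"
proof (rule borel_measure_eqI_continuous)
  show "prob_space \<mu>" "prob_space \<mu>'" "sets \<mu> = sets borel" "sets \<mu>' = sets borel"
    using \<mu> \<mu>' by (auto simp: invariant_prob_def)
  fix f :: "'x \<Rightarrow> real" assume f: "continuous_on UNIV f"
  show "(\<integral>x. f x \<partial>\<mu>) = (\<integral>x. f x \<partial>\<mu>')"
    using integral_via_section[OF \<mu> f] integral_via_section[OF \<mu>' f] unfolding eq by (rule LIMSEQ_unique)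
qed

text \<open>The natural extension of S, built as a Markov chain: \<Phi> samples a preimage of y under S from the law
of a point given its image. Sampling consumes one seed; the map G, which replaces y by the sampled
preimage and shifts the seeds, preserves the product measure, and therefore all y k have law \<nu>.\<close>

lemma backward_orbits:
  assumes \<nu>: "invariant_prob S \<nu>"
  obtains \<Omega> :: "('y \<times> (nat \<Rightarrow> real)) measure" and y where "prob_space \<Omega>" 
    "\<And>k. y k \<in> measurable \<Omega> borel" "\<And>k. distr \<Omega> borel (y k) = \<nu>"
    "AE w in \<Omega>. \<forall>k. S (y (Suc k) w) = y k w"
    "Measurable.pred \<Omega> (\<lambda>w. \<forall>k. S (y (Suc k) w) = y k w)"
proof -
  interpret N: measure_preserving \<nu> S using invariant_measure_preserving_S[OF \<nu>] by simp
  note s[measurable_cong] = invariant_measure_preserving_S(2)[OF \<nu>]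
  have inv: "distr \<nu> borel S = \<nu>" using \<nu> by (simp add: invariant_prob_def)
  have coded: "real_coded (borel :: 'y measure)" by (rule real_coded_compact_metric[OF compact_Y])
  obtain c :: "'y \<Rightarrow> real" and d where c[measurable]: "c \<in> borel_measurable borel" and dc: "\<forall>x\<in>space borel. d (c x) = x"
    using coded unfolding real_coded_def by auto
  have c_inj: "u = v \<longleftrightarrow> c u = c v" for u v using dc by (metis UNIV_I space_borel)
  have eq_pred: "Measurable.pred K (\<lambda>w. f w = g w)" if "f \<in> measurable K borel" "g \<in> measurable K borel" 
    for K :: "'k measure" and f g :: "'k \<Rightarrow> 'y"
    unfolding c_inj[of "f _"] using that by measurable
  define Q where "Q = distr \<nu> (borel \<Otimes>\<^sub>M borel) (\<lambda>y. (y, S y))"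
  have Q: "prob_space Q" unfolding Q_def by (rule N.prob_space_distr) measurable
  have Qs: "sets Q = sets (borel \<Otimes>\<^sub>M borel)" by (simp add: Q_def)
  have Qsnd: "distr Q borel snd = \<nu>"
    unfolding Q_def by (subst distr_distr) (auto simp: comp_def inv)
  obtain \<Phi> where \<Phi>[measurable]: "\<Phi> \<in> measurable (borel \<Otimes>\<^sub>M unit_seed) borel"
    and law: "distr (\<nu> \<Otimes>\<^sub>M unit_seed) (borel \<Otimes>\<^sub>M borel) (\<lambda>z. (\<Phi> z, fst z)) = Q"
    using conditional_sampling[OF coded Q Qs] unfolding Qsnd by metis
  interpret U: prob_space unit_seed by (rule prob_space_unit_seed)
  interpret NU: pair_prob_space \<nu> unit_seed ..
  have \<Phi>law: "distr (\<nu> \<Otimes>\<^sub>M unit_seed) borel \<Phi> = \<nu>"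
  proof -
    have "distr (\<nu> \<Otimes>\<^sub>M unit_seed) borel \<Phi> = distr (distr (\<nu> \<Otimes>\<^sub>M unit_seed) (borel \<Otimes>\<^sub>M borel) (\<lambda>z. (\<Phi> z, fst z))) borel fst"
      by (subst distr_distr) (auto simp: comp_def)
    also have "\<dots> = distr \<nu> borel (\<lambda>y. y)" unfolding law Q_def by (subst distr_distr) (auto simp: comp_def)
    also have "\<dots> = \<nu>" by (rule distr_id2) (simp add: s)
    finally show ?thesis .
  qed
  have \<Phi>S: "AE z in \<nu> \<Otimes>\<^sub>M unit_seed. S (\<Phi> z) = fst z"
  proof -
    have "Measurable.pred (borel \<Otimes>\<^sub>M borel) (\<lambda>z. S (fst z) = snd z)" by (rule eq_pred) measurable
    then have m: "{z \<in> space (borel \<Otimes>\<^sub>M borel). S (fst z) = snd z} \<in> sets (borel \<Otimes>\<^sub>M borel)" by (rule predE)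
    have "AE z in Q. S (fst z) = snd z"
      unfolding Q_def using m by (subst AE_distr_iff) auto
    then show ?thesis unfolding law[symmetric] using m by (subst (asm) AE_distr_iff) auto
  qed
  interpret SS: product_prob_space "\<lambda>_. unit_seed" "UNIV :: nat set" ..
  interpret SQ: sequence_space unit_seed ..
  let ?S = "PiM (UNIV :: nat set) (\<lambda>_. unit_seed)"
  have Ppr: "prob_space ?S" by (rule SS.prob_space_axioms)
  have Psf: "sigma_finite_measure ?S" by (rule prob_space_imp_sigma_finite[OF Ppr])
  define \<Omega> where "\<Omega> = \<nu> \<Otimes>\<^sub>M ?S"
  interpret O: pair_prob_space \<nu> ?S ..
  interpret OO: prob_space \<Omega> unfolding \<Omega>_def by (rule O.prob_space_axioms)
  have \<Omega>s[measurable_cong]: "sets \<Omega> = sets (borel \<Otimes>\<^sub>M ?S)"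
    unfolding \<Omega>_def by (intro sets_pair_measure_cong s refl)
  define G where "G w = (\<Phi> (fst w, snd w 0), \<lambda>n. snd w (Suc n))" for w :: "'y \<times> (nat \<Rightarrow> real)"
  have Gm[measurable]: "G \<in> measurable \<Omega> \<Omega>"

  proof -
    have [measurable]: "(\<lambda>\<xi> n. \<xi> (Suc n)) \<in> measurable ?S ?S"
      by (rule measurable_PiM_single') (auto simp: space_PiM)
    have "G \<in> measurable (borel \<Otimes>\<^sub>M ?S) (borel \<Otimes>\<^sub>M ?S)"
      unfolding G_def by measurable
    then show ?thesis unfolding measurable_cong_sets[OF \<Omega>s \<Omega>s] .
  qed
  have step: "emeasure ?S {\<xi> \<in> space ?S. \<Phi> (y, \<xi> 0) \<in> A \<and> (\<lambda>n. \<xi> (Suc n)) \<in> B}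
      = emeasure unit_seed {s. \<Phi> (y, s) \<in> A} * emeasure ?S B"
    if A[measurable]: "A \<in> sets borel" and B[measurable]: "B \<in> sets ?S" for y A B
  proof -
    let ?E = "{\<xi> \<in> space ?S. \<Phi> (y, \<xi> 0) \<in> A \<and> (\<lambda>n. \<xi> (Suc n)) \<in> B}"
    have shift[measurable]: "(\<lambda>\<xi> n. \<xi> (Suc n)) \<in> measurable ?S ?S"
      by (rule measurable_PiM_single') (auto simp: space_PiM)
    have E: "?E \<in> sets ?S" by measurable
    have "emeasure ?S ?E = emeasure (distr (unit_seed \<Otimes>\<^sub>M ?S) ?S (\<lambda>(s, \<omega>). case_nat s \<omega>)) ?E"
      by (simp only: SQ.PiM_iter)
    also have "\<dots> = emeasure (unit_seed \<Otimes>\<^sub>M ?S) ((\<lambda>(s, \<omega>). case_nat s \<omega>) -` ?E \<inter> space (unit_seed \<Otimes>\<^sub>M ?S))"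
      by (rule emeasure_distr[OF _ E]) measurable
    also have "(\<lambda>(s, \<omega>). case_nat s \<omega>) -` ?E \<inter> space (unit_seed \<Otimes>\<^sub>M ?S) = {s. \<Phi> (y, s) \<in> A} \<times> B"
      using sets.sets_into_space[OF B] by (auto simp: space_pair_measure space_PiM split: nat.split)
    also have "emeasure (unit_seed \<Otimes>\<^sub>M ?S) \<dots> = emeasure unit_seed {s. \<Phi> (y, s) \<in> A} * emeasure ?S B"
    proof (rule sigma_finite_measure.emeasure_pair_measure_Times[OF Psf _ B])
      have "(\<lambda>s. \<Phi> (y, s)) \<in> measurable unit_seed borel"
        by (rule measurable_compose[OF measurable_Pair1' \<Phi>]) simp
      then have "(\<lambda>s. \<Phi> (y, s)) -` A \<inter> space unit_seed \<in> sets unit_seed"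
        by (rule measurable_sets[OF _ A])
      moreover have "(\<lambda>s. \<Phi> (y, s)) -` A \<inter> space unit_seed = {s. \<Phi> (y, s) \<in> A}" by auto
      ultimately show "{s. \<Phi> (y, s) \<in> A} \<in> sets unit_seed" by (simp only:)
    qed
    finally show ?thesis .
  qed
  have "\<nu> \<Otimes>\<^sub>M ?S = distr \<Omega> \<Omega> G"
  proof (rule pair_measure_eqI)
    show "sigma_finite_measure \<nu>" by (rule N.sigma_finite_measure_axioms)
    show "sigma_finite_measure ?S" by (rule Psf)
    show "sets (\<nu> \<Otimes>\<^sub>M ?S) = sets (distr \<Omega> \<Omega> G)" by (simp add: \<Omega>_def)
    fix A B assume A: "A \<in> sets \<nu>" and B: "B \<in> sets ?S"
    have Ab[measurable]: "A \<in> sets borel" using A s by simp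
    have AB: "A \<times> B \<in> sets \<Omega>" unfolding \<Omega>_def using A B by simp
    have sp: "space \<nu> = UNIV" by (rule invariant_measure_preserving_S(3)[OF \<nu>])
    have "emeasure (distr \<Omega> \<Omega> G) (A \<times> B) = emeasure \<Omega> (G -` (A \<times> B) \<inter> space \<Omega>)"
      by (rule emeasure_distr[OF Gm AB])
    also have "\<dots> = (\<integral>\<^sup>+y. emeasure ?S (Pair y -` (G -` (A \<times> B) \<inter> space \<Omega>)) \<partial>\<nu>)"
      using measurable_sets[OF Gm AB] unfolding \<Omega>_def by (rule sigma_finite_measure.emeasure_pair_measure_alt[OF Psf])
    also have "\<dots> = (\<integral>\<^sup>+y. emeasure unit_seed {s. \<Phi> (y, s) \<in> A} * emeasure ?S B \<partial>\<nu>)"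
    proof (rule nn_integral_cong)
      fix y
      have "Pair y -` (G -` (A \<times> B) \<inter> space \<Omega>) = {\<xi> \<in> space ?S. \<Phi> (y, \<xi> 0) \<in> A \<and> (\<lambda>n. \<xi> (Suc n)) \<in> B}"
        by (auto simp: G_def \<Omega>_def space_pair_measure sp)
      then show "emeasure ?S (Pair y -` (G -` (A \<times> B) \<inter> space \<Omega>)) = emeasure unit_seed {s. \<Phi> (y, s) \<in> A} * emeasure ?S B"
        using step[OF Ab B] by simp
    qed
    also have "\<dots> = (\<integral>\<^sup>+y. emeasure unit_seed (Pair y -` (\<Phi> -` A \<inter> space (\<nu> \<Otimes>\<^sub>M unit_seed))) * emeasure ?S B \<partial>\<nu>)"
      by (intro nn_integral_cong arg_cong2[where f="(*)"] arg_cong[where f="emeasure unit_seed"])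
         (auto simp: space_pair_measure sp)
    also have "\<dots> = (\<integral>\<^sup>+y. emeasure unit_seed (Pair y -` (\<Phi> -` A \<inter> space (\<nu> \<Otimes>\<^sub>M unit_seed))) \<partial>\<nu>) * emeasure ?S B"
      by (intro nn_integral_multc U.measurable_emeasure_Pair) measurable
    also have "(\<integral>\<^sup>+y. emeasure unit_seed (Pair y -` (\<Phi> -` A \<inter> space (\<nu> \<Otimes>\<^sub>M unit_seed))) \<partial>\<nu>)
        = emeasure (\<nu> \<Otimes>\<^sub>M unit_seed) (\<Phi> -` A \<inter> space (\<nu> \<Otimes>\<^sub>M unit_seed))"
      by (rule U.emeasure_pair_measure_alt[symmetric]) measurable
    also have "\<dots> = emeasure (distr (\<nu> \<Otimes>\<^sub>M unit_seed) borel \<Phi>) A"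
      by (rule emeasure_distr[symmetric]) measurable
    finally show "emeasure \<nu> A * emeasure ?S B = emeasure (distr \<Omega> \<Omega> G) (A \<times> B)"
      by (simp add: \<Phi>law)
  qed
  then have Ginv: "distr \<Omega> \<Omega> G = \<Omega>" by (simp add: \<Omega>_def)
  interpret G: measure_preserving \<Omega> G 
  proof
    show "G \<in> measurable \<Omega> \<Omega>" by (rule Gm)
    show "distr \<Omega> \<Omega> G = \<Omega>" by (rule Ginv)
  qed
  define y where "y k w = fst ((G ^^ k) w)" for k w
  have fst_m: "fst \<in> measurable \<Omega> borel" by measurable
  have ym[measurable]: "y k \<in> measurable \<Omega> borel" for k
    unfolding y_def by (rule measurable_compose[OF G.T_pow fst_m])
  have pr: "Measurable.pred \<Omega> (\<lambda>w. S (y (Suc k) w) = y k w)" for k by (rule eq_pred) measurable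
  show thesis
  proof (rule that[OF OO.prob_space_axioms ym])
    show "distr \<Omega> borel (y k) = \<nu>" for k
    proof -
      have "distr \<Omega> borel (y k) = distr (distr \<Omega> \<Omega> (G ^^ k)) borel fst"
        unfolding y_def by (subst distr_distr[OF fst_m G.T_pow]) (simp add: comp_def)
      also have "\<dots> = distr \<Omega> \<nu> fst" unfolding G.inv_pow by (rule distr_cong) (auto simp: s)
      also have "\<dots> = \<nu>" unfolding \<Omega>_def by (rule prob_space.distr_pair_fst[OF Ppr])
      finally show ?thesis .
    qed
    have comp0: "distr ?S unit_seed (\<lambda>\<xi>. \<xi> 0) = unit_seed"
      using SS.PiM_component[of 0] by simp
    have "distr \<Omega> (\<nu> \<Otimes>\<^sub>M unit_seed) (\<lambda>(x, \<xi>). (x, \<xi> 0)) = distr \<nu> \<nu> (\<lambda>x. x) \<Otimes>\<^sub>M distr ?S unit_seed (\<lambda>\<xi>. \<xi> 0)"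
      unfolding \<Omega>_def by (rule pair_measure_distr[symmetric]) (auto simp: comp0 U.sigma_finite_measure_axioms)
    then have law0: "distr \<Omega> (\<nu> \<Otimes>\<^sub>M unit_seed) (\<lambda>(x, \<xi>). (x, \<xi> 0)) = \<nu> \<Otimes>\<^sub>M unit_seed"
      by (simp add: comp0)
    have m0: "(\<lambda>(x, \<xi>). (x, \<xi> 0)) \<in> measurable \<Omega> (\<nu> \<Otimes>\<^sub>M unit_seed)"
      unfolding \<Omega>_def split_beta' by measurable
    have "AE w in \<Omega>. S (\<Phi> (case w of (x, \<xi>) \<Rightarrow> (x, \<xi> 0))) = fst (case w of (x, \<xi>) \<Rightarrow> (x, \<xi> 0))"
      by (rule AE_distrD[OF m0]) (unfold law0, rule \<Phi>S)
    then have "AE w in \<Omega>. S (y 1 w) = y 0 w"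
      unfolding y_def G_def by (simp add: split_beta')
    then have one: "AE w in distr \<Omega> \<Omega> (G ^^ k). S (y 1 w) = y 0 w" for k unfolding G.inv_pow .
    have "AE w in \<Omega>. S (y (Suc k) w) = y k w" for k
    proof -
      have "AE w in \<Omega>. S (y 1 ((G ^^ k) w)) = y 0 ((G ^^ k) w)"
        by (rule AE_distrD[OF G.T_pow one])
      then show ?thesis by (simp add: y_def)
    qed
    then show "AE w in \<Omega>. \<forall>k. S (y (Suc k) w) = y k w" by (simp add: AE_all_countable)
    show "Measurable.pred \<Omega> (\<lambda>w. \<forall>k. S (y (Suc k) w) = y k w)"
      by (intro pred_intros_countable(1) pr)
  qed
qed

text \<open>Along a backward orbit, T^m (\<sigma> (y (k + m))) lies in the fiber over y k, so that
T^(k + m) (\<sigma> (y (k + m))) and T^k (\<sigma> (y k)) are within a k of each other: the sequence is Cauchy.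
Its limit projects to y 0. The integral of f against the law of the limit is the limit of the
integrals of f o T^k o \<sigma> against \<nu>, and passing from f to f o T shifts k by one: hence
the law is invariant.\<close>

lemma invariant_lift_exists:
  assumes \<nu>: "invariant_prob S \<nu>"
  obtains \<mu> where "invariant_prob T \<mu>" "distr \<mu> borel p = \<nu>"
proof -
  obtain \<Omega> :: "('y \<times> (nat \<Rightarrow> real)) measure" and y where \<Omega>: "prob_space \<Omega>"
    and ym[measurable]: "\<And>k. y k \<in> measurable \<Omega> borel" and ylaw: "\<And>k. distr \<Omega> borel (y k) = \<nu>"
    and yAE: "AE w in \<Omega>. \<forall>k. S (y (Suc k) w) = y k w"
    and [measurable]: "Measurable.pred \<Omega> (\<lambda>w. \<forall>k. S (y (Suc k) w) = y k w)"
    by (rule backward_orbits[OF \<nu>]) (rule that, assumption+)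
  interpret prob_space \<Omega> by (rule \<Omega>)
  define good where "good w \<longleftrightarrow> (\<forall>k. S (y (Suc k) w) = y k w)" for w
  have good_pred[measurable]: "Measurable.pred \<Omega> good" unfolding good_def by measurable
  have good_AE: "AE w in \<Omega>. good w" using yAE by (simp add: good_def)
  define z where "z k w = (T ^^ k) (\<sigma> (y k w))" for k w
  have zm[measurable]: "z k \<in> measurable \<Omega> borel" for k unfolding z_def by measurable
  have backward: "(S ^^ m) (y (k + m) w) = y k w" if "good w" for k m w
  proof (induction m)
    case (Suc m)
    have "(S ^^ Suc m) (y (k + Suc m) w) = (S ^^ m) (S (y (Suc (k + m)) w))"
      by (simp add: funpow_swap1)
    then show ?case using Suc that by (simp add: good_def)
  qed simp
  have zdist: "dist (z (k + m) w) (z k w) \<le> a k" if g: "good w" for k m w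
  proof -
    have "z (k + m) w = (T ^^ k) ((T ^^ m) (\<sigma> (y (k + m) w)))" by (simp add: z_def funpow_add)
    then show ?thesis unfolding z_def
      by (simp, intro shrink) (simp add: p_pow sect backward[OF g])
  qed
  have conv: "\<exists>l. (\<lambda>k. z k w) \<longlonglongrightarrow> l" if g: "good w" for w
  proof -
    have "Cauchy (\<lambda>k. z k w)"
    proof (rule metric_CauchyI)
      fix e :: real assume "e > 0"
      then have "eventually (\<lambda>k. a k < e / 2) sequentially" using shrink_0 by (intro order_tendstoD(2)) auto
      then obtain k where k: "a k < e / 2" by (auto simp: eventually_sequentially)
      have "dist (z i w) (z j w) < e" if "i \<ge> k" "j \<ge> k" for i j
      proof -
        have "dist (z i w) (z j w) \<le> dist (z i w) (z k w) + dist (z j w) (z k w)" by (rule dist_triangle2)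
        also have "\<dots> \<le> a k + a k"
          using zdist[OF g, of k "i - k"] zdist[OF g, of k "j - k"] that by (intro add_mono) auto
        finally show ?thesis using k by simp
      qed
      then show "\<exists>M. \<forall>m\<ge>M. \<forall>n\<ge>M. dist (z m w) (z n w) < e" by blast
    qed
    then show ?thesis using compact_imp_complete[OF compact_X] by (metis completeE UNIV_I)
  qed
  define zz where "zz w = (if good w then lim (\<lambda>k. z k w) else undefined)" for w
  have lim: "(\<lambda>k. z k w) \<longlonglongrightarrow> zz w" if "good w" for w
    using conv[OF that] that by (auto simp: zz_def limI)
  have zzm[measurable]: "zz \<in> measurable \<Omega> borel"
  proof (rule borel_measurable_LIMSEQ_metric[where f="\<lambda>k w. if good w then z k w else undefined"])
    fix w show "(\<lambda>k. if good w then z k w else undefined) \<longlonglongrightarrow> zz w"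
      using lim[of w] by (cases "good w") (auto simp: zz_def)
  qed measurable
  define \<mu> where "\<mu> = distr \<Omega> borel zz"
  have \<mu>: "prob_space \<mu>" "sets \<mu> = sets borel" unfolding \<mu>_def by (auto intro!: prob_space_distr)
  have int_lim: "(\<lambda>k. \<integral>y. f ((T ^^ k) (\<sigma> y)) \<partial>\<nu>) \<longlonglongrightarrow> (\<integral>x. f x \<partial>\<mu>)"
    if f: "continuous_on UNIV f" for f :: "'x \<Rightarrow> real"
  proof -
    have [measurable]: "f \<in> borel_measurable borel" by (rule borel_measurable_continuous_onI[OF f])
    obtain C where C: "\<And>x. \<bar>f x\<bar> \<le> C" "C \<ge> 0" using continuous_bounded[OF f] by blast
    have "(\<lambda>k. \<integral>w. f (z k w) \<partial>\<Omega>) \<longlonglongrightarrow> (\<integral>w. f (zz w) \<partial>\<Omega>)"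
    proof (rule integral_dominated_convergence[where w="\<lambda>_. C"])
      show "AE w in \<Omega>. (\<lambda>k. f (z k w)) \<longlonglongrightarrow> f (zz w)"
        using good_AE
      proof eventually_elim
        case (elim w)
        have "isCont f (zz w)" using f by (simp add: continuous_on_eq_continuous_at)
        then show ?case using lim[OF elim] by (rule isCont_tendsto_compose)
      qed
    qed (use C in auto)
    moreover have "(\<integral>w. f (z k w) \<partial>\<Omega>) = (\<integral>y. f ((T ^^ k) (\<sigma> y)) \<partial>\<nu>)" for k
      unfolding ylaw[of k, symmetric] z_def by (rule integral_distr[symmetric]) measurable
    moreover have "(\<integral>w. f (zz w) \<partial>\<Omega>) = (\<integral>x. f x \<partial>\<mu>)"
      unfolding \<mu>_def by (rule integral_distr[symmetric]) measurable
    ultimately show ?thesis by simp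
  qed
  have pz: "p (zz w) = y 0 w" if "good w" for w
  proof -
    have "isCont p (zz w)" using p_cont by (simp add: continuous_on_eq_continuous_at)
    then have "(\<lambda>k. p (z k w)) \<longlonglongrightarrow> p (zz w)" using lim[OF that] by (rule isCont_tendsto_compose)
    moreover have "p (z k w) = y 0 w" for k
      using backward[OF that, of k 0] by (simp add: z_def p_pow sect)
    ultimately show ?thesis by (simp add: LIMSEQ_const_iff)
  qed
  show thesis
  proof (rule that)
    have "distr \<mu> borel p = distr \<Omega> borel (\<lambda>w. p (zz w))"
      unfolding \<mu>_def by (subst distr_distr) (auto simp: comp_def)
    also have "\<dots> = distr \<Omega> borel (y 0)"
    proof (rule distr_cong_AE)
      show "AE w in \<Omega>. p (zz w) = y 0 w" using good_AE by eventually_elim (rule pz)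
    qed auto
    finally show "distr \<mu> borel p = \<nu>" by (simp add: ylaw)
    note [measurable_cong] = \<mu>(2)
    have "distr \<mu> borel T = \<mu>"
    proof (rule borel_measure_eqI_continuous)
      show "prob_space (distr \<mu> borel T)" by (rule prob_space.prob_space_distr[OF \<mu>(1)]) measurable
      fix f :: "'x \<Rightarrow> real" assume f: "continuous_on UNIV f"
      have fT: "continuous_on UNIV (\<lambda>x. f (T x))"
        by (rule continuous_on_compose2[OF f T_cont]) simp
      have [measurable]: "f \<in> borel_measurable borel" by (rule borel_measurable_continuous_onI[OF f])
      have "(\<lambda>k. \<integral>y. f ((T ^^ Suc k) (\<sigma> y)) \<partial>\<nu>) \<longlonglongrightarrow> (\<integral>x. f x \<partial>\<mu>)"
        by (rule LIMSEQ_Suc[OF int_lim[OF f]])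
      moreover have "(\<lambda>k. \<integral>y. f ((T ^^ Suc k) (\<sigma> y)) \<partial>\<nu>) \<longlonglongrightarrow> (\<integral>x. f (T x) \<partial>\<mu>)"
        using int_lim[OF fT] by simp
      ultimately have "(\<integral>x. f (T x) \<partial>\<mu>) = (\<integral>x. f x \<partial>\<mu>)" by (rule LIMSEQ_unique[symmetric])
      then show "(\<integral>x. f x \<partial>distr \<mu> borel T) = (\<integral>x. f x \<partial>\<mu>)"
        by (subst integral_distr) auto
    qed (use \<mu> in auto)
    then show "invariant_prob T \<mu>" using \<mu> by (simp add: invariant_prob_def)
  qed
qed

end

section \<open>Lifting limit theorems\<close>

lemma limsup_eq_of_diff_null:
  fixes u v :: "nat \<Rightarrow> real"
  assumes "(\<lambda>n. u n - v n) \<longlonglongrightarrow> 0"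
  shows "limsup (\<lambda>n. ereal (u n)) = limsup (\<lambda>n. ereal (v n))"
proof -
  have "(\<lambda>n. ereal (u n - v n)) \<longlonglongrightarrow> ereal 0" using assms by simp
  from ereal_limsup_lim_add[OF this, of "\<lambda>n. ereal (v n)"] show ?thesis by simp
qed

text \<open>The case of Slutsky's theorem in which the perturbation is bounded by a deterministic null sequence.\<close>

lemma (in prob_space) cdf_limit_perturbation:
  fixes A B :: "nat \<Rightarrow> 'a \<Rightarrow> real"
  assumes A[measurable]: "\<And>n. A n \<in> borel_measurable M" and B[measurable]: "\<And>n. B n \<in> borel_measurable M"
    and close: "\<And>n x. x \<in> space M \<Longrightarrow> \<bar>A n x - B n x\<bar> \<le> c n" and c: "c \<longlonglongrightarrow> 0"
    and lim: "\<And>r. (\<lambda>n. prob {x \<in> space M. A n x \<le> r}) \<longlonglongrightarrow> G r" and G: "isCont G r"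
  shows "(\<lambda>n. prob {x \<in> space M. B n x \<le> r}) \<longlonglongrightarrow> G r"
proof (rule LIMSEQ_I)
  fix e :: real assume e: "e > 0"
  obtain d where d: "d > 0" "\<And>r'. \<bar>r' - r\<bar> < d \<Longrightarrow> \<bar>G r' - G r\<bar> < e / 2"
    using G e unfolding continuous_at_eps_delta dist_real_def by (metis half_gt_zero)
  have "eventually (\<lambda>n. c n < d / 2) sequentially" using c d by (intro order_tendstoD(2)) auto
  moreover have "eventually (\<lambda>n. \<bar>prob {x \<in> space M. A n x \<le> r'} - G r'\<bar> < e / 2) sequentially" for r'
  proof -
    have "0 < e / 2" using e by simp
    then show ?thesis using lim[of r'] unfolding tendsto_iff dist_real_def by blast
  qed
  note this[of "r - d / 2"] this[of "r + d / 2"]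
  ultimately have "eventually (\<lambda>n. \<bar>prob {x \<in> space M. B n x \<le> r} - G r\<bar> < e) sequentially"
  proof eventually_elim
    case (elim n)
    have "prob {x \<in> space M. B n x \<le> r} \<le> prob {x \<in> space M. A n x \<le> r + d / 2}"
    proof (rule finite_measure_mono)
      show "{x \<in> space M. B n x \<le> r} \<subseteq> {x \<in> space M. A n x \<le> r + d / 2}"
        using close[of _ n] elim(1) by (force simp: abs_le_iff)
    qed measurable
    moreover have "prob {x \<in> space M. A n x \<le> r - d / 2} \<le> prob {x \<in> space M. B n x \<le> r}"
    proof (rule finite_measure_mono)
      show "{x \<in> space M. A n x \<le> r - d / 2} \<subseteq> {x \<in> space M. B n x \<le> r}"
        using close[of _ n] elim(1) by (force simp: abs_le_iff)
    qed measurable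
    moreover have "\<bar>G (r + d / 2) - G r\<bar> < e / 2" "\<bar>G (r - d / 2) - G r\<bar> < e / 2" using d by auto
    ultimately show ?case using elim(2,3) by linarith
  qed
  then show "\<exists>n0. \<forall>n\<ge>n0. norm (prob {x \<in> space M. B n x \<le> r} - G r) < e"
    by (simp add: eventually_sequentially)
qed

lemma isCont_normal_cdf:
  assumes "s > 0"
  shows "isCont (cdf (density lborel (normal_density m s))) r"
proof -
  interpret P: prob_space "density lborel (normal_density m s)" by (rule prob_space_normal_density[OF assms])
  interpret real_distribution "density lborel (normal_density m s)" by unfold_locales auto
  have "emeasure (density lborel (normal_density m s)) {r} = (\<integral>\<^sup>+x. ennreal (normal_density m s x) * indicator {r} x \<partial>lborel)"
    by (rule emeasure_density) auto
  also have "\<dots> = (\<integral>\<^sup>+(x::real). 0 \<partial>lborel)"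
  proof (rule nn_integral_cong_AE)
    show "AE x in lborel. ennreal (normal_density m s x) * indicator {r} x = 0"
      using AE_lborel_singleton[of r] by eventually_elim (auto simp: indicator_def)
  qed
  finally have "measure (density lborel (normal_density m s)) {r} = 0" by (simp add: measure_def)
  then show ?thesis unfolding isCont_cdf .
qed

definition asip_close :: "real \<Rightarrow> (nat \<Rightarrow> real) \<Rightarrow> (nat \<Rightarrow> real) \<Rightarrow> bool" where
  "asip_close l u v \<longleftrightarrow> (\<lambda>n. \<bar>(\<Sum>k=1..n. u k) - (\<Sum>k=1..n. v k)\<bar>) \<in> o(\<lambda>n. real n powr l)"

lemma asip_close_tendsto:
  "asip_close l u v \<longleftrightarrow> (\<lambda>n. \<bar>(\<Sum>k=1..n. u k) - (\<Sum>k=1..n. v k)\<bar> / real n powr l) \<longlonglongrightarrow> 0"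
proof -
  have "eventually (\<lambda>n. real n powr l \<noteq> 0) sequentially"
    using eventually_gt_at_top[of 0] by eventually_elim simp
  then show ?thesis
    unfolding asip_close_def by (intro iffI) (erule smalloD_tendsto, rule smalloI_tendsto)
qed

text \<open>Measurability is what allows an almost sure statement to be carried from a probability space to
an image of it.\<close>

lemma asip_close_pred:
  "Measurable.pred (PiM UNIV (\<lambda>_. borel) \<Otimes>\<^sub>M PiM UNIV (\<lambda>_. borel)) (\<lambda>z. asip_close l (fst z) (snd z))"
proof -
  let ?X = "\<lambda>z n. \<bar>(\<Sum>k=1..n. fst z k) - (\<Sum>k=1..n. snd z k)\<bar> / real n powr l"
  have "asip_close l (fst z) (snd z) \<longleftrightarrow> (\<forall>k. \<exists>N. \<forall>n\<ge>N. ?X z n < 1 / Suc k)" for z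
  proof
    assume "asip_close l (fst z) (snd z)"
    then have "eventually (\<lambda>n. ?X z n < 1 / Suc k) sequentially" for k
      unfolding asip_close_tendsto by (rule order_tendstoD(2)) simp
    then show "\<forall>k. \<exists>N. \<forall>n\<ge>N. ?X z n < 1 / Suc k"
      unfolding eventually_sequentially by blast
  next
    assume R: "\<forall>k. \<exists>N. \<forall>n\<ge>N. ?X z n < 1 / Suc k"
    show "asip_close l (fst z) (snd z)"
      unfolding asip_close_tendsto
    proof (rule LIMSEQ_I)
      fix e :: real assume "e > 0"
      then obtain k where k: "1 / Suc k < e" using nat_approx_posE by blast
      obtain N where "\<forall>n\<ge>N. ?X z n < 1 / Suc k" using R by blast
      then have "\<forall>n\<ge>N. norm (?X z n - 0) < e" using k by (auto intro: less_trans)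
      then show "\<exists>N. \<forall>n\<ge>N. norm (?X z n - 0) < e" by blast
    qed
  qed
  moreover have "Measurable.pred (PiM UNIV (\<lambda>_. borel) \<Otimes>\<^sub>M PiM UNIV (\<lambda>_. borel))
     (\<lambda>z. \<forall>k. \<exists>N. \<forall>n\<ge>N. ?X z n < 1 / Suc k)"
    by measurable
  ultimately show ?thesis by simp
qed

lemma asip_close_perturbation:
  assumes l: "l > 0" and uv: "\<And>n. \<bar>(\<Sum>k=1..n. u k) - (\<Sum>k=1..n. v k)\<bar> \<le> C" and vw: "asip_close l v w"
  shows "asip_close l u w"
  unfolding asip_close_tendsto
proof (rule tendsto_sandwich[OF _ _ tendsto_const])
  let ?D = "\<lambda>u v n. \<bar>(\<Sum>k=1..n. u k) - (\<Sum>k=1..n. v k)\<bar> :: real"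
  show "\<forall>\<^sub>F n in sequentially. 0 \<le> ?D u w n / real n powr l" by simp
  show "\<forall>\<^sub>F n in sequentially. ?D u w n / real n powr l \<le> C / real n powr l + ?D v w n / real n powr l"
  proof (rule always_eventually, rule allI)
    fix n
    have "?D u w n \<le> C + ?D v w n" using uv[of n] by linarith
    then show "?D u w n / real n powr l \<le> C / real n powr l + ?D v w n / real n powr l"
      unfolding add_divide_distrib[symmetric] by (intro divide_right_mono) auto
  qed
  have "(\<lambda>n. C / real n powr l) \<longlonglongrightarrow> 0" using l by real_asymp
  from tendsto_add[OF this vw[unfolded asip_close_tendsto]]
  show "(\<lambda>n. C / real n powr l + ?D v w n / real n powr l) \<longlonglongrightarrow> 0" by simp
qed

context shrinking_extension
begin

abbreviation "transfer \<equiv> transfer_fun T p \<sigma>"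
abbreviation "check \<equiv> check_fun T p \<sigma>"

text \<open>The observables for which the series of the transfer function converges uniformly, to a bounded
function.\<close>

definition fiber_summable :: "('x \<Rightarrow> real) \<Rightarrow> bool" where
  "fiber_summable f \<longleftrightarrow> continuous_on UNIV f \<and>
     (\<exists>b. summable b \<and> (\<forall>n x. \<bar>f ((T ^^ n) (\<sigma> (p x))) - f ((T ^^ n) x)\<bar> \<le> b n))"

context
  fixes f assumes f: "fiber_summable f"
begin

lemma fiber_summable_meas: "f \<in> borel_measurable borel"
  using f by (auto simp: fiber_summable_def intro: borel_measurable_continuous_onI)

lemma transfer_summable: "summable (\<lambda>n. f ((T ^^ n) (\<sigma> (p x))) - f ((T ^^ n) x))"
proof -
  obtain b where b: "summable b" "\<And>n x. \<bar>f ((T ^^ n) (\<sigma> (p x))) - f ((T ^^ n) x)\<bar> \<le> b n"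
    using f unfolding fiber_summable_def by blast
  show ?thesis by (rule summable_comparison_test'[OF b(1)]) (simp add: b(2))
qed

lemma transfer_bounded: obtains C where "\<And>x. \<bar>transfer f x\<bar> \<le> C" "C \<ge> 0"
proof -
  obtain b where b: "summable b" "\<And>n x. \<bar>f ((T ^^ n) (\<sigma> (p x))) - f ((T ^^ n) x)\<bar> \<le> b n"
    using f unfolding fiber_summable_def by blast
  have "\<bar>transfer f x\<bar> \<le> suminf b" for x
    using norm_suminf_le[OF _ b(1), of "\<lambda>n. f ((T ^^ n) (\<sigma> (p x))) - f ((T ^^ n) x)"] b(2)
    by (simp add: transfer_fun_def)
  moreover from this[of undefined] have "0 \<le> suminf b" by linarith
  ultimately show thesis by (rule that)
qed

lemma transfer_meas: "transfer f \<in> borel_measurable borel"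
proof -
  note [measurable] = fiber_summable_meas
  show ?thesis unfolding transfer_fun_def by measurable
qed

text \<open>The terms at x and T x of the two transfer functions telescope; of the orbit of x only f (T^N x)
is left, so that the limit depends on p x only (\<open>hat_eq_check\<close>).\<close>

lemma hat_partial_sums:
  "(\<lambda>N. (\<Sum>n<N. f ((T ^^ n) (\<sigma> (p x)))) - (\<Sum>n<N. f ((T ^^ n) (\<sigma> (p (T x))))) + f ((T ^^ N) x))
    \<longlonglongrightarrow> hat_fun T p \<sigma> f x"
proof -
  have "(\<lambda>N. f x + (\<Sum>n<N. f ((T ^^ n) (\<sigma> (p x))) - f ((T ^^ n) x)) -
      (\<Sum>n<N. f ((T ^^ n) (\<sigma> (p (T x)))) - f ((T ^^ n) (T x)))) \<longlonglongrightarrow> hat_fun T p \<sigma> f x"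
    unfolding hat_fun_def transfer_fun_def
    by (intro tendsto_intros summable_LIMSEQ transfer_summable)
  moreover have "f x + (\<Sum>n<N. f ((T ^^ n) (\<sigma> (p x))) - f ((T ^^ n) x)) -
      (\<Sum>n<N. f ((T ^^ n) (\<sigma> (p (T x)))) - f ((T ^^ n) (T x))) =
      (\<Sum>n<N. f ((T ^^ n) (\<sigma> (p x)))) - (\<Sum>n<N. f ((T ^^ n) (\<sigma> (p (T x))))) + f ((T ^^ N) x)" for N
  proof -
    have "f x + (\<Sum>n<N. f ((T ^^ n) (T x))) = (\<Sum>n<N. f ((T ^^ n) x)) + f ((T ^^ N) x)"
      by (induction N) (simp_all add: funpow_swap1)
    then show ?thesis by (simp add: sum_subtractf)
  qed
  ultimately show ?thesis by simp
qed

lemma hat_eq_check: "hat_fun T p \<sigma> f x = check f (p x)"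
proof -
  have c: "continuous_on UNIV f" using f by (simp add: fiber_summable_def)
  have "(\<lambda>N. ((\<Sum>n<N. f ((T ^^ n) (\<sigma> (p (\<sigma> (p x)))))) - (\<Sum>n<N. f ((T ^^ n) (\<sigma> (p (T (\<sigma> (p x))))))) + f ((T ^^ N) (\<sigma> (p x))))
     - ((\<Sum>n<N. f ((T ^^ n) (\<sigma> (p x)))) - (\<Sum>n<N. f ((T ^^ n) (\<sigma> (p (T x))))) + f ((T ^^ N) x)))
     \<longlonglongrightarrow> hat_fun T p \<sigma> f (\<sigma> (p x)) - hat_fun T p \<sigma> f x"
    by (intro tendsto_diff hat_partial_sums)
  then have "(\<lambda>N. f ((T ^^ N) (\<sigma> (p x))) - f ((T ^^ N) x)) \<longlonglongrightarrow> hat_fun T p \<sigma> f (\<sigma> (p x)) - hat_fun T p \<sigma> f x"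
    by (simp add: sect equivariant)
  then have "hat_fun T p \<sigma> f (\<sigma> (p x)) - hat_fun T p \<sigma> f x = 0"
    using continuous_orbit_section[OF c, of x] LIMSEQ_unique by blast
  then show ?thesis by (simp add: check_fun_def)
qed

lemma cohomologous: "f x = check f (p x) - transfer f x + transfer f (T x)"
  unfolding hat_eq_check[symmetric] by (simp add: hat_fun_def)

lemma check_meas: "check f \<in> borel_measurable borel"
proof -
  note [measurable] = fiber_summable_meas transfer_meas
  show ?thesis unfolding check_fun_def hat_fun_def comp_def by measurable
qed

lemma check_bounded: obtains C where "\<And>y. \<bar>check f y\<bar> \<le> C" "C \<ge> 0"
proof -
  obtain C where C: "\<And>x. \<bar>transfer f x\<bar> \<le> C" "C \<ge> 0" using transfer_bounded by blast
  obtain D where D: "\<And>x. \<bar>f x\<bar> \<le> D" "D \<ge> 0"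
    using continuous_bounded[of f] f by (auto simp: fiber_summable_def)
  have "\<bar>check f y\<bar> \<le> D + C + C" for y
    using C(1)[of "\<sigma> y"] C(1)[of "T (\<sigma> y)"] D(1)[of "\<sigma> y"] unfolding check_fun_def hat_fun_def comp_def by linarith
  then show thesis by (rule that) (use C D in simp)
qed

lemma integral_check:
  assumes \<mu>: "invariant_prob T \<mu>"
  shows "(\<integral>x. f x \<partial>\<mu>) = (\<integral>y. check f y \<partial>distr \<mu> borel p)"
proof -
  interpret measure_preserving \<mu> T using invariant_measure_preserving[OF \<mu>] by simp
  note s[measurable_cong] = invariant_measure_preserving(2)[OF \<mu>]
  note [measurable] = fiber_summable_meas transfer_meas check_meas
  obtain C where C: "\<And>x. \<bar>transfer f x\<bar> \<le> C" "C \<ge> 0" using transfer_bounded by blast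
  obtain D where D: "\<And>x. \<bar>check f x\<bar> \<le> D" "D \<ge> 0" using check_bounded by blast
  have i1: "integrable \<mu> (\<lambda>x. check f (p x))"
    by (rule integrable_const_bound[where B=D]) (auto simp: D)
  have i2: "integrable \<mu> (transfer f)" "integrable \<mu> (\<lambda>x. transfer f (T x))"
    by (rule integrable_const_bound[where B=C]; auto simp: C)+
  have "(\<integral>x. f x \<partial>\<mu>) = (\<integral>x. check f (p x) - transfer f x + transfer f (T x) \<partial>\<mu>)"
    by (rule Bochner_Integration.integral_cong[OF refl cohomologous])
  also have "\<dots> = (\<integral>x. check f (p x) \<partial>\<mu>) - (\<integral>x. transfer f x \<partial>\<mu>) + (\<integral>x. transfer f (T x) \<partial>\<mu>)"
    using i1 i2 by simp
  also have "(\<integral>x. transfer f (T x) \<partial>\<mu>) = (\<integral>x. transfer f x \<partial>distr \<mu> \<mu> T)"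
    by (rule integral_distr[symmetric, OF T]) measurable
  also have "(\<integral>x. check f (p x) \<partial>\<mu>) = (\<integral>y. check f y \<partial>distr \<mu> borel p)"
    by (rule integral_distr[symmetric]) measurable
  finally show ?thesis by (simp add: inv)
qed

text \<open>The coboundary telescopes along the orbit.\<close>

lemma birkhoff_sum_close:
  obtains C where "C \<ge> 0" "\<And>n x. \<bar>(\<Sum>k=1..n. f ((T ^^ k) x)) - (\<Sum>k=1..n. check f ((S ^^ k) (p x)))\<bar> \<le> C"
proof -
  obtain C where C: "\<And>x. \<bar>transfer f x\<bar> \<le> C" "C \<ge> 0" using transfer_bounded by blast
  have "(\<Sum>k=1..n. f ((T ^^ k) x)) = (\<Sum>k=1..n. check f ((S ^^ k) (p x))) - transfer f (T x) + transfer f ((T ^^ Suc n) x)" for n x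
  proof (induction n)
    case (Suc n)
    show ?case using Suc cohomologous[of "(T ^^ Suc n) x"] p_pow[of "Suc n" x] by simp
  qed simp
  then have "\<bar>(\<Sum>k=1..n. f ((T ^^ k) x)) - (\<Sum>k=1..n. check f ((S ^^ k) (p x)))\<bar> \<le> C + C" for n x
    using C(1)[of "T x"] C(1)[of "(T ^^ Suc n) x"] by (simp del: funpow.simps)
  then show thesis by (intro that[of "C + C"]) (use C in auto)
qed

lemma LIL_lift:
  assumes \<mu>: "invariant_prob T \<mu>" and lil: "LIL_holds S (distr \<mu> borel p) (check f) s"
  shows "LIL_holds T \<mu> f s"
proof -
  note s[measurable_cong] = invariant_measure_preserving(2)[OF \<mu>]
  obtain C where C: "C \<ge> 0" "\<And>n x. \<bar>(\<Sum>k=1..n. f ((T ^^ k) x)) - (\<Sum>k=1..n. check f ((S ^^ k) (p x)))\<bar> \<le> C"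
    using birkhoff_sum_close by blast
  let ?m = "\<integral>x. f x \<partial>\<mu>"
  let ?N = "\<lambda>n::nat. sqrt (2 * real n * ln (ln (real n)))"
  let ?U = "\<lambda>x n. ((\<Sum>k=1..n. f ((T ^^ k) x)) - real n * ?m) / ?N n"
  let ?V = "\<lambda>y n. ((\<Sum>k=1..n. check f ((S ^^ k) y)) - real n * ?m) / ?N n"
  have "AE x in \<mu>. limsup (\<lambda>n. ereal (?V (p x) n)) = ereal s"
    using lil unfolding LIL_holds_def integral_check[OF \<mu>, symmetric]
    by (rule AE_distrD[rotated]) measurable
  moreover have "limsup (\<lambda>n. ereal (?U x n)) = limsup (\<lambda>n. ereal (?V (p x) n))" for x
  proof (rule limsup_eq_of_diff_null, rule Lim_null_comparison)
    show "(\<lambda>n. C / ?N n) \<longlonglongrightarrow> 0" by real_asymp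
    have "eventually (\<lambda>n. ?N n > 0) sequentially" by real_asymp
    then show "\<forall>\<^sub>F n in sequentially. norm (?U x n - ?V (p x) n) \<le> C / ?N n"
    proof eventually_elim
      case (elim n)
      have "?U x n - ?V (p x) n = ((\<Sum>k=1..n. f ((T ^^ k) x)) - (\<Sum>k=1..n. check f ((S ^^ k) (p x)))) / ?N n"
        by (simp add: diff_divide_distrib)
      also have "norm \<dots> = \<bar>(\<Sum>k=1..n. f ((T ^^ k) x)) - (\<Sum>k=1..n. check f ((S ^^ k) (p x)))\<bar> / ?N n"
        using elim by (simp only: real_norm_def abs_divide abs_of_pos)
      also have "\<dots> \<le> C / ?N n" using elim C(2) by (intro divide_right_mono) auto
      finally show ?case .
    qed
  qed
  ultimately show ?thesis unfolding LIL_holds_def by simp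
qed

lemma CLT_lift:
  assumes \<mu>: "invariant_prob T \<mu>" and s0: "s > 0" and clt: "CLT_holds S (distr \<mu> borel p) (check f) s"
  shows "CLT_holds T \<mu> f s"
  unfolding CLT_holds_def
proof
  fix r
  interpret measure_preserving \<mu> T using invariant_measure_preserving[OF \<mu>] by simp
  note s[measurable_cong] = invariant_measure_preserving(2)[OF \<mu>]
  note [measurable] = fiber_summable_meas check_meas
  obtain C where C: "C \<ge> 0" "\<And>n x. \<bar>(\<Sum>k=1..n. f ((T ^^ k) x)) - (\<Sum>k=1..n. check f ((S ^^ k) (p x)))\<bar> \<le> C"
    using birkhoff_sum_close by blast
  let ?m = "\<integral>x. f x \<partial>\<mu>"
  let ?V = "\<lambda>n y. ((\<Sum>k=1..n. check f ((S ^^ k) y)) - real n * ?m) / sqrt (real n)"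
  show "(\<lambda>n. measure \<mu> {x \<in> space \<mu>. ((\<Sum>k=1..n. f ((T ^^ k) x)) - real n * ?m) / sqrt (real n) \<le> r})
       \<longlonglongrightarrow> cdf (density lborel (normal_density 0 s)) r"
  proof (rule cdf_limit_perturbation[where A="\<lambda>n x. ?V n (p x)" and c="\<lambda>n. C / sqrt (real n)"])
    show "(\<lambda>n. C / sqrt (real n)) \<longlonglongrightarrow> 0" by real_asymp
    show "\<bar>?V n (p x) - ((\<Sum>k=1..n. f ((T ^^ k) x)) - real n * ?m) / sqrt (real n)\<bar> \<le> C / sqrt (real n)" for n x
    proof -
      have "?V n (p x) - ((\<Sum>k=1..n. f ((T ^^ k) x)) - real n * ?m) / sqrt (real n)
         = ((\<Sum>k=1..n. check f ((S ^^ k) (p x))) - (\<Sum>k=1..n. f ((T ^^ k) x))) / sqrt (real n)"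
        by (simp add: diff_divide_distrib)
      also have "\<bar>\<dots>\<bar> \<le> C / sqrt (real n)"
        using C(2)[of x n] by (simp add: divide_right_mono abs_minus_commute)
      finally show ?thesis .
    qed
    show "isCont (cdf (density lborel (normal_density 0 s))) r" by (rule isCont_normal_cdf[OF s0])
    fix r
    have eq: "measure (distr \<mu> borel p) {y \<in> space (distr \<mu> borel p). ?V n y \<le> r} = measure \<mu> {x \<in> space \<mu>. ?V n (p x) \<le> r}" for n
      using invariant_measure_preserving(3)[OF \<mu>]
      by (subst measure_distr) (auto intro!: arg_cong[where f="measure \<mu>"])
    show "(\<lambda>n. measure \<mu> {x \<in> space \<mu>. ?V n (p x) \<le> r}) \<longlonglongrightarrow> cdf (density lborel (normal_density 0 s)) r"
      using clt[unfolded CLT_holds_def integral_check[OF \<mu>, symmetric], rule_format, of r]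
      unfolding eq .
  qed measurable
qed

text \<open>The hypothesis provides a coupling of the orbit of check f with Gaussian variables, and \<mu> provides
a coupling of the orbit of f with the orbit of check f. Gluing the two makes the orbit of f and the
Gaussian variables live on the same space, where they are close because both are close to the orbit
of check f. Only joint laws matter, so the projection of the glued measure to the outer
coordinates is the probability space that is asked for.\<close>

lemma ASIP_lift:
  assumes \<mu>: "invariant_prob T \<mu>" and asip: "ASIP_holds S (distr \<mu> borel p) (check f) s l"
  shows "ASIP_holds T \<mu> f s l"
proof -
  interpret measure_preserving \<mu> T using invariant_measure_preserving[OF \<mu>] by simp
  note s[measurable_cong] = invariant_measure_preserving(2)[OF \<mu>]
  note [measurable] = fiber_summable_meas check_meas
  let ?V = "PiM (UNIV :: nat set) (\<lambda>_. borel :: real measure)"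
  let ?\<nu> = "distr \<mu> borel p"
  obtain C where C: "C \<ge> 0" "\<And>n x. \<bar>(\<Sum>k=1..n. f ((T ^^ k) x)) - (\<Sum>k=1..n. check f ((S ^^ k) (p x)))\<bar> \<le> C"
    using birkhoff_sum_close by blast
  have l: "0 < l" "l \<le> 1 / 2" using asip by (auto simp: ASIP_holds_def)
  obtain \<Omega> :: "((nat \<Rightarrow> real) \<times> (nat \<Rightarrow> real)) measure" and A B where \<Omega>: "prob_space \<Omega>"
    and A[measurable]: "\<And>k. A k \<in> borel_measurable \<Omega>"
    and Alaw: "distr \<Omega> ?V (\<lambda>z k. A k z) = distr ?\<nu> ?V (\<lambda>x k. check f ((S ^^ k) x))"
    and Bind: "prob_space.indep_vars \<Omega> (\<lambda>k. borel) B (UNIV :: nat set)"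
    and Bd: "\<And>k. distributed \<Omega> lborel (B k) (normal_density (\<integral>x. check f x \<partial>?\<nu>) s)"
    and close: "AE z in \<Omega>. asip_close l (\<lambda>k. A k z) (\<lambda>k. B k z)"
    using asip unfolding ASIP_holds_def asip_close_def[symmetric] by blast
  interpret O: prob_space \<Omega> by (rule \<Omega>)
  have B[measurable]: "B k \<in> borel_measurable \<Omega>" for k
    using distributed_measurable[OF Bd[of k]] by simp
  have m1[measurable]: "(\<lambda>z k. A k z) \<in> measurable \<Omega> ?V" "(\<lambda>z k. B k z) \<in> measurable \<Omega> ?V"
    by (rule measurable_PiM_single'; simp)+
  have m2[measurable]: "(\<lambda>x k. f ((T ^^ k) x)) \<in> measurable \<mu> ?V" "(\<lambda>x k. check f ((S ^^ k) (p x))) \<in> measurable \<mu> ?V"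
    "(\<lambda>y k. check f ((S ^^ k) y)) \<in> measurable borel ?V"
    by (rule measurable_PiM_single'; simp)+
  define P1 where "P1 = distr \<mu> (?V \<Otimes>\<^sub>M ?V) (\<lambda>x. (\<lambda>k. f ((T ^^ k) x), \<lambda>k. check f ((S ^^ k) (p x))))"
  define P2 where "P2 = distr \<Omega> (?V \<Otimes>\<^sub>M ?V) (\<lambda>z. (\<lambda>k. A k z, \<lambda>k. B k z))"
  have P1: "prob_space P1" "sets P1 = sets (?V \<Otimes>\<^sub>M ?V)" unfolding P1_def by (auto intro!: prob_space_distr)
  have P2: "prob_space P2" "sets P2 = sets (?V \<Otimes>\<^sub>M ?V)" unfolding P2_def by (auto intro!: O.prob_space_distr)
  have marg: "distr P1 ?V snd = distr P2 ?V fst"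
  proof -
    have "distr P1 ?V snd = distr \<mu> ?V (\<lambda>x k. check f ((S ^^ k) (p x)))"
      unfolding P1_def by (subst distr_distr) (auto simp: comp_def)
    also have "\<dots> = distr ?\<nu> ?V (\<lambda>x k. check f ((S ^^ k) x))"
      by (subst distr_distr) (auto simp: comp_def)
    also have "\<dots> = distr P2 ?V fst"
      unfolding Alaw[symmetric] P2_def by (subst distr_distr) (auto simp: comp_def)
    finally show ?thesis .
  qed
  obtain P where P: "prob_space P" and Ps[measurable_cong]: "sets P = sets (?V \<Otimes>\<^sub>M ?V \<Otimes>\<^sub>M ?V)"
    and P12: "distr P (?V \<Otimes>\<^sub>M ?V) (\<lambda>(u, v, w). (u, v)) = P1" and P23: "distr P (?V \<Otimes>\<^sub>M ?V) snd = P2"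
    by (rule gluing[OF real_coded_sequences P1 P2 marg]) (rule that, assumption+)
  interpret P: prob_space P by (rule P)
  define \<Omega>' where "\<Omega>' = distr P (?V \<Otimes>\<^sub>M ?V) (\<lambda>z. (fst z, snd (snd z)))"
  have \<Omega>'s[measurable_cong]: "sets \<Omega>' = sets (?V \<Otimes>\<^sub>M ?V)" by (simp add: \<Omega>'_def)
  interpret O': prob_space \<Omega>' unfolding \<Omega>'_def by (rule P.prob_space_distr) measurable
  have law_fst: "distr \<Omega>' ?V fst = distr \<mu> ?V (\<lambda>x k. f ((T ^^ k) x))"
  proof -
    have "distr \<Omega>' ?V fst = distr P1 ?V fst"
      unfolding \<Omega>'_def P12[symmetric] by (subst (1 2) distr_distr) (auto simp: comp_def split_beta')
    also have "\<dots> = distr \<mu> ?V (\<lambda>x k. f ((T ^^ k) x))"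
      unfolding P1_def by (subst distr_distr) (auto simp: comp_def)
    finally show ?thesis .
  qed
  have law_snd: "distr \<Omega>' ?V snd = distr \<Omega> ?V (\<lambda>z k. B k z)"
  proof -
    have "distr \<Omega>' ?V snd = distr P2 ?V snd"
      unfolding \<Omega>'_def P23[symmetric] by (subst (1 2) distr_distr) (auto simp: comp_def)
    also have "\<dots> = distr \<Omega> ?V (\<lambda>z k. B k z)"
      unfolding P2_def by (subst distr_distr) (auto simp: comp_def)
    finally show ?thesis .
  qed
  have law_B: "distr \<Omega>' borel (\<lambda>z. snd z k) = distr \<Omega> borel (B k)" for k
  proof -
    have "distr \<Omega>' borel (\<lambda>z. snd z k) = distr (distr \<Omega>' ?V snd) borel (\<lambda>b. b k)"
      by (subst distr_distr) (auto simp: comp_def)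
    also have "\<dots> = distr \<Omega> borel (B k)"
      unfolding law_snd by (subst distr_distr) (auto simp: comp_def)
    finally show ?thesis .
  qed
  show ?thesis
    unfolding ASIP_holds_def asip_close_def[symmetric]
  proof (intro conjI l, rule exI[of _ \<Omega>'], rule exI[of _ "\<lambda>k z. fst z k"],
      rule exI[of _ "\<lambda>k z. snd z k"], intro conjI allI)
    show "prob_space \<Omega>'" by (rule O'.prob_space_axioms)
    show "(\<lambda>z. fst z k) \<in> borel_measurable \<Omega>'" for k by measurable
    show "distr \<Omega>' ?V (\<lambda>z k. fst z k) = distr \<mu> ?V (\<lambda>x k. f ((T ^^ k) x))" using law_fst by simp
    show "O'.indep_vars (\<lambda>k. borel) (\<lambda>k z. snd z k) (UNIV :: nat set)"
    proof (subst O'.indep_vars_iff_distr_eq_PiM)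
      have "distr \<Omega> ?V (\<lambda>z k. B k z) = (\<Pi>\<^sub>M k\<in>UNIV. distr \<Omega> borel (B k))"
        using Bind by (subst (asm) O.indep_vars_iff_distr_eq_PiM) (auto simp: restrict_UNIV)
      then show "distr \<Omega>' (PiM UNIV (\<lambda>_. borel)) (\<lambda>z. \<lambda>k\<in>UNIV. snd z k) = (\<Pi>\<^sub>M k\<in>UNIV. distr \<Omega>' borel (\<lambda>z. snd z k))"
        using law_snd by (simp add: law_B restrict_UNIV)
    qed auto
    show "distributed \<Omega>' lborel (\<lambda>z. snd z k) (normal_density (\<integral>x. f x \<partial>\<mu>) s)" for k
    proof -
      have 1: "distr \<Omega>' lborel (\<lambda>z. snd z k) = distr \<Omega>' borel (\<lambda>z. snd z k)" by (rule distr_cong) auto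
      have 2: "distr \<Omega> lborel (B k) = distr \<Omega> borel (B k)" by (rule distr_cong) auto
      show ?thesis
        using Bd[of k] unfolding distributed_def 1 2 law_B integral_check[OF \<mu>, symmetric] by auto
    qed
    have "AE z in P2. asip_close l (fst z) (snd z)"
      unfolding P2_def using close predE[OF asip_close_pred[of l]] by (subst AE_distr_iff) auto
    then have a1: "AE z in P. asip_close l (fst (snd z)) (snd (snd z))"
      unfolding P23[symmetric] by (rule AE_distrD[rotated]) measurable
    have "Measurable.pred (?V \<Otimes>\<^sub>M ?V) (\<lambda>z. \<forall>n. \<bar>(\<Sum>k=1..n. fst z k) - (\<Sum>k=1..n. snd z k)\<bar> \<le> C)"
      by measurable
    from predE[OF this] have "AE z in P1. \<forall>n. \<bar>(\<Sum>k=1..n. fst z k) - (\<Sum>k=1..n. snd z k)\<bar> \<le> C"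
      unfolding P1_def using C(2) by (subst AE_distr_iff) auto
    then have q12: "AE z in distr P (?V \<Otimes>\<^sub>M ?V) (\<lambda>(u, v, w). (u, v)). \<forall>n. \<bar>(\<Sum>k=1..n. fst z k) - (\<Sum>k=1..n. snd z k)\<bar> \<le> C"
      unfolding P12 .
    have m12: "(\<lambda>(u, v, w). (u, v)) \<in> measurable P (?V \<Otimes>\<^sub>M ?V)"
      unfolding split_beta' by measurable
    have a2: "AE z in P. \<forall>n. \<bar>(\<Sum>k=1..n. fst z k) - (\<Sum>k=1..n. fst (snd z) k)\<bar> \<le> C"
      using AE_distrD[OF m12 q12] by (simp add: split_beta')
    have "AE z in P. asip_close l (fst z) (snd (snd z))"
      using a1 a2 by eventually_elim (rule asip_close_perturbation[OF l(1)], auto)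
    then show "AE z in \<Omega>'. asip_close l (\<lambda>k. fst z k) (\<lambda>k. snd z k)"
      unfolding \<Omega>'_def using predE[OF asip_close_pred[of l]] by (subst AE_distr_iff) auto
  qed
qed

lemma limit_theorem_lift:
  assumes \<mu>: "invariant_prob T \<mu>" and lt: "limit_theorem_holds \<T> S (distr \<mu> borel p) (check f) s l"
  shows "limit_theorem_holds \<T> T \<mu> f s l"
  using lt LIL_lift[OF \<mu>] CLT_lift[OF \<mu>] ASIP_lift[OF \<mu>]
  unfolding limit_theorem_holds_def by (cases \<T>) auto

end

end

section \<open>Estimates on moduli of continuity\<close>

text \<open>By the mean value theorem the terms are dominated by multiples of the decrements of n^(1 - s), which
telescope.\<close>

lemma p_series_tail:
  fixes s :: real
  assumes s: "s > 1"
  obtains K where "K \<ge> 0" "\<And>N. N \<ge> 1 \<Longrightarrow> summable (\<lambda>n. real (n + N) powr (- s))"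
    "\<And>N. N \<ge> 1 \<Longrightarrow> (\<Sum>n. real (n + N) powr (- s)) \<le> K * real N powr (1 - s)"
proof -
  \<comment> \<open>The factor 2 powr (- s) compares z powr (- s) for z < m + 1 with m powr (- s).\<close>
  define c where "c = (s - 1) * 2 powr (- s)"
  have c: "c > 0" unfolding c_def using s by simp
  have key: "real m powr (- s) \<le> (real m powr (1 - s) - real (Suc m) powr (1 - s)) / c" if m: "m \<ge> 1" for m
  proof -
    have "\<exists>z>real m. z < real (Suc m) \<and> real (Suc m) powr (1 - s) - real m powr (1 - s)
        = (real (Suc m) - real m) * ((1 - s) * z powr (- s))"
    proof (rule MVT2)
      show "((\<lambda>x. x powr (1 - s)) has_real_derivative (1 - s) * x powr (- s)) (at x)" 
        if "real m \<le> x" "x \<le> real (Suc m)" for x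
        using that m by (auto intro!: derivative_eq_intros)
    qed simp
    then obtain z where z: "real m < z" "z < real (Suc m)"
      "real (Suc m) powr (1 - s) - real m powr (1 - s) = (1 - s) * z powr (- s)" by auto
    have "2 powr (- s) * real m powr (- s) = (2 * real m) powr (- s)" by (simp add: powr_mult)
    also have "\<dots> \<le> z powr (- s)" using z m s by (intro powr_mono2') auto
    finally have "c * real m powr (- s) \<le> (s - 1) * z powr (- s)"
      unfolding c_def using s by (simp add: mult.assoc mult_left_mono)
    also have "\<dots> = real m powr (1 - s) - real (Suc m) powr (1 - s)" using z(3) by (simp add: algebra_simps)
    finally show ?thesis using c by (simp add: field_simps)
  qed
  have tele: "(\<lambda>n. (real (n + N) powr (1 - s) - real (Suc (n + N)) powr (1 - s)) / c) sums (real N powr (1 - s) / c)" for N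
  proof -
    have "(\<lambda>n. real (n + N) powr (1 - s)) \<longlonglongrightarrow> 0" using s by real_asymp
    from telescope_sums'[OF this] show ?thesis by (intro sums_divide) simp
  qed
  show thesis
  proof (rule that[of "1 / c"])
    fix N :: nat assume N: "N \<ge> 1"
    have kN: "real (n + N) powr (- s) \<le> (real (n + N) powr (1 - s) - real (Suc (n + N)) powr (1 - s)) / c" for n
      by (rule key) (use N in simp)
    show sm: "summable (\<lambda>n. real (n + N) powr (- s))"
      by (rule summable_comparison_test'[OF sums_summable[OF tele[of N]], of 0]) (use kN in simp)
    have "(\<Sum>n. real (n + N) powr (- s)) \<le> (\<Sum>n. (real (n + N) powr (1 - s) - real (Suc (n + N)) powr (1 - s)) / c)"
      by (rule suminf_le[OF _ sm sums_summable[OF tele[of N]]]) (rule kN)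
    then show "(\<Sum>n. real (n + N) powr (- s)) \<le> 1 / c * real N powr (1 - s)"
      using sums_unique[OF tele[of N]] by simp
  qed (use c in simp)
qed

lemma exp_decay_bound:
  fixes b c q l0 :: real
  assumes b: "b > 0" and c: "c > 0" and l0: "l0 > 0"
  obtains K where "K \<ge> 0" "\<And>l. l \<ge> l0 \<Longrightarrow> (c * l + 1) * exp (- b * l) \<le> K * l powr (- q)"
proof -
  define g where "g l = (c * l + 1) * exp (- b * l) * l powr q" for l
  have "(g \<longlongrightarrow> 0) at_top" unfolding g_def using b c by real_asymp
  then have "eventually (\<lambda>l. g l < 1) at_top" by (rule order_tendstoD) simp
  then obtain A where A: "\<And>l. l \<ge> A \<Longrightarrow> g l < 1" by (auto simp: eventually_at_top_linorder)
  have "continuous_on {l0..max A l0} g"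
    unfolding g_def using l0 by (intro continuous_intros) auto
  then have "bounded (g ` {l0..max A l0})" by (intro compact_imp_bounded compact_continuous_image) auto
  then obtain B where B': "\<forall>l\<in>{l0..max A l0}. \<bar>g l\<bar> \<le> B" unfolding bounded_iff by auto
  have B: "\<bar>g l\<bar> \<le> B" if "l \<in> {l0..max A l0}" for l using B' that by blast
  have B0: "B \<ge> 0" using B[of l0] abs_ge_zero[of "g l0"] by force
  have gK: "g l \<le> B + 1" if "l \<ge> l0" for l
  proof (cases "l \<ge> A")
    case True
    then show ?thesis using A[of l] B0 by simp
  next
    case False
    then have "\<bar>g l\<bar> \<le> B" using that by (intro B) auto
    then show ?thesis by simp
  qed
  show thesis
  proof (rule that[of "B + 1"])
    fix l assume l: "l \<ge> l0"
    have "(c * l + 1) * exp (- b * l) = g l * l powr (- q)"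
      unfolding g_def using l l0 by (simp add: mult.assoc powr_add[symmetric])
    also have "\<dots> \<le> (B + 1) * l powr (- q)" by (intro mult_right_mono gK l) simp
    finally show "(c * l + 1) * exp (- b * l) \<le> (B + 1) * l powr (- q)" .
  qed (use B0 in simp)
qed

text \<open>With l playing the role of - ln t, the logarithmic modulus behaves like a power of l, even after a
power and a constant factor have been applied to t.\<close>

lemma log_modulus_exp:
  fixes b B r \<alpha> l0 :: real
  assumes r: "r > 1" and \<alpha>: "\<alpha> > 0" and b: "b > 0" and B: "B > 0" and l0: "l0 > 0"
  obtains K where "K \<ge> 0" "\<And>l. l \<ge> l0 \<Longrightarrow> log_modulus r \<alpha> (B * exp (- b * l)) \<le> K * l powr (- \<alpha>)"
proof -
  define A where "A = max 1 (ln B)"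
  \<comment> \<open>The logarithm in the modulus is at least ln r, and at least b l - A; hence it is at least \<kappa> l.\<close>
  define \<kappa> where "\<kappa> = min (b / 2) (ln r * b / (2 * A))"
  have A: "A \<ge> 1" "ln B \<le> A" by (auto simp: A_def)
  have \<kappa>: "\<kappa> > 0" unfolding \<kappa>_def using b A r by auto
  show thesis
  proof (rule that[of "\<kappa> powr (- \<alpha>)"])
    fix l assume l: "l \<ge> l0"
    define x where "x = B * exp (- b * l)"
    have x: "x > 0" unfolding x_def using B by simp
    have lnx: "ln x = ln B - b * l" unfolding x_def using B by (simp add: ln_mult)
    have 1: "ln (r / min x 1) \<ge> ln r" using x r by (intro iffD2[OF ln_le_cancel_iff]) (auto simp: field_simps min_def)
    have 2: "ln (r / min x 1) \<ge> b * l - A"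
    proof (cases "x \<le> 1")
      case True
      then have "ln (r / min x 1) = ln r - ln x" using x r by (simp add: ln_div)
      moreover have "ln r > 0" using r by simp
      ultimately show ?thesis using lnx A by linarith
    next
      case False
      then have "ln x > 0" by simp
      then have "b * l - A < 0" using lnx A by linarith
      moreover have "ln (r / min x 1) > 0" using False r by simp
      ultimately show ?thesis by linarith
    qed
    have "\<kappa> * l \<le> ln (r / min x 1)"
    proof (cases "b * l \<ge> 2 * A")
      case True
      have "\<kappa> * l \<le> b / 2 * l" using l l0 by (intro mult_right_mono) (auto simp: \<kappa>_def)
      also have "\<dots> \<le> b * l - A" using True by simp
      finally show ?thesis using 2 by simp
    next
      case False
      have "\<kappa> * l \<le> ln r * b / (2 * A) * l" using l l0 by (intro mult_right_mono) (auto simp: \<kappa>_def)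
      also have "\<dots> = ln r * (b * l / (2 * A))" by simp
      also have "\<dots> \<le> ln r * 1" using False A r by (intro mult_left_mono) auto
      finally show ?thesis using 1 by simp
    qed
    then have "ln (r / min x 1) powr (- \<alpha>) \<le> (\<kappa> * l) powr (- \<alpha>)"
      using \<kappa> l l0 \<alpha> by (intro powr_mono2') auto
    also have "\<dots> = \<kappa> powr (- \<alpha>) * l powr (- \<alpha>)" using \<kappa> l l0 by (simp add: powr_mult)
    finally show "log_modulus r \<alpha> (B * exp (- b * l)) \<le> \<kappa> powr (- \<alpha>) * l powr (- \<alpha>)"
      using x unfolding x_def[symmetric] log_modulus_def by simp
  qed simp
qed

lemma powr_neg_le:
  fixes l l0 p q :: real
  assumes "l \<ge> l0" "l0 > 0" "q \<le> p"
  shows "l powr (- p) \<le> l0 powr (q - p) * l powr (- q)"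
proof -
  have "l powr (- p) = l powr (q - p) * l powr (- q)" using assms by (simp add: powr_add[symmetric])
  also have "\<dots> \<le> l0 powr (q - p) * l powr (- q)"
    using assms by (intro mult_right_mono powr_mono2') auto
  finally show ?thesis .
qed

text \<open>Here t is the distance of two points y, y' of the base and D bounds the diameter. The numbers
M L^n t^\<beta> bound the distances after n steps of the lifts of y and y', and a n is the size of
fibers after n steps. The criterion says that the series can be cut at some N depending on t in such a
way that both parts are of order \<omega>' t.\<close>

definition regularity_criterion ::
  "(real \<Rightarrow> real) \<Rightarrow> (real \<Rightarrow> real) \<Rightarrow> (nat \<Rightarrow> real) \<Rightarrow> real \<Rightarrow> real \<Rightarrow> real \<Rightarrow> real \<Rightarrow> bool" where
  "regularity_criterion \<omega> \<omega>' a L M \<beta> D \<longleftrightarrow> summable (\<lambda>n. \<omega> (a n)) \<and>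
     (\<exists>K\<ge>0. \<forall>t. 0 < t \<and> t \<le> D \<longrightarrow> (\<exists>N\<ge>1.
        (\<Sum>n<N. \<omega> (M * L ^ n * t powr \<beta>)) + (\<Sum>n. \<omega> (a (n + N))) \<le> K * \<omega>' t))"

text \<open>The two parts are of order (L^N t^\<beta>)^\<alpha> (a geometric sum, thanks to L > 1) and \<theta>^(N \<alpha>). They balance
when (L / \<theta>)^N = t^(- \<beta>), that is N = c ln (1 / t) with c = \<beta> / (ln L - ln \<theta>), and then both are of order
t^\<gamma> for the exponent \<gamma> of the statement.\<close>

lemma criterion_power:
  assumes L: "L > 1" and \<theta>: "0 < \<theta>" "\<theta> < 1" and C: "C > 0" and M: "M \<ge> 1" and \<beta>: "0 < \<beta>"
    and D: "D \<ge> 1" and \<alpha>: "0 < \<alpha>"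
  shows "regularity_criterion (pow_modulus \<alpha>) (pow_modulus (\<alpha> * \<beta> / (1 - ln L / ln \<theta>)))
    (\<lambda>n. C * \<theta> ^ n) L M \<beta> D"
proof -
  define \<gamma> where "\<gamma> = \<alpha> * \<beta> / (1 - ln L / ln \<theta>)"
  define c where "c = \<beta> / (ln L - ln \<theta>)"
  have lL: "ln L > 0" using L by simp
  have l\<theta>: "ln \<theta> < 0" using \<theta> by simp
  have c: "c > 0" unfolding c_def using lL l\<theta> \<beta> by simp
  have den: "ln L - ln \<theta> > 0" using lL l\<theta> by simp
  have \<gamma>1: "\<gamma> = - \<alpha> * c * ln \<theta>"
    unfolding \<gamma>_def c_def using den l\<theta> by (simp add: divide_simps) (simp add: algebra_simps)
  have \<gamma>2: "\<gamma> = \<alpha> * \<beta> - \<alpha> * c * ln L"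
    unfolding \<gamma>1 c_def using den by (simp add: field_simps)
  have val: "(C * \<theta> ^ n) powr \<alpha> = C powr \<alpha> * (\<theta> powr \<alpha>) ^ n" for n
    using C \<theta> by (simp add: powr_mult powr_realpow[symmetric] powr_powr mult.commute)
  have \<theta>\<alpha>: "\<theta> powr \<alpha> < 1" using \<theta> \<alpha> powr_less_mono2[of \<alpha> \<theta> 1] by simp
  have L\<alpha>: "L powr \<alpha> > 1" using L \<alpha> powr_less_mono2[of \<alpha> 1 L] by simp
  have sm: "summable (\<lambda>n. C powr \<alpha> * (\<theta> powr \<alpha>) ^ (n + N))" for N
    unfolding power_add using \<theta>\<alpha> by (intro summable_mult summable_mult2 summable_geometric) simp
  have tail: "(\<Sum>n. C powr \<alpha> * (\<theta> powr \<alpha>) ^ (n + N)) = C powr \<alpha> / (1 - \<theta> powr \<alpha>) * (\<theta> powr \<alpha>) ^ N" for N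
  proof -
    have "(\<lambda>n. C powr \<alpha> * (\<theta> powr \<alpha>) ^ N * (\<theta> powr \<alpha>) ^ n) sums (C powr \<alpha> * (\<theta> powr \<alpha>) ^ N * (1 / (1 - \<theta> powr \<alpha>)))"
      using \<theta>\<alpha> by (intro sums_mult geometric_sums) simp
    then show ?thesis by (simp add: sums_iff power_add mult_ac)
  qed
  define K1 where "K1 = M powr \<alpha> / (L powr \<alpha> - 1) * L powr (2 * \<alpha>) * D powr (\<alpha> * \<beta>)"
  define K2 where "K2 = C powr \<alpha> / (1 - \<theta> powr \<alpha>)"
  have K: "K1 \<ge> 0" "K2 \<ge> 0" unfolding K1_def K2_def using L\<alpha> \<theta>\<alpha> by auto
  show ?thesis
    unfolding regularity_criterion_def \<gamma>_def[symmetric]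
  proof (intro conjI exI[of _ "(K1 + K2) * D powr (- \<gamma>)"] allI impI)
    show "summable (\<lambda>n. pow_modulus \<alpha> (C * \<theta> ^ n))" using sm[of 0] by (simp add: pow_modulus_def val)
    show "0 \<le> (K1 + K2) * D powr (- \<gamma>)" using K by simp
    fix t :: real assume t: "0 < t \<and> t \<le> D"
    define l where "l = ln (D / t)"
    have l: "l \<ge> 0" unfolding l_def using t D by simp
    have tl: "t = D * exp (- l)" unfolding l_def using t D by (simp add: ln_div exp_minus exp_diff field_simps)
    define N where "N = nat \<lceil>c * l\<rceil> + 1"
    have N: "N \<ge> 1" "c * l \<le> real N" "real N \<le> c * l + 2"
      unfolding N_def using c l by (auto simp: of_nat_nat) linarith+
    have "(\<Sum>n<N. pow_modulus \<alpha> (M * L ^ n * t powr \<beta>)) = M powr \<alpha> * t powr (\<alpha> * \<beta>) * (\<Sum>n<N. (L powr \<alpha>) ^ n)"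
    proof -
      have "pow_modulus \<alpha> (M * L ^ n * t powr \<beta>) = M powr \<alpha> * t powr (\<alpha> * \<beta>) * (L powr \<alpha>) ^ n" for n
        using M L t by (simp add: pow_modulus_def powr_mult powr_realpow[symmetric] powr_powr mult_ac)
      then show ?thesis by (simp add: sum_distrib_left)
    qed
    also have "(\<Sum>n<N. (L powr \<alpha>) ^ n) = ((L powr \<alpha>) ^ N - 1) / (L powr \<alpha> - 1)"
      using L\<alpha> by (intro geometric_sum) simp
    also have "\<dots> \<le> (L powr \<alpha>) ^ N / (L powr \<alpha> - 1)" using L\<alpha> by (intro divide_right_mono) auto
    also have "(L powr \<alpha>) ^ N = exp (real N * \<alpha> * ln L)"
      using L by (simp add: powr_def exp_of_nat_mult[symmetric] mult_ac)
    also have "\<dots> \<le> exp ((c * l + 2) * \<alpha> * ln L)" using N(3) \<alpha> lL by (simp add: mult_right_mono)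
    also have "\<dots> = L powr (2 * \<alpha>) * exp (\<alpha> * c * ln L * l)"
      using L by (simp add: powr_def exp_add[symmetric] algebra_simps)
    also have "t powr (\<alpha> * \<beta>) = D powr (\<alpha> * \<beta>) * exp (- (\<alpha> * \<beta>) * l)"
      unfolding tl using D by (simp add: powr_mult powr_def[of "exp _"])
    also have "M powr \<alpha> * (D powr (\<alpha> * \<beta>) * exp (- (\<alpha> * \<beta>) * l)) * (L powr (2 * \<alpha>) * exp (\<alpha> * c * ln L * l) / (L powr \<alpha> - 1))
       = K1 * (exp (- (\<alpha> * \<beta>) * l) * exp (\<alpha> * c * ln L * l))"
      by (simp add: K1_def mult_ac)
    also have "exp (- (\<alpha> * \<beta>) * l) * exp (\<alpha> * c * ln L * l) = exp (- \<gamma> * l)"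
      unfolding \<gamma>2 exp_add[symmetric] by (simp add: algebra_simps)
    finally have 1: "(\<Sum>n<N. pow_modulus \<alpha> (M * L ^ n * t powr \<beta>)) \<le> K1 * exp (- \<gamma> * l)"
      using L\<alpha> by (simp add: mult_left_mono divide_right_mono)
    have "(\<theta> powr \<alpha>) ^ N = exp (real N * (\<alpha> * ln \<theta>))"
      using \<theta> by (simp add: powr_def exp_of_nat_mult[symmetric])
    also have "\<dots> \<le> exp (c * l * (\<alpha> * ln \<theta>))"
      using N(2) \<alpha> l\<theta> by (simp add: mult_right_mono_neg mult_pos_neg less_imp_le)
    also have "\<dots> = exp (- \<gamma> * l)" unfolding \<gamma>1 by (simp add: algebra_simps)
    finally have "(\<Sum>n. pow_modulus \<alpha> (C * \<theta> ^ (n + N))) \<le> K2 * exp (- \<gamma> * l)"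
      unfolding pow_modulus_def val tail K2_def[symmetric] using K by (intro mult_left_mono) auto
    then have "(\<Sum>n<N. pow_modulus \<alpha> (M * L ^ n * t powr \<beta>)) + (\<Sum>n. pow_modulus \<alpha> (C * \<theta> ^ (n + N))) \<le> (K1 + K2) * exp (- \<gamma> * l)"
      using 1 by (simp add: algebra_simps)
    also have "exp (- \<gamma> * l) = D powr (- \<gamma>) * t powr \<gamma>"
      unfolding tl using D by (simp add: powr_mult powr_def[of "exp _"] powr_add[symmetric] mult.assoc[symmetric])
    finally show "\<exists>N\<ge>1. (\<Sum>n<N. pow_modulus \<alpha> (M * L ^ n * t powr \<beta>)) + (\<Sum>n. pow_modulus \<alpha> (C * \<theta> ^ (n + N)))
         \<le> (K1 + K2) * D powr (- \<gamma>) * pow_modulus \<gamma> t"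
      using N(1) by (auto simp: pow_modulus_def mult.assoc)
  qed
qed

text \<open>For logarithmic moduli no balance is needed: c is taken so small that L^N uses up only half of the
decay of t^\<beta>. The variable l = ln (r' / min t 1) is the one in which the target modulus is a power,
and min t 1 loses at most a factor D against t.\<close>

lemma log_scale:
  assumes L: "L > 1" and M: "M \<ge> 1" and \<beta>: "0 < \<beta>" and D: "D \<ge> 1" and r: "r' > 1"
  obtains B c :: real where "B > 0" "c > 0"
    "\<And>t. 0 < t \<Longrightarrow> t \<le> D \<Longrightarrow> \<exists>l N. l \<ge> ln r' \<and> N \<ge> (1::nat) \<and> c * l \<le> real N \<and> real N \<le> c * l + 1 \<and>
       (\<forall>n<N. M * L ^ n * t powr \<beta> \<le> B * exp (- (\<beta> / 2) * l)) \<and> (\<forall>\<alpha>'. log_modulus r' \<alpha>' t = l powr (- \<alpha>'))"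
proof -
  define c where "c = \<beta> / (2 * ln L)"
  define B where "B = M * L * (D * r') powr \<beta>"
  have lL: "ln L > 0" using L by simp
  have c: "c > 0" unfolding c_def using lL \<beta> by simp
  have B: "B > 0" unfolding B_def using M L D r by simp
  show thesis
  proof (rule that[OF B c])
    fix t :: real assume t: "0 < t" "t \<le> D"
    define l where "l = ln (r' / min t 1)"
    define N where "N = nat \<lceil>c * l\<rceil>"
    have l: "l \<ge> ln r'" unfolding l_def using t r
      by (intro iffD2[OF ln_le_cancel_iff]) (auto simp: field_simps min_def)
    have lpos: "l > 0" using l r by (smt (verit) ln_gt_zero)
    have cl: "c * l > 0" using c lpos by simp
    then have N: "N \<ge> 1" "c * l \<le> real N" "real N \<le> c * l + 1"
      unfolding N_def by linarith+
    have mt: "min t 1 = r' * exp (- l)"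
      unfolding l_def using t r by (simp add: exp_minus)
    have "t \<le> D * min t 1" using t D by (cases "t \<le> 1") (auto simp: min_def mult_le_cancel_right1)
    then have tl: "t \<le> D * r' * exp (- l)" unfolding mt by (simp add: mult.assoc)
    have "M * L ^ n * t powr \<beta> \<le> B * exp (- (\<beta> / 2) * l)" if n: "n < N" for n
    proof -
      have "L ^ n \<le> L ^ N" using L n by (intro power_increasing) auto
      also have "L ^ N = exp (real N * ln L)" using L by (simp add: exp_of_nat_mult)
      also have "\<dots> \<le> exp ((c * l + 1) * ln L)" using N(3) lL by (simp add: mult_right_mono)
      also have "\<dots> = L * exp (\<beta> / 2 * l)"
        using L lL by (simp add: c_def exp_add distrib_right)
      finally have 1: "L ^ n \<le> L * exp (\<beta> / 2 * l)" .
      have "t powr \<beta> \<le> (D * r' * exp (- l)) powr \<beta>" using t tl \<beta> by (intro powr_mono2) auto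
      also have "\<dots> = (D * r') powr \<beta> * exp (- \<beta> * l)" using D r by (simp add: powr_mult powr_def[of "exp _"])
      finally have 2: "t powr \<beta> \<le> (D * r') powr \<beta> * exp (- \<beta> * l)" .
      have "M * L ^ n * t powr \<beta> \<le> M * (L * exp (\<beta> / 2 * l)) * ((D * r') powr \<beta> * exp (- \<beta> * l))"
        using 1 2 M L by (intro mult_mono) auto
      also have "\<dots> = B * (exp (\<beta> / 2 * l) * exp (- \<beta> * l))" by (simp add: B_def mult_ac)
      also have "exp (\<beta> / 2 * l) * exp (- \<beta> * l) = exp (- (\<beta> / 2) * l)"
        unfolding exp_add[symmetric] by (simp add: algebra_simps)
      finally show ?thesis .
    qed
    moreover have "log_modulus r' \<alpha>' t = l powr (- \<alpha>')" for \<alpha>'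
      using t by (simp add: log_modulus_def l_def)
    ultimately show "\<exists>l N. l \<ge> ln r' \<and> N \<ge> (1::nat) \<and> c * l \<le> real N \<and> real N \<le> c * l + 1 \<and>
       (\<forall>n<N. M * L ^ n * t powr \<beta> \<le> B * exp (- (\<beta> / 2) * l)) \<and> (\<forall>\<alpha>'. log_modulus r' \<alpha>' t = l powr (- \<alpha>'))"
      using l N by blast
  qed
qed

text \<open>The first part decays exponentially in l, while the tail of the series of n^(- \<alpha> d) is of order
N^(1 - \<alpha> d), and N is of order l.\<close>

lemma criterion_polynomial:
  assumes L: "L > 1" and M: "M \<ge> 1" and \<beta>: "0 < \<beta>" and D: "D \<ge> 1" and r: "r' > 1"
    and d: "d > 0" and \<alpha>: "0 < \<alpha>" "\<alpha> * d > 1" and C: "C > 0" and a: "\<And>n. n \<ge> 1 \<Longrightarrow> a n = C * real n powr (- d)"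
  shows "regularity_criterion (pow_modulus \<alpha>) (log_modulus r' (\<alpha> * d - 1)) a L M \<beta> D"
proof -
  define q where "q = \<alpha> * d - 1"
  have q: "q > 0" using \<alpha> by (simp add: q_def)
  obtain B c where Bc: "B > 0" "c > 0" and sc: "\<And>t. 0 < t \<Longrightarrow> t \<le> D \<Longrightarrow> \<exists>l N. l \<ge> ln r' \<and> N \<ge> (1::nat) \<and> c * l \<le> real N \<and> real N \<le> c * l + 1 \<and>
       (\<forall>n<N. M * L ^ n * t powr \<beta> \<le> B * exp (- (\<beta> / 2) * l)) \<and> (\<forall>\<alpha>'. log_modulus r' \<alpha>' t = l powr (- \<alpha>'))"
    by (rule log_scale[OF L M \<beta> D r]) (rule that, assumption+)
  have l0: "ln r' > 0" using r by simp
  have b: "\<alpha> * (\<beta> / 2) > 0" using \<alpha> \<beta> by simp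
  obtain K1 where K1: "K1 \<ge> 0" "\<And>l. l \<ge> ln r' \<Longrightarrow> (c * l + 1) * exp (- (\<alpha> * (\<beta> / 2)) * l) \<le> K1 * l powr (- q)"
    by (rule exp_decay_bound[OF b Bc(2) l0]) (rule that, assumption+)
  obtain K2 where K2: "K2 \<ge> 0" "\<And>N. N \<ge> 1 \<Longrightarrow> summable (\<lambda>n. real (n + N) powr (- (\<alpha> * d)))"
    "\<And>N. N \<ge> 1 \<Longrightarrow> (\<Sum>n. real (n + N) powr (- (\<alpha> * d))) \<le> K2 * real N powr (1 - \<alpha> * d)"
    by (rule p_series_tail[OF \<alpha>(2)]) (rule that, assumption+)
  have val: "pow_modulus \<alpha> (a (n + N)) = C powr \<alpha> * real (n + N) powr (- (\<alpha> * d))" if "N \<ge> 1" for n N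
    using that C a[of "n + N"] by (simp add: pow_modulus_def powr_mult powr_powr mult.commute)
  show ?thesis
    unfolding regularity_criterion_def q_def[symmetric]
  proof (intro conjI exI[of _ "B powr \<alpha> * K1 + C powr \<alpha> * K2 * c powr (- q)"] allI impI)
    have "summable (\<lambda>n. pow_modulus \<alpha> (a (n + 1)))"
      unfolding val[OF order_refl] by (intro summable_mult K2(2)) simp
    then show "summable (\<lambda>n. pow_modulus \<alpha> (a n))" by (subst (asm) summable_iff_shift)
    show "0 \<le> B powr \<alpha> * K1 + C powr \<alpha> * K2 * c powr (- q)" using K1 K2 by simp
    fix t :: real assume t: "0 < t \<and> t \<le> D"
    then obtain l N where l: "l \<ge> ln r'" and N: "N \<ge> 1" "c * l \<le> real N" "real N \<le> c * l + 1"
      and small: "\<And>n. n < N \<Longrightarrow> M * L ^ n * t powr \<beta> \<le> B * exp (- (\<beta> / 2) * l)"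
      and lm: "\<And>\<alpha>'. log_modulus r' \<alpha>' t = l powr (- \<alpha>')" using sc[of t] by auto
    have lpos: "l > 0" using l l0 by simp
    have "(\<Sum>n<N. pow_modulus \<alpha> (M * L ^ n * t powr \<beta>)) \<le> (\<Sum>n<N. (B * exp (- (\<beta> / 2) * l)) powr \<alpha>)"
      unfolding pow_modulus_def using small \<alpha> M L by (intro sum_mono powr_mono2) auto
    also have "\<dots> = B powr \<alpha> * (real N * exp (- (\<alpha> * (\<beta> / 2)) * l))"
      using Bc by (simp add: powr_mult powr_def[of "exp _"] mult_ac)
    also have "\<dots> \<le> B powr \<alpha> * ((c * l + 1) * exp (- (\<alpha> * (\<beta> / 2)) * l))"
      using N(3) by (intro mult_left_mono mult_right_mono) auto
    also have "\<dots> \<le> B powr \<alpha> * (K1 * l powr (- q))" by (intro mult_left_mono K1(2) l) auto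
    finally have 1: "(\<Sum>n<N. pow_modulus \<alpha> (M * L ^ n * t powr \<beta>)) \<le> B powr \<alpha> * K1 * l powr (- q)"
      by (simp add: mult.assoc)
    have "(\<Sum>n. pow_modulus \<alpha> (a (n + N))) = C powr \<alpha> * (\<Sum>n. real (n + N) powr (- (\<alpha> * d)))"
      unfolding val[OF N(1)] by (rule suminf_mult[OF K2(2)[OF N(1)]])
    also have "\<dots> \<le> C powr \<alpha> * (K2 * real N powr (- q))"
      using K2(3)[OF N(1)] by (intro mult_left_mono) (auto simp: q_def)
    also have "real N powr (- q) \<le> (c * l) powr (- q)"
      using N Bc lpos q by (intro powr_mono2') auto
    also have "(c * l) powr (- q) = c powr (- q) * l powr (- q)" using Bc lpos by (simp add: powr_mult)
    finally have 2: "(\<Sum>n. pow_modulus \<alpha> (a (n + N))) \<le> C powr \<alpha> * K2 * c powr (- q) * l powr (- q)"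
      using K2(1) by (simp add: mult_left_mono mult.assoc)
    show "\<exists>N\<ge>1. (\<Sum>n<N. pow_modulus \<alpha> (M * L ^ n * t powr \<beta>)) + (\<Sum>n. pow_modulus \<alpha> (a (n + N)))
         \<le> (B powr \<alpha> * K1 + C powr \<alpha> * K2 * c powr (- q)) * log_modulus r' q t"
      using add_mono[OF 1 2] N(1) unfolding lm by (intro exI[of _ N]) (simp add: distrib_right)
  qed
qed

text \<open>Each of the first N terms is of order l^(- \<alpha>), and so is the n-th term of the tail with n in place of
l. As N is of order l, both parts are of order l^(1 - \<alpha>), which is at most of order l^(- (\<alpha> - 1) / 2).\<close>

lemma criterion_logarithmic:
  assumes L: "L > 1" and M: "M \<ge> 1" and \<beta>: "0 < \<beta>" and D: "D \<ge> 1" and r: "r > 1" and r': "r' > 1"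
    and \<alpha>: "\<alpha> > 1" and \<theta>: "0 < \<theta>" "\<theta> < 1" and C: "C > 0" and mod: "is_modulus (log_modulus r \<alpha>)"
  shows "regularity_criterion (log_modulus r \<alpha>) (log_modulus r' ((\<alpha> - 1) / 2)) (\<lambda>n. C * \<theta> ^ n) L M \<beta> D"
proof -
  define q where "q = (\<alpha> - 1) / 2"
  obtain B c where Bc: "B > 0" "c > 0" and sc: "\<And>t. 0 < t \<Longrightarrow> t \<le> D \<Longrightarrow> \<exists>l N. l \<ge> ln r' \<and> N \<ge> (1::nat) \<and> c * l \<le> real N \<and> real N \<le> c * l + 1 \<and>
       (\<forall>n<N. M * L ^ n * t powr \<beta> \<le> B * exp (- (\<beta> / 2) * l)) \<and> (\<forall>\<alpha>'. log_modulus r' \<alpha>' t = l powr (- \<alpha>'))"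
    by (rule log_scale[OF L M \<beta> D r']) (rule that, assumption+)
  have l0: "ln r' > 0" using r' by simp
  have \<alpha>0: "\<alpha> > 0" using \<alpha> by simp
  have b: "\<beta> / 2 > 0" using \<beta> by simp
  obtain K1 where K1: "K1 \<ge> 0" "\<And>l. l \<ge> ln r' \<Longrightarrow> log_modulus r \<alpha> (B * exp (- (\<beta> / 2) * l)) \<le> K1 * l powr (- \<alpha>)"
    by (rule log_modulus_exp[OF r \<alpha>0 b Bc(1) l0]) (rule that, assumption+)
  obtain K2 where K2: "K2 \<ge> 0" "\<And>N. N \<ge> 1 \<Longrightarrow> summable (\<lambda>n. real (n + N) powr (- \<alpha>))"
    "\<And>N. N \<ge> 1 \<Longrightarrow> (\<Sum>n. real (n + N) powr (- \<alpha>)) \<le> K2 * real N powr (1 - \<alpha>)"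
    by (rule p_series_tail[OF \<alpha>]) (rule that, assumption+)
  have l\<theta>: "- ln \<theta> > 0" using \<theta> by simp
  obtain K3 where K3: "K3 \<ge> 0" "\<And>l. l \<ge> 1 \<Longrightarrow> log_modulus r \<alpha> (C * exp (- (- ln \<theta>) * l)) \<le> K3 * l powr (- \<alpha>)"
    by (rule log_modulus_exp[OF r \<alpha>0 l\<theta> C zero_less_one]) (rule that, assumption+)
  have nonneg: "log_modulus r \<alpha> x \<ge> 0" for x by (simp add: log_modulus_def)
  have le: "log_modulus r \<alpha> (C * \<theta> ^ (n + N)) \<le> K3 * real (n + N) powr (- \<alpha>)" if "N \<ge> 1" for n N
  proof -
    have "\<theta> ^ (n + N) = exp (- (- ln \<theta>) * real (n + N))"
      using \<theta> by (simp add: powr_realpow[symmetric] powr_def mult.commute)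
    then show ?thesis using K3(2)[of "real (n + N)"] that by simp
  qed
  have sm: "summable (\<lambda>n. log_modulus r \<alpha> (C * \<theta> ^ (n + N)))" if "N \<ge> 1" for N
    by (rule summable_comparison_test'[OF summable_mult[OF K2(2)[OF that]], of 0 _ K3]) (use le[OF that] nonneg in simp)
  have mono: "log_modulus r \<alpha> x \<le> log_modulus r \<alpha> y" if "0 \<le> x" "x \<le> y" for x y
    using mod that unfolding is_modulus_def by (auto intro: mono_onD)
  define K where "K = K1 * (c + 1 / ln r') + K3 * K2 * c powr (1 - \<alpha>)"
  have K: "K \<ge> 0" unfolding K_def using K1 K2 K3 Bc l0 by simp
  show ?thesis
    unfolding regularity_criterion_def q_def[symmetric]
  proof (intro conjI exI[of _ "K * ln r' powr (q - (\<alpha> - 1))"] allI impI)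
    show "summable (\<lambda>n. log_modulus r \<alpha> (C * \<theta> ^ n))"
      using sm[OF order_refl] summable_iff_shift[of "\<lambda>n. log_modulus r \<alpha> (C * \<theta> ^ n)" 1] by simp
    show "0 \<le> K * ln r' powr (q - (\<alpha> - 1))" using K by simp
    fix t :: real assume t: "0 < t \<and> t \<le> D"
    then obtain l N where l: "l \<ge> ln r'" and N: "N \<ge> 1" "c * l \<le> real N" "real N \<le> c * l + 1"
      and small: "\<And>n. n < N \<Longrightarrow> M * L ^ n * t powr \<beta> \<le> B * exp (- (\<beta> / 2) * l)"
      and lm: "\<And>\<alpha>'. log_modulus r' \<alpha>' t = l powr (- \<alpha>')" using sc[of t] by auto
    have lpos: "l > 0" using l l0 by simp
    have lp: "l * l powr (- \<alpha>) = l powr (1 - \<alpha>)" using lpos by (simp add: powr_diff powr_minus divide_simps)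
    have "(\<Sum>n<N. log_modulus r \<alpha> (M * L ^ n * t powr \<beta>)) \<le> (\<Sum>n<N. K1 * l powr (- \<alpha>))"
    proof (rule sum_mono)
      fix n assume "n \<in> {..<N}"
      then have "log_modulus r \<alpha> (M * L ^ n * t powr \<beta>) \<le> log_modulus r \<alpha> (B * exp (- (\<beta> / 2) * l))"
        using small M L by (intro mono) auto
      also have "\<dots> \<le> K1 * l powr (- \<alpha>)" by (rule K1(2)[OF l])
      finally show "log_modulus r \<alpha> (M * L ^ n * t powr \<beta>) \<le> K1 * l powr (- \<alpha>)" .
    qed
    also have "\<dots> = real N * (K1 * l powr (- \<alpha>))" by simp
    also have "\<dots> \<le> ((c + 1 / ln r') * l) * (K1 * l powr (- \<alpha>))"
    proof (rule mult_right_mono)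
      have "1 \<le> 1 / ln r' * l" using l l0 by (simp add: field_simps)
      then show "real N \<le> (c + 1 / ln r') * l" using N(3) by (simp add: distrib_right)
    qed (use K1 in simp)
    also have "\<dots> = K1 * (c + 1 / ln r') * (l * l powr (- \<alpha>))" by (simp add: mult_ac)
    finally have 1: "(\<Sum>n<N. log_modulus r \<alpha> (M * L ^ n * t powr \<beta>)) \<le> K1 * (c + 1 / ln r') * l powr (1 - \<alpha>)"
      unfolding lp .
    have "(\<Sum>n. log_modulus r \<alpha> (C * \<theta> ^ (n + N))) \<le> (\<Sum>n. K3 * real (n + N) powr (- \<alpha>))"
      by (rule suminf_le[OF le[OF N(1)] sm[OF N(1)] summable_mult[OF K2(2)[OF N(1)]]])
    also have "\<dots> = K3 * (\<Sum>n. real (n + N) powr (- \<alpha>))" by (rule suminf_mult[OF K2(2)[OF N(1)]])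
    also have "\<dots> \<le> K3 * (K2 * real N powr (1 - \<alpha>))" by (intro mult_left_mono K2(3) N(1) K3(1))
    also have "\<dots> \<le> K3 * (K2 * (c * l) powr (1 - \<alpha>))"
      using N Bc lpos \<alpha> by (intro mult_left_mono K2(1) K3(1) powr_mono2') auto
    also have "(c * l) powr (1 - \<alpha>) = c powr (1 - \<alpha>) * l powr (1 - \<alpha>)" using Bc lpos by (simp add: powr_mult)
    finally have 2: "(\<Sum>n. log_modulus r \<alpha> (C * \<theta> ^ (n + N))) \<le> K3 * K2 * c powr (1 - \<alpha>) * l powr (1 - \<alpha>)"
      by (simp add: mult.assoc)
    have "(\<Sum>n<N. log_modulus r \<alpha> (M * L ^ n * t powr \<beta>)) + (\<Sum>n. log_modulus r \<alpha> (C * \<theta> ^ (n + N))) \<le> K * l powr (- (\<alpha> - 1))"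
      using add_mono[OF 1 2] by (simp add: K_def distrib_right)
    also have "\<dots> \<le> K * (ln r' powr (q - (\<alpha> - 1)) * l powr (- q))"
      using l l0 \<alpha> by (intro mult_left_mono K powr_neg_le) (auto simp: q_def)
    finally show "\<exists>N\<ge>1. (\<Sum>n<N. log_modulus r \<alpha> (M * L ^ n * t powr \<beta>)) + (\<Sum>n. log_modulus r \<alpha> (C * \<theta> ^ (n + N)))
         \<le> K * ln r' powr (q - (\<alpha> - 1)) * log_modulus r' q t"
      using N(1) unfolding lm by (intro exI[of _ N]) (simp add: mult.assoc)
  qed
qed

section \<open>Regularity of the induced functions\<close>

text \<open>The properties of moduli on which the regularity estimates rest. They are immediate for powers.\<close>

definition weak_modulus :: "(real \<Rightarrow> real) \<Rightarrow> bool" where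
  "weak_modulus \<omega> \<longleftrightarrow> (\<forall>x\<ge>0. 0 \<le> \<omega> x) \<and> mono_on {0..} \<omega> \<and> \<omega> 0 = 0 \<and> (\<omega> \<longlongrightarrow> 0) (at_right 0)"

lemma weak_modulus_nonneg: "weak_modulus \<omega> \<Longrightarrow> 0 \<le> x \<Longrightarrow> 0 \<le> \<omega> x"
  by (simp add: weak_modulus_def)

lemma weak_modulus_mono: "weak_modulus \<omega> \<Longrightarrow> 0 \<le> x \<Longrightarrow> x \<le> y \<Longrightarrow> \<omega> x \<le> \<omega> y"
  unfolding weak_modulus_def by (auto intro: mono_onD)

lemma weak_modulus_small:
  assumes "weak_modulus \<omega>" "e > 0"
  obtains d where "d > 0" "\<And>x. 0 \<le> x \<Longrightarrow> x < d \<Longrightarrow> \<omega> x < e"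
proof -
  have "eventually (\<lambda>x. \<omega> x < e) (at_right 0)"
    using assms unfolding weak_modulus_def by (auto intro: order_tendstoD)
  then obtain d where "d > 0" "\<And>x. 0 < x \<Longrightarrow> x < d \<Longrightarrow> \<omega> x < e"
    unfolding eventually_at_right_field by auto
  moreover have "\<omega> 0 < e" using assms by (simp add: weak_modulus_def)
  ultimately show thesis by (intro that[of d]) (auto simp: le_less)
qed

lemma weak_modulus_pow:
  assumes "\<alpha> > 0" shows "weak_modulus (pow_modulus \<alpha>)"
  unfolding weak_modulus_def
proof (intro conjI allI impI)
  show "mono_on {0..} (pow_modulus \<alpha>)"
    unfolding pow_modulus_def using assms by (intro mono_onI powr_mono2) auto
  show "(pow_modulus \<alpha> \<longlongrightarrow> 0) (at_right 0)"
    unfolding pow_modulus_def[abs_def] using assms by real_asymp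
qed (auto simp: pow_modulus_def)

lemma weak_modulus_is_modulus:
  assumes "is_modulus \<omega>" shows "weak_modulus \<omega>"
proof -
  have "continuous_on {0..} \<omega>" "\<omega> 0 = 0" using assms by (auto simp: is_modulus_def)
  then have "\<forall>x\<in>{0..}. (\<omega> \<longlongrightarrow> \<omega> x) (at x within {0..})" unfolding continuous_on_def by simp
  then have "(\<omega> \<longlongrightarrow> \<omega> 0) (at 0 within {0..})" by (rule bspec) simp
  then have "(\<omega> \<longlongrightarrow> \<omega> 0) (at_right 0)"
    by (rule tendsto_within_subset) auto
  then have "(\<omega> \<longlongrightarrow> 0) (at_right 0)" unfolding \<open>\<omega> 0 = 0\<close> .
  then show ?thesis using assms by (auto simp: weak_modulus_def is_modulus_def)
qed

text \<open>The infimum that defines the constant is attained.\<close>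

lemma Hol_const_bound:
  assumes \<omega>: "weak_modulus \<omega>" and f: "f \<in> Hol_space \<omega>"
  shows "0 \<le> Hol_const \<omega> f" "\<bar>f x - f x'\<bar> \<le> Hol_const \<omega> f * \<omega> (dist x x')"
proof -
  let ?S = "{C. 0 \<le> C \<and> (\<forall>x x'. \<bar>f x - f x'\<bar> \<le> C * \<omega> (dist x x'))}"
  obtain C where C: "\<And>x x'. \<bar>f x - f x'\<bar> \<le> C * \<omega> (dist x x')"
    using f unfolding Hol_space_def mod_continuous_def dist_real_def by auto
  have "\<bar>f x - f x'\<bar> \<le> max 0 C * \<omega> (dist x x')" for x x'
    by (rule order_trans[OF C mult_right_mono]) (simp_all add: weak_modulus_nonneg[OF \<omega>])
  then have ne: "?S \<noteq> {}" by (intro exI[of _ "max 0 C"] ex_in_conv[THEN iffD1]) auto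
  show "0 \<le> Hol_const \<omega> f" unfolding Hol_const_def using ne by (intro cInf_greatest) auto
  show "\<bar>f x - f x'\<bar> \<le> Hol_const \<omega> f * \<omega> (dist x x')"
  proof (cases "\<omega> (dist x x') = 0")
    case True
    then show ?thesis using C[of x x'] by simp
  next
    case False
    then have pos: "\<omega> (dist x x') > 0" using weak_modulus_nonneg[OF \<omega>, of "dist x x'"] by simp
    have "\<bar>f x - f x'\<bar> / \<omega> (dist x x') \<le> Hol_const \<omega> f"
      unfolding Hol_const_def using ne pos by (intro cInf_greatest) (auto simp: field_simps)
    then show ?thesis using pos by (simp add: field_simps)
  qed
qed

lemma Hol_norm_le:
  assumes "\<And>x. \<bar>f x\<bar> \<le> B" "0 \<le> C" "\<And>x x'. \<bar>f x - f x'\<bar> \<le> C * \<omega> (dist x x')"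
  shows "f \<in> Hol_space \<omega>" "Hol_norm \<omega> f \<le> B + C"
proof -
  show "f \<in> Hol_space \<omega>" using assms(3) unfolding Hol_space_def mod_continuous_def dist_real_def by auto
  have "(SUP x. \<bar>f x\<bar>) \<le> B" by (rule cSUP_least) (use assms in auto)
  moreover have "Hol_const \<omega> f \<le> C"
    unfolding Hol_const_def using assms by (intro cInf_lower bdd_belowI[of _ 0]) auto
  ultimately show "Hol_norm \<omega> f \<le> B + C" unfolding Hol_norm_def by simp
qed

lemma Hol_continuous:
  assumes \<omega>: "weak_modulus \<omega>" and f: "f \<in> Hol_space \<omega>"
  shows "continuous_on UNIV f"
  unfolding continuous_on_iff
proof (intro ballI allI impI)
  fix x :: 'a and e :: real assume e: "e > 0"
  let ?H = "Hol_const \<omega> f"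
  have H: "?H \<ge> 0" by (rule Hol_const_bound(1)[OF \<omega> f])
  have "e / (?H + 1) > 0" using e H by simp
  then obtain d where d: "d > 0" "\<And>x. 0 \<le> x \<Longrightarrow> x < d \<Longrightarrow> \<omega> x < e / (?H + 1)"
    using weak_modulus_small[OF \<omega>] by blast
  have "dist (f x') (f x) < e" if "dist x' x < d" for x'
  proof -
    have w: "0 \<le> \<omega> (dist x' x)" "\<omega> (dist x' x) < e / (?H + 1)" using d that weak_modulus_nonneg[OF \<omega>] by auto
    have "\<bar>f x' - f x\<bar> \<le> ?H * \<omega> (dist x' x)" by (rule Hol_const_bound(2)[OF \<omega> f])
    also have "\<dots> \<le> (?H + 1) * \<omega> (dist x' x)" using w by (intro mult_right_mono) auto
    also have "\<dots> < e" using w(2) H by (simp add: field_simps)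
    finally show ?thesis by (simp add: dist_real_def)
  qed
  then show "\<exists>d>0. \<forall>x'\<in>UNIV. dist x' x < d \<longrightarrow> dist (f x') (f x) < e" using d(1) by auto
qed

lemma (in shrinking_extension) abs_le_SUP:
  fixes f :: "'x \<Rightarrow> real"
  assumes "continuous_on UNIV f"
  shows "\<bar>f x\<bar> \<le> (SUP x. \<bar>f x\<bar>)"
proof -
  obtain C where "\<And>x. \<bar>f x\<bar> \<le> C" using continuous_bounded[OF assms] by blast
  then show ?thesis by (intro cSUP_upper bdd_aboveI[of _ C]) auto
qed

text \<open>The quantitative hypotheses, with all constants enlarged to be at least 1. The Lipschitz constant L
of T need not be optimal, so that it can be assumed to exceed 1 where this helps.\<close>

locale regular_extension = shrinking_extension T S p \<sigma> a
  for T :: "'x::metric_space \<Rightarrow> 'x" and S :: "'y::metric_space \<Rightarrow> 'y"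
    and p :: "'x \<Rightarrow> 'y" and \<sigma> :: "'y \<Rightarrow> 'x" and a :: "nat \<Rightarrow> real" +
  fixes L K P \<beta> D :: real
  assumes L: "L \<ge> 1" and T_lip: "dist (T x) (T x') \<le> L * dist x x'"
    and K: "K \<ge> 1" and \<sigma>_lip: "dist (\<sigma> y) (\<sigma> y') \<le> K * dist y y'"
    and P: "P \<ge> 1" and p_hol: "dist (p x) (p x') \<le> P * dist x x' powr \<beta>"
    and \<beta>: "0 < \<beta>" "\<beta> \<le> 1" and D: "D \<ge> 1" and diam: "dist (y :: 'y) y' \<le> D"
begin

lemma T_pow_lip: "dist ((T ^^ n) x) ((T ^^ n) x') \<le> L ^ n * dist x x'"
proof (induction n)
  case (Suc n)
  have "dist ((T ^^ Suc n) x) ((T ^^ Suc n) x') \<le> L * dist ((T ^^ n) x) ((T ^^ n) x')" using T_lip by simp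
  also have "\<dots> \<le> L * (L ^ n * dist x x')" using Suc L by (intro mult_left_mono) auto
  finally show ?case by (simp add: mult.assoc)
qed simp

definition M :: real where "M = K * P * (L * K) powr \<beta> + L * K * D"

lemma M_ge_1: "M \<ge> 1"
proof -
  have "1 * 1 * 1 \<le> L * K * D" using L K D by (intro mult_mono) auto
  moreover have "0 \<le> K * P * (L * K) powr \<beta>" using K P by (intro mult_nonneg_nonneg) auto
  ultimately show ?thesis unfolding M_def by linarith
qed

text \<open>The base map satisfies S = p o T o \<sigma>, hence is Hoelder of exponent \<beta>; the first estimate thus
loses the exponent \<beta> once, whatever n is. The other two are stated with the same exponent, by
boundedness of the base, in order to have a single bound.\<close>

lemma orbit_distances:
  "dist ((T ^^ n) (\<sigma> (S y))) ((T ^^ n) (\<sigma> (S y'))) \<le> M * L ^ n * dist y y' powr \<beta>"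
  "dist ((T ^^ n) (T (\<sigma> y))) ((T ^^ n) (T (\<sigma> y'))) \<le> M * L ^ n * dist y y' powr \<beta>"
  "dist (\<sigma> y) (\<sigma> y') \<le> M * dist y y' powr \<beta>"
proof -
  let ?t = "dist y y'"
  have Ln: "0 \<le> L ^ n" using L by simp
  have T\<sigma>: "dist (T (\<sigma> y)) (T (\<sigma> y')) \<le> L * K * ?t"
    unfolding mult.assoc by (rule order_trans[OF T_lip mult_left_mono[OF \<sigma>_lip]]) (use L in simp)
  have "S y = p (T (\<sigma> y))" for y by (simp add: equivariant sect)
  then have "dist (S y) (S y') \<le> P * dist (T (\<sigma> y)) (T (\<sigma> y')) powr \<beta>" using p_hol by simp
  also have "\<dots> \<le> P * (L * K * ?t) powr \<beta>" using T\<sigma> P \<beta> by (intro mult_left_mono powr_mono2) auto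
  also have "\<dots> = P * (L * K) powr \<beta> * ?t powr \<beta>" using L K by (simp add: powr_mult mult.assoc)
  finally have Sd: "dist (S y) (S y') \<le> P * (L * K) powr \<beta> * ?t powr \<beta>" .
  have tb: "?t \<le> D * ?t powr \<beta>"
  proof (cases "?t = 0")
    case False
    then have t: "?t > 0" by simp
    have "?t powr (1 - \<beta>) \<le> D powr (1 - \<beta>)" using t diam \<beta> by (intro powr_mono2) auto
    also have "\<dots> \<le> D powr 1" using D \<beta> by (intro powr_mono) auto
    finally have "?t powr (1 - \<beta>) \<le> D" using D by simp
    then have "?t powr (1 - \<beta>) * ?t powr \<beta> \<le> D * ?t powr \<beta>" by (intro mult_right_mono) auto
    then show ?thesis using t by (simp add: powr_add[symmetric])
  qed simp
  have "dist ((T ^^ n) (\<sigma> (S y))) ((T ^^ n) (\<sigma> (S y'))) \<le> L ^ n * dist (\<sigma> (S y)) (\<sigma> (S y'))" by (rule T_pow_lip)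
  also have "\<dots> \<le> L ^ n * (K * (P * (L * K) powr \<beta> * ?t powr \<beta>))"
    using order_trans[OF \<sigma>_lip mult_left_mono[OF Sd]] K by (intro mult_left_mono Ln) auto
  also have "\<dots> \<le> M * L ^ n * ?t powr \<beta>"
    unfolding M_def using L K D Ln by (simp add: distrib_right distrib_left mult_ac)
  finally show "dist ((T ^^ n) (\<sigma> (S y))) ((T ^^ n) (\<sigma> (S y'))) \<le> M * L ^ n * dist y y' powr \<beta>" .
  have LK: "L * K * ?t \<le> M * ?t powr \<beta>"
  proof -
    have "L * K * ?t \<le> L * K * (D * ?t powr \<beta>)" using tb L K by (intro mult_left_mono) auto
    also have "\<dots> = (L * K * D) * ?t powr \<beta>" by (simp add: mult_ac)
    also have "\<dots> \<le> M * ?t powr \<beta>"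
      unfolding M_def by (intro mult_right_mono) (use K P in auto)
    finally show ?thesis .
  qed
  have "dist ((T ^^ n) (T (\<sigma> y))) ((T ^^ n) (T (\<sigma> y'))) \<le> L ^ n * dist (T (\<sigma> y)) (T (\<sigma> y'))" by (rule T_pow_lip)
  also have "\<dots> \<le> L ^ n * (M * ?t powr \<beta>)" using T\<sigma> LK by (intro mult_left_mono Ln) auto
  finally show "dist ((T ^^ n) (T (\<sigma> y))) ((T ^^ n) (T (\<sigma> y'))) \<le> M * L ^ n * dist y y' powr \<beta>"
    by (simp add: mult_ac)
  have "dist (\<sigma> y) (\<sigma> y') \<le> 1 * (K * ?t)" using \<sigma>_lip by simp
  also have "\<dots> \<le> L * (K * ?t)" using L K by (intro mult_right_mono) auto
  finally show "dist (\<sigma> y) (\<sigma> y') \<le> M * dist y y' powr \<beta>" using LK by (simp add: mult.assoc)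
qed

text \<open>The transfer function vanishes on the image of \<sigma>. The points \<sigma> (S y) and T (\<sigma> y) lie in the same
fiber.\<close>

lemma check_eq: "check f y = f (\<sigma> y) - (\<Sum>n. f ((T ^^ n) (\<sigma> (S y))) - f ((T ^^ n) (T (\<sigma> y))))"
  by (simp add: check_fun_def hat_fun_def transfer_fun_def sect equivariant)

text \<open>In the series of \<open>check_eq\<close>, the difference of the n-th terms at y and y' is at most twice
\<omega> (M L^n t^\<beta>), by comparing the orbits over y with those over y', and also at most twice \<omega> (a n),
by comparing the two orbits in the same fiber; here t is the distance of y and y'. The first bound is
used for n < N, the second one for n \<ge> N.\<close>

lemma check_regularity:
  assumes \<omega>: "weak_modulus \<omega>" and crit: "regularity_criterion \<omega> \<omega>' a L M \<beta> D" and \<omega>': "\<omega>' 0 \<ge> 0"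
  obtains Q where "Q > 0" "\<And>f. f \<in> Hol_space \<omega> \<Longrightarrow> fiber_summable f \<and> check f \<in> Hol_space \<omega>' \<and> Hol_norm \<omega>' (check f) \<le> Q * Hol_norm \<omega> f"
proof -
  obtain R where sm: "summable (\<lambda>n. \<omega> (a n))" and R: "R \<ge> 0" "\<And>t. 0 < t \<Longrightarrow> t \<le> D \<Longrightarrow> \<exists>N\<ge>1.
        (\<Sum>n<N. \<omega> (M * L ^ n * t powr \<beta>)) + (\<Sum>n. \<omega> (a (n + N))) \<le> R * \<omega>' t"
    using crit unfolding regularity_criterion_def by auto
  define A where "A = (\<Sum>n. \<omega> (a n))"
  have an: "0 \<le> \<omega> (a n)" for n by (rule weak_modulus_nonneg[OF \<omega> shrink_nonneg])
  have A: "A \<ge> 0" unfolding A_def by (rule suminf_nonneg[OF sm an])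
  show thesis
  proof (rule that[of "1 + A + 3 * R"])
    show "1 + A + 3 * R > 0" using A R by simp
    fix f :: "'x \<Rightarrow> real" assume f: "f \<in> Hol_space \<omega>"
    define H where "H = Hol_const \<omega> f"
    have H: "H \<ge> 0" and Hb: "\<bar>f x - f x'\<bar> \<le> H * \<omega> (dist x x')" for x x'
      unfolding H_def using Hol_const_bound[OF \<omega> f] by auto
    have Hd: "\<bar>f x - f x'\<bar> \<le> H * \<omega> d" if "dist x x' \<le> d" for x x' d
      using order_trans[OF Hb mult_left_mono[OF weak_modulus_mono[OF \<omega> _ that] H]] by simp
    have fc: "continuous_on UNIV f" by (rule Hol_continuous[OF \<omega> f])
    have smH: "summable (\<lambda>n. H * \<omega> (a n))" by (rule summable_mult[OF sm])
    have fs: "fiber_summable f"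
      unfolding fiber_summable_def using fc smH Hd[OF near_section] by blast
    define u where "u y n = f ((T ^^ n) (\<sigma> (S y))) - f ((T ^^ n) (T (\<sigma> y)))" for y n
    have ua: "\<bar>u y n\<bar> \<le> H * \<omega> (a n)" for y n
      unfolding u_def by (intro Hd shrink) (simp add: sect equivariant)
    have su: "summable (u y)" for y by (rule summable_comparison_test'[OF smH, of 0]) (simp add: ua)
    define F where "F = (SUP x. \<bar>f x\<bar>)"
    have F: "\<bar>f x\<bar> \<le> F" for x unfolding F_def by (rule abs_le_SUP[OF fc])
    have F0: "F \<ge> 0" using F[of undefined] by linarith
    have chk: "check f y = f (\<sigma> y) - suminf (u y)" for y by (simp add: check_eq u_def[abs_def])
    have bound: "\<bar>check f y\<bar> \<le> F + H * A" for y
    proof -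
      have "\<bar>suminf (u y)\<bar> \<le> (\<Sum>n. H * \<omega> (a n))"
        using norm_suminf_le[of "u y" "\<lambda>n. H * \<omega> (a n)"] ua smH by simp
      also have "\<dots> = H * A" unfolding A_def by (rule suminf_mult[OF sm])
      finally show ?thesis using F[of "\<sigma> y"] unfolding chk by linarith
    qed
    have hol: "\<bar>check f y - check f y'\<bar> \<le> 3 * R * H * \<omega>' (dist y y')" for y y'
    proof (cases "y = y'")
      case True
      then show ?thesis using R H \<omega>' by simp
    next
      case False
      define t where "t = dist y y'"
      have t: "0 < t" "t \<le> D" using False diam by (auto simp: t_def)
      obtain N where N: "N \<ge> 1" "(\<Sum>n<N. \<omega> (M * L ^ n * t powr \<beta>)) + (\<Sum>n. \<omega> (a (n + N))) \<le> R * \<omega>' t"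
        using R(2)[OF t] by blast
      let ?w = "\<lambda>n. \<omega> (M * L ^ n * t powr \<beta>)"
      have w0: "0 \<le> ?w n" for n using M_ge_1 L by (intro weak_modulus_nonneg[OF \<omega>]) auto
      have d1: "\<bar>u y n - u y' n\<bar> \<le> 2 * H * ?w n" for n
        using Hd[OF orbit_distances(1)[of n y y', folded t_def]] Hd[OF orbit_distances(2)[of n y y', folded t_def]]
        unfolding u_def by linarith
      have d2: "\<bar>f (\<sigma> y) - f (\<sigma> y')\<bar> \<le> H * (\<Sum>n<N. ?w n)"
      proof -
        have "\<bar>f (\<sigma> y) - f (\<sigma> y')\<bar> \<le> H * ?w 0" using Hd[OF orbit_distances(3)[of y y', folded t_def]] by simp
        also have "\<dots> \<le> H * (\<Sum>n<N. ?w n)" 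
          by (intro mult_left_mono H member_le_sum[where i=0 and f="?w"] w0) (use N in auto)
        finally show ?thesis .
      qed
      have sd: "summable (\<lambda>n. u y n - u y' n)" by (rule summable_diff[OF su su])
      have sN: "summable (\<lambda>n. \<omega> (a (n + N)))" using sm by (rule summable_ignore_initial_segment)
      have "suminf (u y) - suminf (u y') = (\<Sum>n. u y n - u y' n)" by (rule suminf_diff[OF su su])
      also have "\<dots> = (\<Sum>n. u y (n + N) - u y' (n + N)) + (\<Sum>n<N. u y n - u y' n)"
        by (rule suminf_split_initial_segment[OF sd])
      finally have split: "suminf (u y) - suminf (u y') = (\<Sum>n. u y (n + N) - u y' (n + N)) + (\<Sum>n<N. u y n - u y' n)" .
      have "\<bar>\<Sum>n<N. u y n - u y' n\<bar> \<le> (\<Sum>n<N. 2 * H * ?w n)"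
        by (rule order_trans[OF sum_abs sum_mono[OF d1]])
      then have i1: "\<bar>\<Sum>n<N. u y n - u y' n\<bar> \<le> 2 * H * (\<Sum>n<N. ?w n)" by (simp add: sum_distrib_left)
      have "\<bar>\<Sum>n. u y (n + N) - u y' (n + N)\<bar> \<le> (\<Sum>n. 2 * H * \<omega> (a (n + N)))"
      proof -
        have "norm (u y (n + N) - u y' (n + N)) \<le> 2 * H * \<omega> (a (n + N))" for n
          using ua[of y "n + N"] ua[of y' "n + N"] unfolding real_norm_def by linarith
        from norm_suminf_le[OF this summable_mult[OF sN]] show ?thesis by simp
      qed
      also have "\<dots> = 2 * H * (\<Sum>n. \<omega> (a (n + N)))" by (rule suminf_mult[OF sN])
      finally have i2: "\<bar>\<Sum>n. u y (n + N) - u y' (n + N)\<bar> \<le> 2 * H * (\<Sum>n. \<omega> (a (n + N)))" .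
      have pos: "0 \<le> H * (\<Sum>n. \<omega> (a (n + N)))" by (intro mult_nonneg_nonneg H suminf_nonneg sN an)
      have "\<bar>check f y - check f y'\<bar> \<le> 3 * (H * (\<Sum>n<N. ?w n)) + 3 * (H * (\<Sum>n. \<omega> (a (n + N))))"
        using split i1 i2 d2 pos unfolding chk by linarith
      also have "\<dots> = 3 * H * ((\<Sum>n<N. ?w n) + (\<Sum>n. \<omega> (a (n + N))))" by (simp add: algebra_simps)
      also have "\<dots> \<le> 3 * H * (R * \<omega>' t)" using N(2) H by (intro mult_left_mono) auto
      finally show ?thesis by (simp add: t_def mult_ac)
    qed
    have RH: "0 \<le> 3 * R * H" using R H by simp
    have mem: "check f \<in> Hol_space \<omega>'"
      by (rule Hol_norm_le(1)) (rule bound, rule RH, rule hol)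
    have "Hol_norm \<omega>' (check f) \<le> (F + H * A) + 3 * R * H"
      by (rule Hol_norm_le(2)) (rule bound, rule RH, rule hol)
    also have "\<dots> \<le> (1 + A + 3 * R) * (F + H)"
    proof -
      have "0 \<le> H + A * F + 3 * (R * F)" using A R(1) F0 H by simp
      moreover have "(1 + A + 3 * R) * (F + H) = F + H * A + 3 * R * H + (H + A * F + 3 * (R * F))"
        by (simp add: algebra_simps)
      ultimately show ?thesis by linarith
    qed
    also have "F + H = Hol_norm \<omega> f" unfolding Hol_norm_def F_def H_def ..
    finally show "fiber_summable f \<and> check f \<in> Hol_space \<omega>' \<and> Hol_norm \<omega>' (check f) \<le> (1 + A + 3 * R) * Hol_norm \<omega> f"
      using fs mem by simp
  qed
qed

end

section \<open>Transfer of equilibrium states\<close>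

lemma ereal_less_of_scaled:
  fixes x y Q :: real and \<rho> :: ereal
  assumes "Q > 0" "0 < \<rho>" "y \<le> Q * x" "ereal x < ereal (1 / Q) * \<rho>"
  shows "ereal y < \<rho>"
proof (cases \<rho>)
  case (real r)
  then have "x < 1 / Q * r" using assms by simp
  then have "Q * x < r" using assms(1) by (simp add: field_simps)
  then show ?thesis using assms(3) real by simp
qed (use assms in auto)

context shrinking_extension
begin

text \<open>Entropy and integrals agree for \<mu> and its projection, and every invariant measure of S is a
projection, so the two variational problems coincide.\<close>

lemma equilibrium_state_project_iff:
  fixes \<phi> :: "'x \<Rightarrow> real" and \<psi> :: "'y \<Rightarrow> real"
  assumes int: "\<And>\<mu>. invariant_prob T \<mu> \<Longrightarrow> (\<integral>x. \<phi> x \<partial>\<mu>) = (\<integral>y. \<psi> y \<partial>distr \<mu> borel p)"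
  shows "equilibrium_state T \<phi> \<mu> \<longleftrightarrow> invariant_prob T \<mu> \<and> equilibrium_state S \<psi> (distr \<mu> borel p)"
proof
  assume eq: "equilibrium_state T \<phi> \<mu>"
  then have \<mu>: "invariant_prob T \<mu>" by (simp add: equilibrium_state_def)
  have "KS_entropy S \<nu> + ereal (\<integral>y. \<psi> y \<partial>\<nu>) \<le> KS_entropy S (distr \<mu> borel p) + ereal (\<integral>y. \<psi> y \<partial>distr \<mu> borel p)"
    if \<nu>: "invariant_prob S \<nu>" for \<nu>
  proof -
    obtain \<mu>' where "invariant_prob T \<mu>'" "distr \<mu>' borel p = \<nu>" by (rule invariant_lift_exists[OF \<nu>])
    then show ?thesis
      using eq KS_entropy_project[of \<mu>'] KS_entropy_project[OF \<mu>] int[of \<mu>'] int[OF \<mu>]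
      unfolding equilibrium_state_def by auto
  qed
  then show "invariant_prob T \<mu> \<and> equilibrium_state S \<psi> (distr \<mu> borel p)"
    using \<mu> project_invariant[OF \<mu>] by (simp add: equilibrium_state_def)
next
  assume R: "invariant_prob T \<mu> \<and> equilibrium_state S \<psi> (distr \<mu> borel p)"
  show "equilibrium_state T \<phi> \<mu>"
    unfolding equilibrium_state_def
  proof (intro conjI allI impI)
    fix \<mu>' assume \<mu>': "invariant_prob T \<mu>'"
    show "KS_entropy T \<mu>' + ereal (\<integral>x. \<phi> x \<partial>\<mu>') \<le> KS_entropy T \<mu> + ereal (\<integral>x. \<phi> x \<partial>\<mu>)"
      using R project_invariant[OF \<mu>'] unfolding equilibrium_state_def
      by (simp add: KS_entropy_project int \<mu>')
  qed (use R in simp)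
qed

text \<open>Existence and uniqueness of equilibrium states are carried over by the bijection between invariant
measures. The potential \<psi> only has to have the right integrals: this makes room for choices
other than check \<phi>.\<close>

theorem UE_implies_lift:
  fixes ObsX :: "('x \<Rightarrow> real) set" and ObsY :: "('y \<Rightarrow> real) set"
  assumes pot: "\<And>\<phi>. \<phi> \<in> Hol_space \<omega>X \<Longrightarrow> ereal (Hol_norm \<omega>X \<phi>) < \<rho>X \<Longrightarrow> fiber_summable \<phi> \<and>
      (\<exists>\<psi>\<in>Hol_space \<omega>Y. ereal (Hol_norm \<omega>Y \<psi>) < \<rho>Y \<and>
        (\<forall>\<mu>. invariant_prob T \<mu> \<longrightarrow> (\<integral>x. \<phi> x \<partial>\<mu>) = (\<integral>y. \<psi> y \<partial>distr \<mu> borel p)))"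
    and obs: "\<And>f. f \<in> ObsX \<Longrightarrow> fiber_summable f \<and> check f \<in> ObsY"
  shows "UE_implies S T p \<sigma> \<T> \<omega>Y \<rho>Y ObsY \<omega>X \<rho>X ObsX"
  unfolding UE_implies_def
proof (intro allI impI conjI ballI)
  fix s l assume UE: "UE S \<omega>Y \<rho>Y \<T> ObsY s l"
  show "UE T \<omega>X \<rho>X \<T> ObsX (pull_param T p \<sigma> s) (pull_param T p \<sigma> l)"
    unfolding UE_def
  proof (intro ballI impI conjI allI)
    fix \<phi> :: "'x \<Rightarrow> real" assume "\<phi> \<in> Hol_space \<omega>X" "ereal (Hol_norm \<omega>X \<phi>) < \<rho>X"
    then obtain \<psi> :: "'y \<Rightarrow> real" where \<psi>: "\<psi> \<in> Hol_space \<omega>Y" "ereal (Hol_norm \<omega>Y \<psi>) < \<rho>Y"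
      and int: "\<And>\<mu>. invariant_prob T \<mu> \<Longrightarrow> (\<integral>x. \<phi> x \<partial>\<mu>) = (\<integral>y. \<psi> y \<partial>distr \<mu> borel p)"
      using pot by blast
    have iff: "equilibrium_state T \<phi> \<mu> \<longleftrightarrow> invariant_prob T \<mu> \<and> equilibrium_state S \<psi> (distr \<mu> borel p)" for \<mu>
      by (rule equilibrium_state_project_iff[OF int])
    have ex1: "\<exists>!\<nu>. equilibrium_state S \<psi> \<nu>"
      and lt: "\<And>\<nu> f. equilibrium_state S \<psi> \<nu> \<Longrightarrow> f \<in> ObsY \<Longrightarrow> limit_theorem_holds \<T> S \<nu> f (s \<nu> f) (l \<nu> f)"
      using UE \<psi> unfolding UE_def by auto
    obtain \<nu> where \<nu>: "equilibrium_state S \<psi> \<nu>" using ex1 by blast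
    then obtain \<mu> where \<mu>: "invariant_prob T \<mu>" "distr \<mu> borel p = \<nu>"
      using invariant_lift_exists[of \<nu>] unfolding equilibrium_state_def by blast
    show "\<exists>!\<mu>. equilibrium_state T \<phi> \<mu>"
    proof (rule ex1I[of _ \<mu>])
      show "equilibrium_state T \<phi> \<mu>" using \<mu> \<nu> by (simp add: iff)
      fix \<mu>' assume "equilibrium_state T \<phi> \<mu>'"
      then have "invariant_prob T \<mu>'" "distr \<mu>' borel p = \<nu>" using ex1 \<nu> by (auto simp: iff)
      then show "\<mu>' = \<mu>" using \<mu> by (intro invariant_lift_unique) auto
    qed
    fix \<mu> f assume \<mu>: "equilibrium_state T \<phi> \<mu>" and f: "f \<in> ObsX"
    then show "limit_theorem_holds \<T> T \<mu> f (pull_param T p \<sigma> s \<mu> f) (pull_param T p \<sigma> l \<mu> f)"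
      unfolding pull_param_def using obs[OF f] by (intro limit_theorem_lift lt) (auto simp: iff)
  qed
next
  fix \<phi> :: "'x \<Rightarrow> real" and \<mu> assume "\<phi> \<in> Hol_space \<omega>X" "ereal (Hol_norm \<omega>X \<phi>) < \<rho>X" and \<mu>: "equilibrium_state T \<phi> \<mu>"
  then have "fiber_summable \<phi>" using pot by blast
  from equilibrium_state_project_iff[OF integral_check[OF this]] \<mu>
  show "equilibrium_state S (check \<phi>) (distr \<mu> borel p)" by simp
qed

lemma UE_implies_check:
  fixes ObsX :: "('x \<Rightarrow> real) set" and ObsY :: "('y \<Rightarrow> real) set"
  assumes Q: "Q > 0" and \<rho>: "0 < \<rho>"
    and pot: "\<And>f. f \<in> Hol_space \<omega>X \<Longrightarrow> fiber_summable f \<and> check f \<in> Hol_space \<omega>Y \<and> Hol_norm \<omega>Y (check f) \<le> Q * Hol_norm \<omega>X f"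
    and obs: "\<And>f. f \<in> ObsX \<Longrightarrow> fiber_summable f \<and> check f \<in> ObsY"
  shows "\<exists>C>0. UE_implies S T p \<sigma> \<T> \<omega>Y \<rho> ObsY \<omega>X (ereal C * \<rho>) ObsX"
proof (intro exI[of _ "1 / Q"] conjI)
  show "1 / Q > 0" using Q by simp
  show "UE_implies S T p \<sigma> \<T> \<omega>Y \<rho> ObsY \<omega>X (ereal (1 / Q) * \<rho>) ObsX"
  proof (rule UE_implies_lift[OF _ obs])
    fix \<phi> :: "'x \<Rightarrow> real" assume \<phi>: "\<phi> \<in> Hol_space \<omega>X" "ereal (Hol_norm \<omega>X \<phi>) < ereal (1 / Q) * \<rho>"
    have fs: "fiber_summable \<phi>" using pot[OF \<phi>(1)] by simp
    have "ereal (Hol_norm \<omega>Y (check \<phi>)) < \<rho>"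
      by (rule ereal_less_of_scaled[OF Q \<rho> _ \<phi>(2)]) (use pot[OF \<phi>(1)] in simp)
    then show "fiber_summable \<phi> \<and> (\<exists>\<psi>\<in>Hol_space \<omega>Y. ereal (Hol_norm \<omega>Y \<psi>) < \<rho> \<and>
          (\<forall>\<mu>. invariant_prob T \<mu> \<longrightarrow> (\<integral>x. \<phi> x \<partial>\<mu>) = (\<integral>y. \<psi> y \<partial>distr \<mu> borel p)))"
      using pot[OF \<phi>(1)] integral_check[OF fs] by blast
  qed
qed

end

section \<open>Potentials on the base for the three regimes\<close>

context regular_extension
begin

lemma check_exponential_power:
  assumes "L > 1" "0 < \<theta>" "\<theta> < 1" "C > 0" "a = (\<lambda>n. C * \<theta> ^ n)" "0 < \<alpha>"
  obtains Q where "Q > 0" "\<And>f. f \<in> Hol_space (pow_modulus \<alpha>) \<Longrightarrow> fiber_summable f \<and>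
     check f \<in> Hol_space (pow_modulus (\<alpha> * \<beta> / (1 - ln L / ln \<theta>))) \<and>
     Hol_norm (pow_modulus (\<alpha> * \<beta> / (1 - ln L / ln \<theta>))) (check f) \<le> Q * Hol_norm (pow_modulus \<alpha>) f"
proof (rule check_regularity)
  show "weak_modulus (pow_modulus \<alpha>)" by (rule weak_modulus_pow) fact
  show "regularity_criterion (pow_modulus \<alpha>) (pow_modulus (\<alpha> * \<beta> / (1 - ln L / ln \<theta>))) a L M \<beta> D"
    unfolding assms(5) by (intro criterion_power assms M_ge_1 \<beta> D)
qed (auto simp: pow_modulus_def intro: that)

lemma check_polynomial:
  assumes "L > 1" "d > 0" "C > 0" "\<And>n. n \<ge> 1 \<Longrightarrow> a n = C * real n powr (- d)" "0 < \<alpha>" "\<alpha> * d > 1" "r' > 1"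
  obtains Q where "Q > 0" "\<And>f. f \<in> Hol_space (pow_modulus \<alpha>) \<Longrightarrow> fiber_summable f \<and>
     check f \<in> Hol_space (log_modulus r' (\<alpha> * d - 1)) \<and>
     Hol_norm (log_modulus r' (\<alpha> * d - 1)) (check f) \<le> Q * Hol_norm (pow_modulus \<alpha>) f"
proof (rule check_regularity)
  show "weak_modulus (pow_modulus \<alpha>)" by (rule weak_modulus_pow) fact
  show "regularity_criterion (pow_modulus \<alpha>) (log_modulus r' (\<alpha> * d - 1)) a L M \<beta> D"
    by (intro criterion_polynomial[where C=C] assms M_ge_1 \<beta> D)
qed (auto simp: log_modulus_def intro: that)

lemma check_logarithmic:
  assumes "L > 1" "0 < \<theta>" "\<theta> < 1" "C > 0" "a = (\<lambda>n. C * \<theta> ^ n)" "\<alpha> > 1" "r > 1" "r' > 1"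
    "is_modulus (log_modulus r \<alpha>)"
  obtains Q where "Q > 0" "\<And>f. f \<in> Hol_space (log_modulus r \<alpha>) \<Longrightarrow> fiber_summable f \<and>
     check f \<in> Hol_space (log_modulus r' ((\<alpha> - 1) / 2)) \<and>
     Hol_norm (log_modulus r' ((\<alpha> - 1) / 2)) (check f) \<le> Q * Hol_norm (log_modulus r \<alpha>) f"
proof (rule check_regularity)
  show "weak_modulus (log_modulus r \<alpha>)" by (rule weak_modulus_is_modulus) fact
  show "regularity_criterion (log_modulus r \<alpha>) (log_modulus r' ((\<alpha> - 1) / 2)) a L M \<beta> D"
    unfolding assms(5) by (intro criterion_logarithmic assms M_ge_1 \<beta> D)
qed (auto simp: log_modulus_def intro: that)

text \<open>If T does not expand distances, the functions \<phi> o T^n o \<sigma> have a common modulus of continuity, so a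
subsequence converges pointwise: it does so on a countable dense set, by a diagonal argument, and then
everywhere by equicontinuity. By \<open>integral_via_section\<close> the limit has the integrals of \<phi>.\<close>

lemma nonexpansive_potential:
  assumes L1: "L = 1" and \<omega>: "weak_modulus \<omega>" and \<phi>: "\<phi> \<in> Hol_space \<omega>"
  obtains \<psi> where "\<And>y. \<bar>\<psi> y\<bar> \<le> (SUP x. \<bar>\<phi> x\<bar>)"
    "\<And>y y'. \<bar>\<psi> y - \<psi> y'\<bar> \<le> Hol_const \<omega> \<phi> * \<omega> (K * dist y y')"
    "\<And>\<mu>. invariant_prob T \<mu> \<Longrightarrow> (\<integral>x. \<phi> x \<partial>\<mu>) = (\<integral>y. \<psi> y \<partial>distr \<mu> borel p)"
proof -
  define H where "H = Hol_const \<omega> \<phi>"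
  define B where "B = (SUP x. \<bar>\<phi> x\<bar>)"
  have \<phi>c: "continuous_on UNIV \<phi>" by (rule Hol_continuous[OF \<omega> \<phi>])
  have \<phi>m[measurable]: "\<phi> \<in> borel_measurable borel" by (rule borel_measurable_continuous_onI[OF \<phi>c])
  have B: "\<bar>\<phi> x\<bar> \<le> B" for x unfolding B_def by (rule abs_le_SUP[OF \<phi>c])
  have H: "H \<ge> 0" unfolding H_def by (rule Hol_const_bound[OF \<omega> \<phi>])
  define g where "g n y = \<phi> ((T ^^ n) (\<sigma> y))" for n y
  have gm[measurable]: "g n \<in> borel_measurable borel" for n unfolding g_def by measurable
  have gH: "\<bar>g n y - g n y'\<bar> \<le> H * \<omega> (K * dist y y')" for n y y'
  proof -
    have "dist ((T ^^ n) (\<sigma> y)) ((T ^^ n) (\<sigma> y')) \<le> K * dist y y'"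
      using T_pow_lip[of n "\<sigma> y" "\<sigma> y'"] \<sigma>_lip[of y y'] unfolding L1 by simp
    then have "\<omega> (dist ((T ^^ n) (\<sigma> y)) ((T ^^ n) (\<sigma> y'))) \<le> \<omega> (K * dist y y')"
      by (intro weak_modulus_mono[OF \<omega>]) auto
    then show ?thesis
      unfolding g_def H_def by (rule order_trans[OF Hol_const_bound(2)[OF \<omega> \<phi>] mult_left_mono])
        (rule Hol_const_bound(1)[OF \<omega> \<phi>])
  qed
  obtain D0 :: "'y set" where D0: "countable D0" "closure D0 = UNIV"
    by (rule compact_metric_countable_dense[OF compact_Y])
  obtain k where k: "strict_mono (k :: nat \<Rightarrow> nat)" "\<And>y. y \<in> D0 \<Longrightarrow> \<exists>l. (\<lambda>n. g (k n) y) \<longlonglongrightarrow> l"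
  proof (rule function_convergent_subsequence[OF D0(1)])
    show "norm (g n y) \<le> B" for n y unfolding g_def using B by simp
  qed (rule that)
  have conv: "convergent (\<lambda>n. g (k n) y)" for y
  proof (rule Cauchy_convergent, rule metric_CauchyI)
    fix e :: real assume e: "e > 0"
    \<comment> \<open>Adding 1 to H avoids a division by 0.\<close>
    define e' where "e' = e / (3 * (H + 1))"
    have e': "e' > 0" using e H by (simp add: e'_def)
    obtain d where d: "d > 0" "\<And>x. 0 \<le> x \<Longrightarrow> x < d \<Longrightarrow> \<omega> x < e'" using weak_modulus_small[OF \<omega> e'] by blast
    have "y \<in> closure D0" using D0 by simp
    then obtain z where z: "z \<in> D0" "dist z y < d / K"
      unfolding closure_approachable using d(1) K by (metis divide_pos_pos less_le_trans zero_less_one)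
    have near: "\<bar>g n y - g n z\<bar> < e / 3" for n
    proof -
      have "\<omega> (K * dist y z) < e'" using z K by (intro d(2)) (auto simp: field_simps dist_commute)
      have "\<bar>g n y - g n z\<bar> \<le> H * \<omega> (K * dist y z)" by (rule gH)
      also have "\<dots> \<le> H * e'" using \<open>\<omega> (K * dist y z) < e'\<close> H by (intro mult_left_mono) auto
      also have "\<dots> < (H + 1) * e'" using e' by (simp add: distrib_right)
      also have "\<dots> = e / 3" using H by (simp add: e'_def field_simps)
      finally show ?thesis .
    qed
    have "Cauchy (\<lambda>n. g (k n) z)" using k(2)[OF z(1)] convergent_Cauchy unfolding convergent_def by blast
    then obtain N where N: "\<And>m n. m \<ge> N \<Longrightarrow> n \<ge> N \<Longrightarrow> dist (g (k m) z) (g (k n) z) < e / 3"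
      using e unfolding Cauchy_def by (metis divide_pos_pos zero_less_numeral)
    have "dist (g (k m) y) (g (k n) y) < e" if "m \<ge> N" "n \<ge> N" for m n
      using near[of "k m"] near[of "k n"] N[OF that] unfolding dist_real_def by linarith
    then show "\<exists>N. \<forall>m\<ge>N. \<forall>n\<ge>N. dist (g (k m) y) (g (k n) y) < e" by blast
  qed
  define \<psi> where "\<psi> y = lim (\<lambda>n. g (k n) y)" for y
  have lim: "(\<lambda>n. g (k n) y) \<longlonglongrightarrow> \<psi> y" for y
    unfolding \<psi>_def using conv[of y] by (simp add: convergent_LIMSEQ_iff)
  show thesis
  proof (rule that[of \<psi>])
    show "\<bar>\<psi> y\<bar> \<le> (SUP x. \<bar>\<phi> x\<bar>)" for y
      unfolding B_def[symmetric]
      by (rule LIMSEQ_le_const2[OF tendsto_rabs[OF lim]]) (auto simp: g_def B)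
    show "\<bar>\<psi> y - \<psi> y'\<bar> \<le> Hol_const \<omega> \<phi> * \<omega> (K * dist y y')" for y y'
      unfolding H_def[symmetric]
      by (rule LIMSEQ_le_const2[OF tendsto_rabs[OF tendsto_diff[OF lim lim]]]) (auto simp: gH)
    fix \<mu> assume \<mu>: "invariant_prob T \<mu>"
    interpret \<nu>: prob_space "distr \<mu> borel p" using project_invariant[OF \<mu>] by (simp add: invariant_prob_def)
    have "(\<lambda>n. \<integral>y. g (k n) y \<partial>distr \<mu> borel p) \<longlonglongrightarrow> (\<integral>y. \<psi> y \<partial>distr \<mu> borel p)"
    proof (rule integral_dominated_convergence[where w="\<lambda>_. B"])
      show "\<psi> \<in> borel_measurable (distr \<mu> borel p)"
        by (rule borel_measurable_LIMSEQ_real[OF lim]) measurable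
    qed (auto simp: lim, auto simp: g_def B)
    moreover have "(\<lambda>n. \<integral>y. g (k n) y \<partial>distr \<mu> borel p) \<longlonglongrightarrow> (\<integral>x. \<phi> x \<partial>\<mu>)"
      using LIMSEQ_subseq_LIMSEQ[OF integral_via_section[OF \<mu> \<phi>c] k(1)] by (simp add: g_def comp_def)
    ultimately show "(\<integral>x. \<phi> x \<partial>\<mu>) = (\<integral>y. \<psi> y \<partial>distr \<mu> borel p)" by (rule LIMSEQ_unique[symmetric])
  qed
qed

text \<open>The limit is Hoelder of exponent \<alpha>, hence of exponent \<alpha> \<beta> since the base is bounded.\<close>

lemma nonexpansive_power_potential:
  assumes L1: "L = 1" and \<alpha>: "0 < \<alpha>" and \<phi>: "\<phi> \<in> Hol_space (pow_modulus \<alpha>)"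
  shows "\<exists>\<psi>\<in>Hol_space (pow_modulus (\<alpha> * \<beta>)).
      Hol_norm (pow_modulus (\<alpha> * \<beta>)) \<psi> \<le> (1 + K powr \<alpha> * D powr (\<alpha> - \<alpha> * \<beta>)) * Hol_norm (pow_modulus \<alpha>) \<phi> \<and>
      (\<forall>\<mu>. invariant_prob T \<mu> \<longrightarrow> (\<integral>x. \<phi> x \<partial>\<mu>) = (\<integral>y. \<psi> y \<partial>distr \<mu> borel p))"
proof -
  note \<omega> = weak_modulus_pow[OF \<alpha>]
  define H where "H = Hol_const (pow_modulus \<alpha>) \<phi>"
  define F where "F = (SUP x. \<bar>\<phi> x\<bar>)"
  define Q where "Q = K powr \<alpha> * D powr (\<alpha> - \<alpha> * \<beta>)"
  have H: "H \<ge> 0" unfolding H_def by (rule Hol_const_bound[OF \<omega> \<phi>])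
  have Q: "Q \<ge> 0" unfolding Q_def by simp
  obtain \<psi> where \<psi>: "\<And>y. \<bar>\<psi> y\<bar> \<le> F" "\<And>y y'. \<bar>\<psi> y - \<psi> y'\<bar> \<le> H * pow_modulus \<alpha> (K * dist y y')"
    "\<And>\<mu>. invariant_prob T \<mu> \<Longrightarrow> (\<integral>x. \<phi> x \<partial>\<mu>) = (\<integral>y. \<psi> y \<partial>distr \<mu> borel p)"
    by (rule nonexpansive_potential[OF L1 \<omega> \<phi>, folded H_def F_def]) (rule that)
  have F: "F \<ge> 0" using \<psi>(1)[of undefined] by linarith
  have pw: "pow_modulus \<alpha> (K * dist y y') \<le> Q * pow_modulus (\<alpha> * \<beta>) (dist y y')" for y y' :: 'y
  proof (cases "y = y'")
    case False
    let ?t = "dist y y'"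
    have t: "?t > 0" using False by simp
    have "\<alpha> * \<beta> \<le> \<alpha>" using \<alpha> \<beta> by (simp add: mult_le_cancel_left1)
    then have "?t powr (\<alpha> - \<alpha> * \<beta>) \<le> D powr (\<alpha> - \<alpha> * \<beta>)" using t diam by (intro powr_mono2) auto
    then have "K powr \<alpha> * (?t powr (\<alpha> - \<alpha> * \<beta>) * ?t powr (\<alpha> * \<beta>)) \<le> K powr \<alpha> * (D powr (\<alpha> - \<alpha> * \<beta>) * ?t powr (\<alpha> * \<beta>))"
      by (intro mult_left_mono mult_right_mono) auto
    then show ?thesis using t K by (simp add: pow_modulus_def Q_def powr_mult powr_add[symmetric] mult.assoc)
  qed (simp add: pow_modulus_def)
  have hol: "\<bar>\<psi> y - \<psi> y'\<bar> \<le> (H * Q) * pow_modulus (\<alpha> * \<beta>) (dist y y')" for y y'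
    using order_trans[OF \<psi>(2) mult_left_mono[OF pw H]] by (simp add: mult.assoc)
  have HQ: "0 \<le> H * Q" using H Q by simp
  have "\<psi> \<in> Hol_space (pow_modulus (\<alpha> * \<beta>))"
    by (rule Hol_norm_le(1)) (rule \<psi>(1), rule HQ, rule hol)
  moreover have "Hol_norm (pow_modulus (\<alpha> * \<beta>)) \<psi> \<le> F + H * Q"
    by (rule Hol_norm_le(2)) (rule \<psi>(1), rule HQ, rule hol)
  moreover have "F + H * Q \<le> (1 + Q) * Hol_norm (pow_modulus \<alpha>) \<phi>"
  proof -
    have "(1 + Q) * (F + H) = F + H * Q + (H + Q * F)" by (simp add: algebra_simps)
    moreover have "0 \<le> H + Q * F" using H Q F by simp
    ultimately show ?thesis unfolding Hol_norm_def F_def[symmetric] H_def[symmetric] by linarith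
  qed
  ultimately show ?thesis using \<psi>(3) unfolding Q_def[symmetric] by (intro bexI[of _ \<psi>]) auto
qed

end

section \<open>The transfer theorem\<close>

theorem theorem3:
  fixes T :: "'x::metric_space \<Rightarrow> 'x"
    and S :: "'y::metric_space \<Rightarrow> 'y"
    and p :: "'x \<Rightarrow> 'y"
    and \<sigma> :: "'y \<Rightarrow> 'x"
    and L \<beta> :: real
    and r :: "real \<Rightarrow> real"
    and \<T> :: limit_theorem
    and \<rho> :: ereal
  assumes "compact (UNIV :: 'x set)" and "compact (UNIV :: 'y set)"
    and "T \<in> borel_measurable borel" and "S \<in> borel_measurable borel"
    and "continuous_on UNIV p" and "surj p" and "p \<circ> T = S \<circ> p"
    and "L \<ge> 1" and "L-lipschitz_on UNIV T"
    and "0 < \<beta>" and "\<beta> \<le> 1" and "mod_continuous (pow_modulus \<beta>) p"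
    and "p \<circ> \<sigma> = id" and "\<exists>K. K-lipschitz_on UNIV \<sigma>"
    and "0 < \<rho>"
    and "\<forall>a>0. admissible_log_const (r a) a"
  shows "(\<forall>\<theta> \<alpha> \<gamma>. exp_shrinking_fibers T p \<theta> \<longrightarrow> 0 < \<alpha> \<longrightarrow> \<alpha> \<le> 1 \<longrightarrow>
           \<gamma> = \<alpha> * \<beta> / (1 - ln L / ln \<theta>) \<longrightarrow>
           (\<exists>C>0. UE_implies S T p \<sigma> \<T>
              (pow_modulus \<gamma>) \<rho> Holder_functions
              (pow_modulus \<alpha>) (ereal C * \<rho>) Holder_functions)) \<and>
         (\<forall>d \<alpha> \<gamma> \<alpha>' \<gamma>'. d > 1 \<longrightarrow> poly_shrinking_fibers T p d \<longrightarrow>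
           \<alpha> \<in> {1 / d<..1} \<longrightarrow> \<gamma> \<in> {1 / d<..1} \<longrightarrow> \<alpha>' = \<alpha> * d - 1 \<longrightarrow> \<gamma>' = \<gamma> * d - 1 \<longrightarrow>
           (\<exists>C>0. UE_implies S T p \<sigma> \<T>
              (log_modulus (r \<alpha>') \<alpha>') \<rho> (Hol_space (log_modulus (r \<gamma>') \<gamma>'))
              (pow_modulus \<alpha>) (ereal C * \<rho>) (Hol_space (pow_modulus \<gamma>)))) \<and>
         (\<forall>\<theta> \<alpha> \<gamma> \<alpha>' \<gamma>'. exp_shrinking_fibers T p \<theta> \<longrightarrow> \<alpha> > 1 \<longrightarrow> \<gamma> > 1 \<longrightarrow>
           \<alpha>' = (\<alpha> - 1) / 2 \<longrightarrow> \<gamma>' = (\<gamma> - 1) / 2 \<longrightarrow>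
           (\<exists>C>0. UE_implies S T p \<sigma> \<T>
              (log_modulus (r \<alpha>') \<alpha>') \<rho> (Hol_space (log_modulus (r \<gamma>') \<gamma>'))
              (log_modulus (r \<alpha>) \<alpha>) (ereal C * \<rho>) (Hol_space (log_modulus (r \<gamma>) \<gamma>))))"
proof -
  have equivariant: "p (T x) = S (p x)" for x using assms(7) by (metis comp_apply)
  have sect: "p (\<sigma> y) = y" for y using assms(13) by (metis comp_apply id_apply)
  obtain K0 where K0: "K0-lipschitz_on UNIV \<sigma>" using assms(14) by auto
  define K where "K = max K0 1"
  have K: "K \<ge> 1" "dist (\<sigma> y) (\<sigma> y') \<le> K * dist y y'" for y y'
  proof -
    show "K \<ge> 1" by (simp add: K_def)
    have "dist (\<sigma> y) (\<sigma> y') \<le> K0 * dist y y'" by (rule lipschitz_onD[OF K0]) auto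
    also have "\<dots> \<le> K * dist y y'" by (intro mult_right_mono) (auto simp: K_def)
    finally show "dist (\<sigma> y) (\<sigma> y') \<le> K * dist y y'" .
  qed
  obtain P0 where P0: "\<And>x x'. dist (p x) (p x') \<le> P0 * pow_modulus \<beta> (dist x x')"
    using assms(12) unfolding mod_continuous_def by auto
  define P where "P = max P0 1"
  have P: "P \<ge> 1" "dist (p x) (p x') \<le> P * dist x x' powr \<beta>" for x x'
  proof -
    show "P \<ge> 1" by (simp add: P_def)
    have "dist (p x) (p x') \<le> P0 * dist x x' powr \<beta>" using P0 by (simp add: pow_modulus_def)
    also have "\<dots> \<le> P * dist x x' powr \<beta>" by (intro mult_right_mono) (auto simp: P_def)
    finally show "dist (p x) (p x') \<le> P * dist x x' powr \<beta>" .
  qed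
  have "bounded (UNIV :: 'y set)" by (rule compact_imp_bounded[OF assms(2)])
  then obtain D0 where D0: "\<And>y y' :: 'y. dist y y' \<le> D0" unfolding bounded_two_points by auto
  define D where "D = max D0 1"
  have D: "D \<ge> 1" "dist y y' \<le> D" for y y' :: 'y using D0[of y y'] by (auto simp: D_def)
  have ext: "shrinking_extension T S p \<sigma> a" if a: "shrinking_fibers T p a" for a
  proof
    show "continuous_on UNIV T" by (rule lipschitz_on_continuous_on[OF assms(9)])
    show "continuous_on UNIV \<sigma>" by (rule lipschitz_on_continuous_on[OF K0])
    show "dist ((T ^^ n) x) ((T ^^ n) x') \<le> a n" if "p x = p x'" for x x' n
      using a that by (auto simp: shrinking_fibers_def)
    show "a \<longlonglongrightarrow> 0" using a by (simp add: shrinking_fibers_def)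
  qed (use assms equivariant sect in auto)
  have reg: "regular_extension T S p \<sigma> a L' K P \<beta> D" if a: "shrinking_fibers T p a" and L': "L \<le> L'" for a L'
  proof -
    interpret shrinking_extension T S p \<sigma> a by (rule ext[OF a])
    show ?thesis
    proof
      show "1 \<le> L'" using L' assms(8) by simp
      show "dist (T x) (T x') \<le> L' * dist x x'" for x x'
      proof -
        have "dist (T x) (T x') \<le> L * dist x x'" by (rule lipschitz_onD[OF assms(9)]) auto
        also have "\<dots> \<le> L' * dist x x'" using L' by (intro mult_right_mono) auto
        finally show ?thesis .
      qed
    qed (use K P D assms(10,11) in auto)
  qed
  \<comment> \<open>For observables any exponent will do, and the logarithmic target moduli are the same for all L, so L may be enlarged to have L > 1.\<close>
  define L2 where "L2 = max L 2"
  have L2: "L \<le> L2" "L2 > 1" by (auto simp: L2_def)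
  have r1: "r b > 1" and rm: "is_modulus (log_modulus (r b) b)" if "b > 0" for b
    using assms(16) that by (auto simp: admissible_log_const_def)
  show ?thesis
  proof (intro conjI allI impI)
    fix \<theta> \<alpha> \<gamma> :: real assume exp: "exp_shrinking_fibers T p \<theta>" and \<alpha>: "0 < \<alpha>" "\<alpha> \<le> 1"
      and \<gamma>: "\<gamma> = \<alpha> * \<beta> / (1 - ln L / ln \<theta>)"
    obtain C where \<theta>: "0 < \<theta>" "\<theta> < 1" and sh: "shrinking_fibers T p (\<lambda>n. C * \<theta> ^ n)"
      using exp unfolding exp_shrinking_fibers_def by blast
    have "\<forall>n. C * \<theta> ^ n > 0" using sh by (simp add: shrinking_fibers_def)
    from spec[OF this, of 0] have C: "C > 0" by simp
    interpret E: shrinking_extension T S p \<sigma> "\<lambda>n. C * \<theta> ^ n" by (rule ext[OF sh])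
    have obs: "E.fiber_summable f \<and> E.check f \<in> Holder_functions" if f: "f \<in> Holder_functions" for f
    proof -
      obtain \<delta> where \<delta>: "0 < \<delta>" "\<delta> \<le> 1" and f\<delta>: "f \<in> Hol_space (pow_modulus \<delta>)"
        using f unfolding Holder_functions_def by auto
      define \<gamma>' where "\<gamma>' = \<delta> * \<beta> / (1 - ln L2 / ln \<theta>)"
      have "E.fiber_summable f \<and> E.check f \<in> Hol_space (pow_modulus \<gamma>')"
        unfolding \<gamma>'_def
        using regular_extension.check_exponential_power[OF reg[OF sh L2(1)] L2(2) \<theta> C refl \<delta>(1)] f\<delta> by metis
      moreover have "0 < \<gamma>'" "\<gamma>' \<le> 1"
      proof -
        have "ln L2 / ln \<theta> < 0" using L2 \<theta> by (intro divide_pos_neg) auto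
        then have den: "1 - ln L2 / ln \<theta> \<ge> 1" by simp
        have num: "0 < \<delta> * \<beta>" "\<delta> * \<beta> \<le> 1" using \<delta> assms(10,11) mult_mono[of \<delta> 1 \<beta> 1] by auto
        show "0 < \<gamma>'" unfolding \<gamma>'_def using num den by (intro divide_pos_pos) auto
        show "\<gamma>' \<le> 1" unfolding \<gamma>'_def
          using num den by (subst divide_le_eq_1_pos) linarith+
      qed
      ultimately show ?thesis unfolding Holder_functions_def by auto
    qed
    show "\<exists>C>0. UE_implies S T p \<sigma> \<T> (pow_modulus \<gamma>) \<rho> Holder_functions
        (pow_modulus \<alpha>) (ereal C * \<rho>) Holder_functions"
    proof (cases "L = 1")
      case False
      then have L: "L > 1" using assms(8) by simp
      obtain Q where Q: "Q > 0" "\<And>f. f \<in> Hol_space (pow_modulus \<alpha>) \<Longrightarrow> E.fiber_summable f \<and>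
         E.check f \<in> Hol_space (pow_modulus \<gamma>) \<and> Hol_norm (pow_modulus \<gamma>) (E.check f) \<le> Q * Hol_norm (pow_modulus \<alpha>) f"
        by (rule regular_extension.check_exponential_power[OF reg[OF sh order_refl] L \<theta> C refl \<alpha>(1), folded \<gamma>]) (rule that)
      show ?thesis by (rule E.UE_implies_check[OF Q(1) assms(15) Q(2) obs])
    next
      case True
      have \<gamma>1: "\<gamma> = \<alpha> * \<beta>" unfolding \<gamma> True by simp
      \<comment> \<open>For potentials the exponent is prescribed, so L cannot be enlarged here.\<close>
      define Q where "Q = 1 + K powr \<alpha> * D powr (\<alpha> - \<alpha> * \<beta>)"
      have Q: "Q > 0" unfolding Q_def by (simp add: add_pos_nonneg)
      have summ: "E.fiber_summable f" if "f \<in> Hol_space (pow_modulus \<alpha>)" for f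
        using that regular_extension.check_exponential_power[OF reg[OF sh L2(1)] L2(2) \<theta> C refl \<alpha>(1)] by metis
      have "UE_implies S T p \<sigma> \<T> (pow_modulus \<gamma>) \<rho> Holder_functions (pow_modulus \<alpha>) (ereal (1 / Q) * \<rho>) Holder_functions"
      proof (rule E.UE_implies_lift[OF _ obs])
        fix \<phi> :: "'x \<Rightarrow> real" assume \<phi>: "\<phi> \<in> Hol_space (pow_modulus \<alpha>)"
          "ereal (Hol_norm (pow_modulus \<alpha>) \<phi>) < ereal (1 / Q) * \<rho>"
        obtain \<psi> where \<psi>: "\<psi> \<in> Hol_space (pow_modulus \<gamma>)"
          "Hol_norm (pow_modulus \<gamma>) \<psi> \<le> Q * Hol_norm (pow_modulus \<alpha>) \<phi>"
          "\<forall>\<mu>. invariant_prob T \<mu> \<longrightarrow> (\<integral>x. \<phi> x \<partial>\<mu>) = (\<integral>y. \<psi> y \<partial>distr \<mu> borel p)"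
          using regular_extension.nonexpansive_power_potential[OF reg[OF sh order_refl] True \<alpha>(1) \<phi>(1)]
          unfolding \<gamma>1 Q_def by blast
        have "ereal (Hol_norm (pow_modulus \<gamma>) \<psi>) < \<rho>"
          by (rule ereal_less_of_scaled[OF Q assms(15) \<psi>(2) \<phi>(2)])
        then show "E.fiber_summable \<phi> \<and> (\<exists>\<psi>\<in>Hol_space (pow_modulus \<gamma>). ereal (Hol_norm (pow_modulus \<gamma>) \<psi>) < \<rho> \<and>
            (\<forall>\<mu>. invariant_prob T \<mu> \<longrightarrow> (\<integral>x. \<phi> x \<partial>\<mu>) = (\<integral>y. \<psi> y \<partial>distr \<mu> borel p)))"
          using summ[OF \<phi>(1)] \<psi> by blast
      qed
      then show ?thesis using Q by (intro exI[of _ "1 / Q"]) simp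
    qed
  next
    fix d \<alpha> \<gamma> \<alpha>' \<gamma>' :: real assume d: "d > 1" and poly: "poly_shrinking_fibers T p d"
      and \<alpha>: "\<alpha> \<in> {1 / d<..1}" and \<gamma>: "\<gamma> \<in> {1 / d<..1}" and \<alpha>': "\<alpha>' = \<alpha> * d - 1" and \<gamma>': "\<gamma>' = \<gamma> * d - 1"
    obtain a C where sh: "shrinking_fibers T p a" and a: "\<And>n. n \<ge> 1 \<Longrightarrow> a n = C * real n powr (- d)"
      using poly unfolding poly_shrinking_fibers_def by blast
    have "a 1 > 0" using sh by (simp add: shrinking_fibers_def)
    then have C: "C > 0" using a[of 1] by simp
    have d0: "d > 0" using d by simp
    have pos: "0 < b" "b * d > 1" if "b \<in> {1 / d<..1}" for b
    proof -
      have "1 / d < b" using that by simp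
      then show "b * d > 1" using d0 by (simp add: field_simps)
      have "0 < 1 / d" using d0 by simp
      then show "0 < b" using \<open>1 / d < b\<close> by linarith
    qed
    interpret E: shrinking_extension T S p \<sigma> a by (rule ext[OF sh])
    have chk: "\<exists>Q>0. \<forall>f\<in>Hol_space (pow_modulus b). E.fiber_summable f \<and>
         E.check f \<in> Hol_space (log_modulus (r (b * d - 1)) (b * d - 1)) \<and>
         Hol_norm (log_modulus (r (b * d - 1)) (b * d - 1)) (E.check f) \<le> Q * Hol_norm (pow_modulus b) f"
      if b: "b \<in> {1 / d<..1}" for b
    proof -
      have "r (b * d - 1) > 1" using pos[OF b] by (intro r1) simp
      from regular_extension.check_polynomial[OF reg[OF sh L2(1)] L2(2) d0 C a pos[OF b] this]
      show ?thesis by metis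
    qed
    obtain Q where Q: "Q > 0" "\<And>f. f \<in> Hol_space (pow_modulus \<alpha>) \<Longrightarrow> E.fiber_summable f \<and>
         E.check f \<in> Hol_space (log_modulus (r \<alpha>') \<alpha>') \<and>
         Hol_norm (log_modulus (r \<alpha>') \<alpha>') (E.check f) \<le> Q * Hol_norm (pow_modulus \<alpha>) f"
      using chk[OF \<alpha>] unfolding \<alpha>' by blast
    show "\<exists>C>0. UE_implies S T p \<sigma> \<T> (log_modulus (r \<alpha>') \<alpha>') \<rho> (Hol_space (log_modulus (r \<gamma>') \<gamma>'))
        (pow_modulus \<alpha>) (ereal C * \<rho>) (Hol_space (pow_modulus \<gamma>))"
      by (rule E.UE_implies_check[OF Q(1) assms(15) Q(2)]) (use chk[OF \<gamma>] in \<open>auto simp: \<gamma>'\<close>)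
  next
    fix \<theta> \<alpha> \<gamma> \<alpha>' \<gamma>' :: real assume exp: "exp_shrinking_fibers T p \<theta>" and \<alpha>: "\<alpha> > 1" and \<gamma>: "\<gamma> > 1"
      and \<alpha>': "\<alpha>' = (\<alpha> - 1) / 2" and \<gamma>': "\<gamma>' = (\<gamma> - 1) / 2"
    obtain C where \<theta>: "0 < \<theta>" "\<theta> < 1" and sh: "shrinking_fibers T p (\<lambda>n. C * \<theta> ^ n)"
      using exp unfolding exp_shrinking_fibers_def by blast
    have "\<forall>n. C * \<theta> ^ n > 0" using sh by (simp add: shrinking_fibers_def)
    from spec[OF this, of 0] have C: "C > 0" by simp
    interpret E: shrinking_extension T S p \<sigma> "\<lambda>n. C * \<theta> ^ n" by (rule ext[OF sh])
    have chk: "\<exists>Q>0. \<forall>f\<in>Hol_space (log_modulus (r b) b). E.fiber_summable f \<and>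
         E.check f \<in> Hol_space (log_modulus (r ((b - 1) / 2)) ((b - 1) / 2)) \<and>
         Hol_norm (log_modulus (r ((b - 1) / 2)) ((b - 1) / 2)) (E.check f) \<le> Q * Hol_norm (log_modulus (r b) b) f"
      if b: "b > 1" for b
    proof -
      have "r b > 1" "r ((b - 1) / 2) > 1" "is_modulus (log_modulus (r b) b)" using b by (auto intro!: r1 rm)
      from regular_extension.check_logarithmic[OF reg[OF sh L2(1)] L2(2) \<theta> C refl b this]
      show ?thesis by metis
    qed
    obtain Q where Q: "Q > 0" "\<And>f. f \<in> Hol_space (log_modulus (r \<alpha>) \<alpha>) \<Longrightarrow> E.fiber_summable f \<and>
         E.check f \<in> Hol_space (log_modulus (r \<alpha>') \<alpha>') \<and>
         Hol_norm (log_modulus (r \<alpha>') \<alpha>') (E.check f) \<le> Q * Hol_norm (log_modulus (r \<alpha>) \<alpha>) f"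
      using chk[OF \<alpha>] unfolding \<alpha>' by blast
    show "\<exists>C>0. UE_implies S T p \<sigma> \<T> (log_modulus (r \<alpha>') \<alpha>') \<rho> (Hol_space (log_modulus (r \<gamma>') \<gamma>'))
        (log_modulus (r \<alpha>) \<alpha>) (ereal C * \<rho>) (Hol_space (log_modulus (r \<gamma>) \<gamma>))"
      by (rule E.UE_implies_check[OF Q(1) assms(15) Q(2)]) (use chk[OF \<gamma>] in \<open>auto simp: \<gamma>'\<close>)
  qed
qed

end
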